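(* Let $R$ be a ring. The generating hypothesis holds for $\mathsf{D}(R)$ if and only if $\mathscr{S}\cap\mathsf{mod}(\mathsf{D}(R)^{\mathrm{c}})=0$. In particular, if $R$ is right coherent, then $\mathsf{D}(R)$ satisfies the generating hypothesis if and only if $R$ is von Neumann regular.
   Context: Rings are unital and associative; $\mathsf{D}(R)$ is the unbounded derived category of right $R$-modules, with shift $\Sigma$, and $\mathsf{D}(R)^{\mathrm{c}}$ is its full subcategory of compact objects (perfect complexes). $\mathsf{Mod}(\mathsf{D}(R)^{\mathrm{c}})$ is the category of additive functors $(\mathsf{D}(R)^{\mathrm{c}})^{\mathrm{op}}\to\mathsf{Ab}$ and $\mathsf{mod}(\mathsf{D}(R)^{\mathrm{c}})$ its full subcategory of finitely presented objects. Set \[ \mathscr{S}=\{f\in\mathsf{Mod}(\mathsf{D}(R)^{\mathrm{c}}): f(\Sigma^{i}R)=0\text{ for all }i\in\mathbb{Z}\}. \] The generating hypothesis for $\mathsf{D}(R)$ is the statement: if $f\colon C\to D$ is a morphism of perfect complexes such that $\mathrm{Hom}_{\mathsf{D}(R)}(\Sigma^i R,f)\colon\mathrm{Hom}_{\mathsf{D}(R)}(\Sigma^i R,C)\to\mathrm{Hom}_{\mathsf{D}(R)}(\Sigma^i R,D)$ is zero for all $i\in\mathbb{Z}$, then $f=0$ in $\mathsf{D}(R)$. A ring $R$ is von Neumann regular if for every $x\in R$ there is $y\in R$ with $x=xyx$. *)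

theory Defs
  imports "HOL-Algebra.AbelCoset" "HOL-Library.FuncSet"
begin

section \<open>Right modules over a (not necessarily commutative) ring\<close>

text \<open>As in the library's record of left modules, the abelian group underlying a module is a ring
  record of which only the additive part is used; the fields \<open>mult\<close> and \<open>one\<close> carry no information.\<close>

record ('a, 'b) rmod = "'b ring" +
  rsmult :: "'b \<Rightarrow> 'a \<Rightarrow> 'b" (infixl \<open>\<cdot>\<index>\<close> 70)

locale right_module = R?: ring R + M?: abelian_group M
  for R :: "('a, 'm) ring_scheme" (structure) and M :: "('a, 'b) rmod" (structure) +
  assumes rsmult_closed: "\<lbrakk>x \<in> carrier M; r \<in> carrier R\<rbrakk> \<Longrightarrow> x \<cdot>\<^bsub>M\<^esub> r \<in> carrier M"
    and rsmult_distr_module: "\<lbrakk>x \<in> carrier M; y \<in> carrier M; r \<in> carrier R\<rbrakk> \<Longrightarrow>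
      (x \<oplus>\<^bsub>M\<^esub> y) \<cdot>\<^bsub>M\<^esub> r = x \<cdot>\<^bsub>M\<^esub> r \<oplus>\<^bsub>M\<^esub> y \<cdot>\<^bsub>M\<^esub> r"
    and rsmult_distr_ring: "\<lbrakk>x \<in> carrier M; r \<in> carrier R; s \<in> carrier R\<rbrakk> \<Longrightarrow>
      x \<cdot>\<^bsub>M\<^esub> (r \<oplus>\<^bsub>R\<^esub> s) = x \<cdot>\<^bsub>M\<^esub> r \<oplus>\<^bsub>M\<^esub> x \<cdot>\<^bsub>M\<^esub> s"
    and rsmult_assoc: "\<lbrakk>x \<in> carrier M; r \<in> carrier R; s \<in> carrier R\<rbrakk> \<Longrightarrow>
      x \<cdot>\<^bsub>M\<^esub> (r \<otimes>\<^bsub>R\<^esub> s) = (x \<cdot>\<^bsub>M\<^esub> r) \<cdot>\<^bsub>M\<^esub> s"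
    and rsmult_one: "x \<in> carrier M \<Longrightarrow> x \<cdot>\<^bsub>M\<^esub> \<one>\<^bsub>R\<^esub> = x"

definition rmod_hom ::
    "('a, 'm) ring_scheme \<Rightarrow> ('a, 'b) rmod \<Rightarrow> ('a, 'c) rmod \<Rightarrow> ('b \<Rightarrow> 'c) set" where
  "rmod_hom R M N = {f \<in> carrier M \<rightarrow> carrier N.
     (\<forall>x\<in>carrier M. \<forall>y\<in>carrier M. f (x \<oplus>\<^bsub>M\<^esub> y) = f x \<oplus>\<^bsub>N\<^esub> f y) \<and>
     (\<forall>x\<in>carrier M. \<forall>r\<in>carrier R. f (x \<cdot>\<^bsub>M\<^esub> r) = f x \<cdot>\<^bsub>N\<^esub> r)}"

definition regular_rmod :: "('a, 'm) ring_scheme \<Rightarrow> ('a, 'a) rmod" where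
  "regular_rmod R = \<lparr>carrier = carrier R, mult = (\<otimes>\<^bsub>R\<^esub>), one = \<one>\<^bsub>R\<^esub>,
     zero = \<zero>\<^bsub>R\<^esub>, add = (\<oplus>\<^bsub>R\<^esub>), rsmult = (\<otimes>\<^bsub>R\<^esub>)\<rparr>"

definition zero_rmod :: "('a, 'm) ring_scheme \<Rightarrow> ('a, 'a) rmod" where
  "zero_rmod R = (regular_rmod R)\<lparr>carrier := {\<zero>\<^bsub>R\<^esub>}\<rparr>"

definition free_rmod :: "('a, 'm) ring_scheme \<Rightarrow> nat \<Rightarrow> ('a, nat \<Rightarrow> 'a) rmod" where
  "free_rmod R n = \<lparr>carrier = {..<n} \<rightarrow>\<^sub>E carrier R, mult = undefined, one = undefined,
     zero = (\<lambda>i\<in>{..<n}. \<zero>\<^bsub>R\<^esub>), add = (\<lambda>x y. \<lambda>i\<in>{..<n}. x i \<oplus>\<^bsub>R\<^esub> y i),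
     rsmult = (\<lambda>x r. \<lambda>i\<in>{..<n}. x i \<otimes>\<^bsub>R\<^esub> r)\<rparr>"

definition fg_rmod :: "('a, 'm) ring_scheme \<Rightarrow> ('a, 'b) rmod \<Rightarrow> bool" where
  "fg_rmod R M \<longleftrightarrow> (\<exists>S. finite S \<and> S \<subseteq> carrier M \<and>
     (\<forall>x\<in>carrier M. \<exists>c\<in>S \<rightarrow> carrier R. x = (\<Oplus>\<^bsub>M\<^esub>s\<in>S. s \<cdot>\<^bsub>M\<^esub> c s)))"

definition fp_rmod :: "('a, 'm) ring_scheme \<Rightarrow> ('a, 'b) rmod \<Rightarrow> bool" where
  "fp_rmod R M \<longleftrightarrow> (\<exists>n. \<exists>\<phi>\<in>rmod_hom R (free_rmod R n) M.
     \<phi> ` carrier (free_rmod R n) = carrier M \<and>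
     fg_rmod R ((free_rmod R n)\<lparr>carrier := {x \<in> carrier (free_rmod R n). \<phi> x = \<zero>\<^bsub>M\<^esub>}\<rparr>))"

text \<open>Projectivity is the lifting property with respect to surjections of modules living in the
  same universe (type) \<open>'b\<close>.\<close>

definition projective_rmod :: "('a, 'm) ring_scheme \<Rightarrow> ('a, 'b) rmod \<Rightarrow> bool" where
  "projective_rmod R P \<longleftrightarrow> right_module R P \<and>
     (\<forall>(M :: ('a, 'b) rmod) (N :: ('a, 'b) rmod). \<forall>p\<in>rmod_hom R M N. \<forall>f\<in>rmod_hom R P N.
        right_module R M \<longrightarrow> right_module R N \<longrightarrow> p ` carrier M = carrier N \<longrightarrow>
        (\<exists>g\<in>rmod_hom R P M. \<forall>x\<in>carrier P. p (g x) = f x))"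

definition right_coherent :: "('a, 'm) ring_scheme \<Rightarrow> bool" where
  "right_coherent R \<longleftrightarrow>
     (\<forall>I. additive_subgroup I R \<and> (\<forall>x\<in>I. \<forall>r\<in>carrier R. x \<otimes>\<^bsub>R\<^esub> r \<in> I) \<longrightarrow>
          fg_rmod R ((regular_rmod R)\<lparr>carrier := I\<rparr>) \<longrightarrow>
          fp_rmod R ((regular_rmod R)\<lparr>carrier := I\<rparr>))"

definition von_neumann_regular :: "('a, 'm) ring_scheme \<Rightarrow> bool" where
  "von_neumann_regular R \<longleftrightarrow> (\<forall>x\<in>carrier R. \<exists>y\<in>carrier R. x = x \<otimes>\<^bsub>R\<^esub> y \<otimes>\<^bsub>R\<^esub> x)"


section \<open>Complexes of right modules\<close>

text \<open>Complexes are cohomologically graded and unbounded. The type \<open>'u\<close> plays the role of a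
  universe of sets: the carrier of \<open>R\<close> and those of all modules that occur in complexes are subsets
  of \<open>'u\<close>. When \<open>'u\<close> is infinite, this universe is closed (up to bijection) under finite products
  and subquotients, hence under all the constructions (homotopy pullbacks, mapping cones, free
  modules of finite rank) on which the calculus of fractions in \<open>D(R)\<close> rests.\<close>

record 'u cpx =
  cobj :: "int \<Rightarrow> ('u, 'u) rmod"
  cdiff :: "int \<Rightarrow> 'u \<Rightarrow> 'u"

type_synonym 'u cmap = "int \<Rightarrow> 'u \<Rightarrow> 'u"

definition complexes :: "('u, 'm) ring_scheme \<Rightarrow> 'u cpx set" where
  "complexes R = {X. (\<forall>n. right_module R (cobj X n)) \<and>
     (\<forall>n. cdiff X n \<in> rmod_hom R (cobj X n) (cobj X (n + 1))) \<and>
     (\<forall>n. \<forall>x\<in>carrier (cobj X n). cdiff X (n + 1) (cdiff X n x) = \<zero>\<^bsub>cobj X (n + 1 + 1)\<^esub>)}"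

definition chain_map :: "('u, 'm) ring_scheme \<Rightarrow> 'u cpx \<Rightarrow> 'u cpx \<Rightarrow> 'u cmap \<Rightarrow> bool" where
  "chain_map R X Y f \<longleftrightarrow> (\<forall>n. f n \<in> rmod_hom R (cobj X n) (cobj Y n)) \<and>
     (\<forall>n. \<forall>x\<in>carrier (cobj X n). f (n + 1) (cdiff X n x) = cdiff Y n (f n x))"

definition chain_comp :: "'u cmap \<Rightarrow> 'u cmap \<Rightarrow> 'u cmap" where
  "chain_comp g f = (\<lambda>n x. g n (f n x))"

definition chain_add :: "'u cpx \<Rightarrow> 'u cmap \<Rightarrow> 'u cmap \<Rightarrow> 'u cmap" where
  "chain_add Y f g = (\<lambda>n x. f n x \<oplus>\<^bsub>cobj Y n\<^esub> g n x)"

definition chain_id :: "'u cmap" where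
  "chain_id = (\<lambda>n x. x)"

definition chain_zero :: "'u cpx \<Rightarrow> 'u cmap" where
  "chain_zero Y = (\<lambda>n x. \<zero>\<^bsub>cobj Y n\<^esub>)"

definition homotopic ::
    "('u, 'm) ring_scheme \<Rightarrow> 'u cpx \<Rightarrow> 'u cpx \<Rightarrow> 'u cmap \<Rightarrow> 'u cmap \<Rightarrow> bool" where
  "homotopic R X Y f g \<longleftrightarrow> (\<exists>h.
     (\<forall>n. h n \<in> rmod_hom R (cobj X n) (cobj Y (n - 1))) \<and>
     (\<forall>n. \<forall>x\<in>carrier (cobj X n). f n x =
        g n x \<oplus>\<^bsub>cobj Y n\<^esub> (cdiff Y (n - 1) (h n x) \<oplus>\<^bsub>cobj Y n\<^esub> h (n + 1) (cdiff X n x))))"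

definition cocycles :: "'u cpx \<Rightarrow> int \<Rightarrow> 'u set" where
  "cocycles X n = {x \<in> carrier (cobj X n). cdiff X n x = \<zero>\<^bsub>cobj X (n + 1)\<^esub>}"

definition coboundaries :: "'u cpx \<Rightarrow> int \<Rightarrow> 'u set" where
  "coboundaries X n = cdiff X (n - 1) ` carrier (cobj X (n - 1))"

definition cohomology :: "'u cpx \<Rightarrow> int \<Rightarrow> 'u set monoid" where
  "cohomology X n = (cobj X n)\<lparr>carrier := cocycles X n\<rparr> A_Mod coboundaries X n"

text \<open>The map induced by \<open>f\<close> on cohomology sends a coset \<open>c = B(X) + z\<close> to \<open>B(Y) + f(c) = B(Y) + f z\<close>.\<close>

definition quasi_iso :: "('u, 'm) ring_scheme \<Rightarrow> 'u cpx \<Rightarrow> 'u cpx \<Rightarrow> 'u cmap \<Rightarrow> bool" where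
  "quasi_iso R X Y f \<longleftrightarrow> chain_map R X Y f \<and>
     (\<forall>n. (\<lambda>c. coboundaries Y n <+>\<^bsub>cobj Y n\<^esub> f n ` c) \<in> iso (cohomology X n) (cohomology Y n))"

text \<open>\<open>shift i X\<close> is the \<open>i\<close>-fold suspension of \<open>X\<close>.\<close>

definition shift :: "int \<Rightarrow> 'u cpx \<Rightarrow> 'u cpx" where
  "shift i X = \<lparr>cobj = (\<lambda>n. cobj X (n + i)),
     cdiff = (\<lambda>n x. if even i then cdiff X (n + i) x
                    else \<ominus>\<^bsub>cobj X (n + i + 1)\<^esub> cdiff X (n + i) x)\<rparr>"

definition stalk_ring :: "('u, 'm) ring_scheme \<Rightarrow> 'u cpx" where
  "stalk_ring R = \<lparr>cobj = (\<lambda>n. if n = 0 then regular_rmod R else zero_rmod R),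
     cdiff = (\<lambda>n x. \<zero>\<^bsub>R\<^esub>)\<rparr>"


section \<open>Preadditive categories and their modules\<close>

text \<open>The Hom-sets are abelian groups, written multiplicatively as groups are in the library.
  \<open>cmp C X Y Z g f\<close> is the composite of \<open>f : X \<rightarrow> Y\<close> and \<open>g : Y \<rightarrow> Z\<close>. Morphisms need not determine
  their source and target, which are therefore passed explicitly.\<close>

record ('o, 'm) precat =
  obj :: "'o set"
  homg :: "'o \<Rightarrow> 'o \<Rightarrow> 'm monoid"
  idm :: "'o \<Rightarrow> 'm"
  cmp :: "'o \<Rightarrow> 'o \<Rightarrow> 'o \<Rightarrow> 'm \<Rightarrow> 'm \<Rightarrow> 'm"

definition full_subcat :: "('o, 'm) precat \<Rightarrow> 'o set \<Rightarrow> ('o, 'm) precat" where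
  "full_subcat C S = C\<lparr>obj := S\<rparr>"

definition isomorphic_in :: "('o, 'm) precat \<Rightarrow> 'o \<Rightarrow> 'o \<Rightarrow> bool" where
  "isomorphic_in C X Y \<longleftrightarrow> (\<exists>f\<in>carrier (homg C X Y). \<exists>g\<in>carrier (homg C Y X).
     cmp C X Y X g f = idm C X \<and> cmp C Y X Y f g = idm C Y)"

record ('o, 'm, 'b) cfun =
  fobj :: "'o \<Rightarrow> 'b monoid"
  fmor :: "'o \<Rightarrow> 'o \<Rightarrow> 'm \<Rightarrow> 'b \<Rightarrow> 'b"

text \<open>The objects of \<open>Mod(C)\<close>: additive functors from the opposite category of \<open>C\<close> to abelian
  groups with carriers in the type \<open>'b\<close>.\<close>

definition Mod_cat :: "('o, 'm) precat \<Rightarrow> ('o, 'm, 'b) cfun set" where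
  "Mod_cat C = {F.
     (\<forall>X\<in>obj C. comm_group (fobj F X)) \<and>
     (\<forall>X\<in>obj C. \<forall>Y\<in>obj C. \<forall>f\<in>carrier (homg C X Y). fmor F X Y f \<in> hom (fobj F Y) (fobj F X)) \<and>
     (\<forall>X\<in>obj C. \<forall>a\<in>carrier (fobj F X). fmor F X X (idm C X) a = a) \<and>
     (\<forall>X\<in>obj C. \<forall>Y\<in>obj C. \<forall>Z\<in>obj C.
        \<forall>f\<in>carrier (homg C X Y). \<forall>g\<in>carrier (homg C Y Z). \<forall>a\<in>carrier (fobj F Z).
          fmor F X Z (cmp C X Y Z g f) a = fmor F X Y f (fmor F Y Z g a)) \<and>
     (\<forall>X\<in>obj C. \<forall>Y\<in>obj C.
        \<forall>f\<in>carrier (homg C X Y). \<forall>g\<in>carrier (homg C X Y). \<forall>a\<in>carrier (fobj F Y).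
          fmor F X Y (f \<otimes>\<^bsub>homg C X Y\<^esub> g) a = fmor F X Y f a \<otimes>\<^bsub>fobj F X\<^esub> fmor F X Y g a)}"

definition nat_trans ::
    "('o, 'm) precat \<Rightarrow> ('o, 'm, 'b) cfun \<Rightarrow> ('o, 'm, 'c) cfun \<Rightarrow> ('o \<Rightarrow> 'b \<Rightarrow> 'c) \<Rightarrow> bool" where
  "nat_trans C F G \<tau> \<longleftrightarrow>
     (\<forall>X\<in>obj C. \<tau> X \<in> hom (fobj F X) (fobj G X)) \<and>
     (\<forall>X\<in>obj C. \<forall>Y\<in>obj C. \<forall>f\<in>carrier (homg C X Y). \<forall>a\<in>carrier (fobj F Y).
        \<tau> X (fmor F X Y f a) = fmor G X Y f (\<tau> Y a))"

definition representable :: "('o, 'm) precat \<Rightarrow> 'o \<Rightarrow> ('o, 'm, 'm) cfun" where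
  "representable C A = \<lparr>fobj = (\<lambda>X. homg C X A), fmor = (\<lambda>X Y f a. cmp C X Y A a f)\<rparr>"

text \<open>The objects of \<open>mod(C)\<close>: functors \<open>F\<close> with a presentation
  \<open>Hom(-, A) \<rightarrow> Hom(-, B) \<rightarrow> F \<rightarrow> 0\<close>.\<close>

definition mod_cat :: "('o, 'm) precat \<Rightarrow> ('o, 'm, 'b) cfun set" where
  "mod_cat C = {F \<in> Mod_cat C. \<exists>A\<in>obj C. \<exists>B\<in>obj C. \<exists>\<eta> \<pi>.
     nat_trans C (representable C A) (representable C B) \<eta> \<and>
     nat_trans C (representable C B) F \<pi> \<and>
     (\<forall>X\<in>obj C. \<pi> X ` carrier (homg C X B) = carrier (fobj F X) \<and>
        kernel (homg C X B) (fobj F X) (\<pi> X) = \<eta> X ` carrier (homg C X A))}"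

definition zero_functors :: "('o, 'm) precat \<Rightarrow> ('o, 'm, 'b) cfun set" where
  "zero_functors C = {F \<in> Mod_cat C. \<forall>X\<in>obj C. carrier (fobj F X) = {\<one>\<^bsub>fobj F X\<^esub>}}"


section \<open>The derived category\<close>

text \<open>A morphism \<open>X \<rightarrow> Y\<close> in \<open>D(R)\<close> is an equivalence class of roofs \<open>X \<leftarrow> Z \<rightarrow> Y\<close>, in the homotopy
  category, whose left leg \<open>Z \<rightarrow> X\<close> is a quasi-isomorphism.\<close>

datatype 'u roof = Roof (apex: "'u cpx") (left_leg: "'u cmap") (right_leg: "'u cmap")

definition roofs :: "('u, 'm) ring_scheme \<Rightarrow> 'u cpx \<Rightarrow> 'u cpx \<Rightarrow> 'u roof set" where
  "roofs R X Y = {Roof Z s f |Z s f. Z \<in> complexes R \<and> quasi_iso R Z X s \<and> chain_map R Z Y f}"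

definition roof_rel :: "('u, 'm) ring_scheme \<Rightarrow> 'u cpx \<Rightarrow> 'u cpx \<Rightarrow> ('u roof \<times> 'u roof) set" where
  "roof_rel R X Y = {(\<rho>, \<sigma>). \<rho> \<in> roofs R X Y \<and> \<sigma> \<in> roofs R X Y \<and>
     (\<exists>W\<in>complexes R. \<exists>u v. chain_map R W (apex \<rho>) u \<and> chain_map R W (apex \<sigma>) v \<and>
        quasi_iso R W X (chain_comp (left_leg \<rho>) u) \<and>
        homotopic R W X (chain_comp (left_leg \<rho>) u) (chain_comp (left_leg \<sigma>) v) \<and>
        homotopic R W Y (chain_comp (right_leg \<rho>) u) (chain_comp (right_leg \<sigma>) v))}"

type_synonym 'u dmor = "'u roof set"

definition roof_class :: "('u, 'm) ring_scheme \<Rightarrow> 'u cpx \<Rightarrow> 'u cpx \<Rightarrow> 'u roof \<Rightarrow> 'u dmor" where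
  "roof_class R X Y \<rho> = roof_rel R X Y `` {\<rho>}"

text \<open>Classes of roofs are added by putting them over a common left leg. The union ranges over all
  choices of such representatives; they all give the same class.\<close>

definition dadd :: "('u, 'm) ring_scheme \<Rightarrow> 'u cpx \<Rightarrow> 'u cpx \<Rightarrow> 'u dmor \<Rightarrow> 'u dmor \<Rightarrow> 'u dmor" where
  "dadd R X Y \<alpha> \<beta> = \<Union>{roof_class R X Y (Roof Z s (chain_add Y f g)) |Z s f g.
     Roof Z s f \<in> \<alpha> \<and> Roof Z s g \<in> \<beta>}"

definition dhom :: "('u, 'm) ring_scheme \<Rightarrow> 'u cpx \<Rightarrow> 'u cpx \<Rightarrow> 'u dmor monoid" where
  "dhom R X Y = \<lparr>carrier = roofs R X Y // roof_rel R X Y, mult = dadd R X Y,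
     one = roof_class R X Y (Roof X chain_id (chain_zero Y))\<rparr>"

text \<open>The composite of \<open>X \<leftarrow> A \<rightarrow> Y\<close> and \<open>Y \<leftarrow> B \<rightarrow> Z\<close> is obtained by completing \<open>A \<rightarrow> Y \<leftarrow> B\<close> to a
  square \<open>A \<leftarrow> W \<rightarrow> B\<close>, commutative up to homotopy, with \<open>W \<rightarrow> A\<close> a quasi-isomorphism. Again all
  choices give the same class.\<close>

definition dcomp :: "('u, 'm) ring_scheme \<Rightarrow> 'u cpx \<Rightarrow> 'u cpx \<Rightarrow> 'u cpx \<Rightarrow>
    'u dmor \<Rightarrow> 'u dmor \<Rightarrow> 'u dmor" where
  "dcomp R X Y Z \<beta> \<alpha> = \<Union>{roof_class R X Z (Roof W (chain_comp s u) (chain_comp g v)) |W A B s f t g u v.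
     Roof A s f \<in> \<alpha> \<and> Roof B t g \<in> \<beta> \<and> W \<in> complexes R \<and>
     quasi_iso R W A u \<and> chain_map R W B v \<and> homotopic R W Y (chain_comp f u) (chain_comp t v)}"

definition derived_cat :: "('u, 'm) ring_scheme \<Rightarrow> ('u cpx, 'u dmor) precat" where
  "derived_cat R = \<lparr>obj = complexes R, homg = dhom R,
     idm = (\<lambda>X. roof_class R X X (Roof X chain_id chain_id)), cmp = dcomp R\<rparr>"

text \<open>The compact objects of \<open>D(R)\<close>, i.e. the perfect complexes: those isomorphic in \<open>D(R)\<close> to a
  bounded complex of finitely generated projective modules.\<close>

definition perfect_complexes :: "('u, 'm) ring_scheme \<Rightarrow> 'u cpx set" where
  "perfect_complexes R = {X \<in> complexes R. \<exists>P\<in>complexes R.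
     (\<forall>n. projective_rmod R (cobj P n) \<and> fg_rmod R (cobj P n)) \<and>
     (\<exists>a b. \<forall>n. n \<notin> {a..b} \<longrightarrow> carrier (cobj P n) = {\<zero>\<^bsub>cobj P n\<^esub>}) \<and>
     isomorphic_in (derived_cat R) X P}"

definition compact_cat :: "('u, 'm) ring_scheme \<Rightarrow> ('u cpx, 'u dmor) precat" where
  "compact_cat R = full_subcat (derived_cat R) (perfect_complexes R)"

definition generating_hypothesis :: "('u, 'm) ring_scheme \<Rightarrow> bool" where
  "generating_hypothesis R \<longleftrightarrow>
     (\<forall>C\<in>perfect_complexes R. \<forall>D\<in>perfect_complexes R. \<forall>f\<in>carrier (dhom R C D).
        (\<forall>i. \<forall>x\<in>carrier (dhom R (shift i (stalk_ring R)) C).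
           dcomp R (shift i (stalk_ring R)) C D f x = \<one>\<^bsub>dhom R (shift i (stalk_ring R)) D\<^esub>) \<longrightarrow>
        f = \<one>\<^bsub>dhom R C D\<^esub>)"

definition ghost_functors :: "('u, 'm) ring_scheme \<Rightarrow> ('u cpx, 'u dmor, 'b) cfun set" where
  "ghost_functors R = {F \<in> Mod_cat (compact_cat R).
     \<forall>i. carrier (fobj F (shift i (stalk_ring R))) = {\<one>\<^bsub>fobj F (shift i (stalk_ring R))\<^esub>}}"

end

theory Submission
  imports Defs
begin

text \<open>The image of \<open>Hom(-, f)\<close> is finitely presented, because \<open>f\<close> has a fibre, and it vanishes on the
  shifts of \<open>R\<close> exactly when \<open>f\<close> is a ghost. Conversely, by Yoneda a finitely presented functor is the
  cokernel of some \<open>Hom(-, g)\<close>; if it vanishes on the shifts of \<open>R\<close>, the map from the target of \<open>g\<close> to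
  the cone of \<open>g\<close> is a ghost, and if that is zero then \<open>g\<close> is a split epimorphism.

  Since bounded complexes of projectives lift uniquely, up to homotopy, along quasi-isomorphisms, a
  strictly perfect resolution \<open>P \<rightarrow> X\<close> identifies roofs from \<open>X\<close> to \<open>Y\<close> with homotopy classes of chain
  maps \<open>P \<rightarrow> Y\<close>. This replaces the Ore condition for perfect \<open>X\<close>, and the generating hypothesis becomes:
  chain maps of strictly perfect complexes that vanish on cohomology are null homotopic. Over a von
  Neumann regular ring the differentials of such a complex have quasi-inverses, from which a null
  homotopy is assembled. Conversely, if the annihilator of \<open>x\<close> is finitely generated, a ghost between
  two-term complexes built from \<open>x\<close> and its annihilator produces \<open>y\<close> with \<open>x = x y x\<close>.\<close>

text \<open>\<open>dadd\<close> and \<open>dcomp\<close> are unions over all representatives and all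
  completing squares. Computing one takes two facts: all choices give the same class, and at least
  one choice exists. Maps out of a resolution supply both. One place cannot profit from this: a
  perfect complex is only given as isomorphic in \<open>D(R)\<close> to a strictly perfect
  \<open>P\<close>, and turning that isomorphism into a quasi-isomorphism \<open>P -> X\<close>
  means unfolding roofs by hand.

  Two size constraints shape the constructions. Modules in complexes have elements in
  \<open>'u\<close>, so direct sums are coded by a bijection between \<open>'u \<times> 'u\<close>
  and \<open>'u\<close>, and free modules of finite rank are rebuilt from them. Functors take values
  in \<open>'b\<close>, so the functor attached to a morphism is moved there along an injection.

  Weak exactness of fibre and cone sequences at their middle term stands in for the triangulated
  structure.\<close>

locale preadditive =
  fixes C :: "('o, 'm) precat"
  assumes hom_group: "\<lbrakk>X \<in> obj C; Y \<in> obj C\<rbrakk> \<Longrightarrow> comm_group (homg C X Y)"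
    and id_closed: "X \<in> obj C \<Longrightarrow> idm C X \<in> carrier (homg C X X)"
    and cmp_closed: "\<lbrakk>X \<in> obj C; Y \<in> obj C; Z \<in> obj C; f \<in> carrier (homg C X Y);
      g \<in> carrier (homg C Y Z)\<rbrakk> \<Longrightarrow> cmp C X Y Z g f \<in> carrier (homg C X Z)"
    and cmp_assoc: "\<lbrakk>X \<in> obj C; Y \<in> obj C; Z \<in> obj C; W \<in> obj C; f \<in> carrier (homg C X Y);
      g \<in> carrier (homg C Y Z); h \<in> carrier (homg C Z W)\<rbrakk> \<Longrightarrow>
      cmp C X Z W h (cmp C X Y Z g f) = cmp C X Y W (cmp C Y Z W h g) f"
    and cmp_id_left: "\<lbrakk>X \<in> obj C; Y \<in> obj C; f \<in> carrier (homg C X Y)\<rbrakk> \<Longrightarrow>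
      cmp C X Y Y (idm C Y) f = f"
    and cmp_id_right: "\<lbrakk>X \<in> obj C; Y \<in> obj C; f \<in> carrier (homg C X Y)\<rbrakk> \<Longrightarrow>
      cmp C X X Y f (idm C X) = f"
    and cmp_add_left: "\<lbrakk>X \<in> obj C; Y \<in> obj C; Z \<in> obj C; f \<in> carrier (homg C X Y);
      g \<in> carrier (homg C Y Z); h \<in> carrier (homg C Y Z)\<rbrakk> \<Longrightarrow>
      cmp C X Y Z (g \<otimes>\<^bsub>homg C Y Z\<^esub> h) f = cmp C X Y Z g f \<otimes>\<^bsub>homg C X Z\<^esub> cmp C X Y Z h f"
    and cmp_add_right: "\<lbrakk>X \<in> obj C; Y \<in> obj C; Z \<in> obj C; f \<in> carrier (homg C X Y);
      g \<in> carrier (homg C X Y); h \<in> carrier (homg C Y Z)\<rbrakk> \<Longrightarrow>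
      cmp C X Y Z h (f \<otimes>\<^bsub>homg C X Y\<^esub> g) = cmp C X Y Z h f \<otimes>\<^bsub>homg C X Z\<^esub> cmp C X Y Z h g"
begin

text \<open>A weak kernel: factorizations through \<open>f\<close> exist but need not be unique,
  which is what a triangle provides. It is used for fibre sequences and for cone sequences
  alike.\<close>

definition exact_at :: "'o \<Rightarrow> 'o \<Rightarrow> 'o \<Rightarrow> 'm \<Rightarrow> 'm \<Rightarrow> bool" where
  "exact_at X Y Z f g \<longleftrightarrow> cmp C X Y Z g f = \<one>\<^bsub>homg C X Z\<^esub> \<and>
     (\<forall>W\<in>obj C. \<forall>b\<in>carrier (homg C W Y). cmp C W Y Z g b = \<one>\<^bsub>homg C W Z\<^esub> \<longrightarrow>
        (\<exists>c\<in>carrier (homg C W X). cmp C W X Y f c = b))"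

lemma one_closed: "\<lbrakk>X \<in> obj C; Y \<in> obj C\<rbrakk> \<Longrightarrow> \<one>\<^bsub>homg C X Y\<^esub> \<in> carrier (homg C X Y)"
  using hom_group by (simp add: comm_group_def comm_monoid_def monoid.one_closed)

lemma postcomp_hom:
  assumes "X \<in> obj C" "Y \<in> obj C" "Z \<in> obj C" "f \<in> carrier (homg C Y Z)"
  shows "cmp C X Y Z f \<in> hom (homg C X Y) (homg C X Z)"
  using assms by (auto intro!: homI cmp_closed cmp_add_right)

lemma precomp_hom:
  assumes "X \<in> obj C" "Y \<in> obj C" "Z \<in> obj C" "f \<in> carrier (homg C X Y)"
  shows "(\<lambda>g. cmp C X Y Z g f) \<in> hom (homg C Y Z) (homg C X Z)"
  using assms by (auto intro!: homI cmp_closed cmp_add_left)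

lemma hom_group': "\<lbrakk>X \<in> obj C; Y \<in> obj C\<rbrakk> \<Longrightarrow> group (homg C X Y)"
  using hom_group by (simp add: comm_group_def)

lemma cmp_one_left:
  assumes "X \<in> obj C" "Y \<in> obj C" "Z \<in> obj C" "f \<in> carrier (homg C X Y)"
  shows "cmp C X Y Z \<one>\<^bsub>homg C Y Z\<^esub> f = \<one>\<^bsub>homg C X Z\<^esub>"
  using hom_one[OF precomp_hom[OF assms]] hom_group' assms by blast

text \<open>Every \<open>a\<close> is the pullback of the identity of \<open>A\<close> along
  \<open>a\<close>, so naturality forces the value of \<open>\<eta>\<close> at
  \<open>a\<close>.\<close>

lemma yoneda:
  assumes "nat_trans C (representable C A) (representable C B) \<eta>"
    and "A \<in> obj C" "B \<in> obj C" "X \<in> obj C" "a \<in> carrier (homg C X A)"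
  shows "\<eta> A (idm C A) \<in> carrier (homg C A B)" "\<eta> X a = cmp C X A B (\<eta> A (idm C A)) a"
proof -
  have h: "\<And>X. X \<in> obj C \<Longrightarrow> \<eta> X \<in> hom (homg C X A) (homg C X B)"
    using assms(1) by (simp add: nat_trans_def representable_def)
  show "\<eta> A (idm C A) \<in> carrier (homg C A B)"
    using h[OF assms(2)] id_closed[OF assms(2)] by (auto simp: hom_def)
  have "\<eta> X (cmp C X A A (idm C A) a) = cmp C X A B (\<eta> A (idm C A)) a"
    using assms id_closed[OF assms(2)] by (simp add: nat_trans_def representable_def)
  then show "\<eta> X a = cmp C X A B (\<eta> A (idm C A)) a"
    using cmp_id_left assms by simp
qed

text \<open>The image of \<open>Hom(-, f)\<close>, with values carried along \<open>\<iota>\<close> since functors take values in \<open>'b\<close>.\<close>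

definition image_group :: "('m \<Rightarrow> 'b) \<Rightarrow> 'o \<Rightarrow> 'o \<Rightarrow> 'm \<Rightarrow> 'o \<Rightarrow> 'b monoid" where
  "image_group \<iota> D E f X = \<lparr>carrier = \<iota> ` cmp C X D E f ` carrier (homg C X D),
     mult = (\<lambda>a b. \<iota> (inv_into UNIV \<iota> a \<otimes>\<^bsub>homg C X E\<^esub> inv_into UNIV \<iota> b)), one = \<iota> \<one>\<^bsub>homg C X E\<^esub>\<rparr>"

definition image_functor :: "('m \<Rightarrow> 'b) \<Rightarrow> 'o \<Rightarrow> 'o \<Rightarrow> 'm \<Rightarrow> ('o, 'm, 'b) cfun" where
  "image_functor \<iota> D E f = \<lparr>fobj = image_group \<iota> D E f,
     fmor = (\<lambda>X Y g a. \<iota> (cmp C X Y E (inv_into UNIV \<iota> a) g))\<rparr>"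

lemma image_group_comm_group:
  assumes "inj \<iota>" "D \<in> obj C" "E \<in> obj C" "f \<in> carrier (homg C D E)" "X \<in> obj C"
  shows "comm_group (image_group \<iota> D E f X)"
proof -
  interpret H: comm_group "homg C X D" using hom_group assms by simp
  interpret K: comm_group "homg C X E" using hom_group assms by simp
  interpret f: group_hom "homg C X D" "homg C X E" "cmp C X D E f"
    using postcomp_hom[of X D E f] assms
    by (simp add: group_hom_def group_hom_axioms_def H.group_axioms K.group_axioms)
  note s = image_group_def inv_f_f[OF assms(1)]
  show ?thesis
  proof (rule comm_groupI)
    fix x y assume "x \<in> carrier (image_group \<iota> D E f X)" "y \<in> carrier (image_group \<iota> D E f X)"
    then obtain a b where ab: "a \<in> carrier (homg C X D)" "x = \<iota> (cmp C X D E f a)"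
      "b \<in> carrier (homg C X D)" "y = \<iota> (cmp C X D E f b)" by (auto simp: s)
    show "x \<otimes>\<^bsub>image_group \<iota> D E f X\<^esub> y \<in> carrier (image_group \<iota> D E f X)"
      using ab by (auto simp: s f.hom_mult[symmetric] simp del: f.hom_mult)
    show "x \<otimes>\<^bsub>image_group \<iota> D E f X\<^esub> y = y \<otimes>\<^bsub>image_group \<iota> D E f X\<^esub> x"
      using ab by (simp add: s K.m_comm)
  next
    show "\<one>\<^bsub>image_group \<iota> D E f X\<^esub> \<in> carrier (image_group \<iota> D E f X)"
      using f.hom_one H.one_closed by (force simp: s simp del: f.hom_one)
  next
    fix x y z assume "x \<in> carrier (image_group \<iota> D E f X)" "y \<in> carrier (image_group \<iota> D E f X)"
      "z \<in> carrier (image_group \<iota> D E f X)"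
    then show "x \<otimes>\<^bsub>image_group \<iota> D E f X\<^esub> y \<otimes>\<^bsub>image_group \<iota> D E f X\<^esub> z =
      x \<otimes>\<^bsub>image_group \<iota> D E f X\<^esub> (y \<otimes>\<^bsub>image_group \<iota> D E f X\<^esub> z)"
      by (auto simp: s K.m_assoc)
  next
    fix x assume "x \<in> carrier (image_group \<iota> D E f X)"
    then obtain a where a: "a \<in> carrier (homg C X D)" "x = \<iota> (cmp C X D E f a)" by (auto simp: s)
    show "\<one>\<^bsub>image_group \<iota> D E f X\<^esub> \<otimes>\<^bsub>image_group \<iota> D E f X\<^esub> x = x" using a by (simp add: s)
    show "\<exists>y\<in>carrier (image_group \<iota> D E f X). y \<otimes>\<^bsub>image_group \<iota> D E f X\<^esub> x = \<one>\<^bsub>image_group \<iota> D E f X\<^esub>"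
    proof (rule bexI)
      show "\<iota> (cmp C X D E f (inv\<^bsub>homg C X D\<^esub> a)) \<otimes>\<^bsub>image_group \<iota> D E f X\<^esub> x = \<one>\<^bsub>image_group \<iota> D E f X\<^esub>"
        using a by (simp add: s)
      show "\<iota> (cmp C X D E f (inv\<^bsub>homg C X D\<^esub> a)) \<in> carrier (image_group \<iota> D E f X)"
        using a by (simp add: s del: f.hom_inv)
    qed
  qed
qed

lemma image_functor_Mod:
  assumes "inj \<iota>" "D \<in> obj C" "E \<in> obj C" "f \<in> carrier (homg C D E)"
  shows "image_functor \<iota> D E f \<in> Mod_cat C"
proof -
  note s = image_functor_def image_group_def inv_f_f[OF assms(1)]
  \<comment> \<open>Precomposing with \<open>g\<close> stays inside the image, since
    \<open>(f b) g = f (b g)\<close>.\<close>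
  have cl: "\<exists>c\<in>carrier (homg C X D). cmp C X Y E (cmp C Y D E f b) g = cmp C X D E f c"
    if "X \<in> obj C" "Y \<in> obj C" "g \<in> carrier (homg C X Y)" "b \<in> carrier (homg C Y D)" for X Y g b
    using that assms by (intro bexI[of _ "cmp C X Y D b g"]) (auto simp: cmp_assoc cmp_closed)
  show ?thesis
    unfolding Mod_cat_def
  proof (intro CollectI conjI ballI)
    fix X assume "X \<in> obj C"
    then show "comm_group (fobj (image_functor \<iota> D E f) X)"
      using image_group_comm_group[OF assms] by (simp add: image_functor_def)
  next
    fix X Y g assume g: "X \<in> obj C" "Y \<in> obj C" "g \<in> carrier (homg C X Y)"
    show "fmor (image_functor \<iota> D E f) X Y g
        \<in> hom (fobj (image_functor \<iota> D E f) Y) (fobj (image_functor \<iota> D E f) X)"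
    proof (rule homI)
      fix x assume "x \<in> carrier (fobj (image_functor \<iota> D E f) Y)"
      then show "fmor (image_functor \<iota> D E f) X Y g x \<in> carrier (fobj (image_functor \<iota> D E f) X)"
        using cl[OF g] by (fastforce simp: s)
    qed (use g assms in \<open>auto simp: s cmp_add_left cmp_closed\<close>)
  next
    fix X a assume "X \<in> obj C" "a \<in> carrier (fobj (image_functor \<iota> D E f) X)"
    then show "fmor (image_functor \<iota> D E f) X X (idm C X) a = a"
      using assms by (auto simp: s cmp_id_right cmp_closed)
  next
    fix X Y Z g h a assume "X \<in> obj C" "Y \<in> obj C" "Z \<in> obj C" "g \<in> carrier (homg C X Y)"
      "h \<in> carrier (homg C Y Z)" "a \<in> carrier (fobj (image_functor \<iota> D E f) Z)"
    then show "fmor (image_functor \<iota> D E f) X Z (cmp C X Y Z h g) a =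
       fmor (image_functor \<iota> D E f) X Y g (fmor (image_functor \<iota> D E f) Y Z h a)"
      using assms by (auto simp: s cmp_assoc cmp_closed)
  next
    fix X Y g h a assume "X \<in> obj C" "Y \<in> obj C" "g \<in> carrier (homg C X Y)"
      "h \<in> carrier (homg C X Y)" "a \<in> carrier (fobj (image_functor \<iota> D E f) Y)"
    then show "fmor (image_functor \<iota> D E f) X Y (g \<otimes>\<^bsub>homg C X Y\<^esub> h) a =
       fmor (image_functor \<iota> D E f) X Y g a \<otimes>\<^bsub>fobj (image_functor \<iota> D E f) X\<^esub>
       fmor (image_functor \<iota> D E f) X Y h a"
      using assms by (auto simp: s cmp_add_right cmp_closed)
  qed
qed

text \<open>Composition with \<open>f\<close> maps \<open>Hom(-, D)\<close> onto the image, and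
  exactness says that the kernel of this surjection is what comes through \<open>g\<close>. So a
  weak kernel of \<open>f\<close> is a presentation of the image of \<open>f\<close>.\<close>

lemma image_functor_mod:
  assumes "inj \<iota>" "D \<in> obj C" "E \<in> obj C" "f \<in> carrier (homg C D E)"
    and "A \<in> obj C" "g \<in> carrier (homg C A D)" "exact_at A D E g f"
  shows "image_functor \<iota> D E f \<in> mod_cat C"
proof -
  note s = image_functor_def image_group_def inv_f_f[OF assms(1)] representable_def
  have gf: "cmp C X D E f (cmp C X A D g a) = \<one>\<^bsub>homg C X E\<^esub>"
    if "X \<in> obj C" "a \<in> carrier (homg C X A)" for X a
    using that assms by (simp add: cmp_assoc exact_at_def cmp_one_left)
  have ex: "\<exists>c\<in>carrier (homg C X A). cmp C X A D g c = b"
    if "X \<in> obj C" "b \<in> carrier (homg C X D)" "cmp C X D E f b = \<one>\<^bsub>homg C X E\<^esub>" for X b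
    using that assms by (simp add: exact_at_def)
  have 1: "nat_trans C (representable C A) (representable C D) (\<lambda>X. cmp C X A D g)"
    unfolding nat_trans_def using assms postcomp_hom by (auto simp: s cmp_assoc)
  have 2: "nat_trans C (representable C D) (image_functor \<iota> D E f) (\<lambda>X b. \<iota> (cmp C X D E f b))"
    unfolding nat_trans_def using assms by (auto intro!: homI simp: s cmp_assoc cmp_add_right)
  have 3: "kernel (homg C X D) (fobj (image_functor \<iota> D E f) X) (\<lambda>b. \<iota> (cmp C X D E f b))
      = cmp C X A D g ` carrier (homg C X A)" if "X \<in> obj C" for X
    using gf[OF that] ex[OF that] cmp_closed[OF that assms(5,2) _ assms(6)]
    by (auto simp: kernel_def s inj_eq[OF assms(1)])
  show ?thesis
    unfolding mod_cat_def using image_functor_Mod[OF assms(1-4)] 1 2 3 assms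
    by (intro CollectI conjI bexI[of _ A] bexI[of _ D]) (auto simp: image_image s intro!: exI)
qed

text \<open>The identity of a representable functor has cokernel zero. The final statement is an
  equality of classes, so the zero functors have to be finitely presented as well.\<close>

lemma zero_functors_mod:
  assumes "A \<in> obj C" "F \<in> zero_functors C"
  shows "F \<in> mod_cat C"
proof -
  have F: "F \<in> Mod_cat C" "\<And>X. X \<in> obj C \<Longrightarrow> carrier (fobj F X) = {\<one>\<^bsub>fobj F X\<^esub>}"
    using assms by (auto simp: zero_functors_def)
  have g: "\<And>X. X \<in> obj C \<Longrightarrow> group (fobj F X)" using F(1) by (simp add: Mod_cat_def comm_group_def)
  have m: "fmor F X Y f \<one>\<^bsub>fobj F Y\<^esub> = \<one>\<^bsub>fobj F X\<^esub>"
    if "X \<in> obj C" "Y \<in> obj C" "f \<in> carrier (homg C X Y)" for X Y f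
    using F(1) that g by (intro hom_one) (auto simp: Mod_cat_def)
  have 1: "nat_trans C (representable C A) (representable C A) (\<lambda>X a. a)"
    by (auto simp: nat_trans_def intro!: homI)
  have 2: "nat_trans C (representable C A) F (\<lambda>X a. \<one>\<^bsub>fobj F X\<^esub>)"
    using m g by (auto simp: nat_trans_def group.is_monoid monoid.one_closed intro!: homI)
  show ?thesis
    unfolding mod_cat_def
  proof (intro CollectI conjI bexI[of _ A] exI ballI)
    show "nat_trans C (representable C A) (representable C A) (\<lambda>X a. a)" by (rule 1)
    show "nat_trans C (representable C A) F (\<lambda>X a. \<one>\<^bsub>fobj F X\<^esub>)" by (rule 2)
    fix X assume X: "X \<in> obj C"
    show "(\<lambda>a. \<one>\<^bsub>fobj F X\<^esub>) ` carrier (homg C X A) = carrier (fobj F X)"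
      using F(2)[OF X] one_closed[OF X assms(1)] by auto
    show "kernel (homg C X A) (fobj F X) (\<lambda>a. \<one>\<^bsub>fobj F X\<^esub>) = (\<lambda>a. a) ` carrier (homg C X A)"
      by (auto simp: kernel_def)
  qed (use F assms in auto)
qed

text \<open>\<open>T\<close> stands for the shifts of \<open>R\<close>. The derived category enters
  only through the two assumptions that ghosts vanish and that cones exist.\<close>

lemma ghost_mod_is_zero:
  fixes F :: "('o, 'm, 'b) cfun"
  assumes "\<And>i. T i \<in> obj C"
    and gh: "\<And>X Y f. \<lbrakk>X \<in> obj C; Y \<in> obj C; f \<in> carrier (homg C X Y);
      \<And>i x. x \<in> carrier (homg C (T i) X) \<Longrightarrow> cmp C (T i) X Y f x = \<one>\<^bsub>homg C (T i) Y\<^esub>\<rbrakk> \<Longrightarrow>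
      f = \<one>\<^bsub>homg C X Y\<^esub>"
    and cone: "\<And>X Y f. \<lbrakk>X \<in> obj C; Y \<in> obj C; f \<in> carrier (homg C X Y)\<rbrakk> \<Longrightarrow>
      \<exists>N\<in>obj C. \<exists>h\<in>carrier (homg C Y N). exact_at X Y N f h"
    and F: "F \<in> mod_cat C" "\<And>i. carrier (fobj F (T i)) = {\<one>\<^bsub>fobj F (T i)\<^esub>}"
  shows "F \<in> zero_functors C"
proof -
  obtain A B \<eta> \<pi> where AB: "A \<in> obj C" "B \<in> obj C"
    and \<eta>: "nat_trans C (representable C A) (representable C B) \<eta>"
    and \<pi>: "nat_trans C (representable C B) F \<pi>"
    and surj: "\<And>X. X \<in> obj C \<Longrightarrow> \<pi> X ` carrier (homg C X B) = carrier (fobj F X)"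
    and ker: "\<And>X. X \<in> obj C \<Longrightarrow>
      kernel (homg C X B) (fobj F X) (\<pi> X) = \<eta> X ` carrier (homg C X A)"
    using F(1) unfolding mod_cat_def by (elim CollectE conjE bexE exE) (rule that; blast)
  define g where "g = \<eta> A (idm C A)"
  have g: "g \<in> carrier (homg C A B)"
    using yoneda(1)[OF \<eta> AB AB(1) id_closed[OF AB(1)]] by (simp add: g_def)
  have \<eta>g: "\<eta> X a = cmp C X A B g a" if "X \<in> obj C" "a \<in> carrier (homg C X A)" for X a
    using yoneda(2)[OF \<eta> AB that] by (simp add: g_def)
  obtain N h where N: "N \<in> obj C" "h \<in> carrier (homg C B N)" and ex: "exact_at A B N g h"
    using cone[OF AB g] by blast
  \<comment> \<open>\<open>F\<close> vanishes at \<open>T i\<close>, so every \<open>x\<close> from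
    \<open>T i\<close> to \<open>B\<close> lies in the kernel of \<open>\<pi>\<close>; hence it
    factors through \<open>g\<close>, and \<open>h\<close> kills \<open>g\<close>.\<close>
  have "h = \<one>\<^bsub>homg C B N\<^esub>"
  proof (rule gh[OF AB(2) N])
    fix i x assume x: "x \<in> carrier (homg C (T i) B)"
    have "\<pi> (T i) x = \<one>\<^bsub>fobj F (T i)\<^esub>"
      using surj[OF assms(1), of i] x F(2)[of i] by blast
    then have "x \<in> kernel (homg C (T i) B) (fobj F (T i)) (\<pi> (T i))"
      using x by (simp add: kernel_def)
    then obtain a where a: "a \<in> carrier (homg C (T i) A)" "x = cmp C (T i) A B g a"
      using ker[OF assms(1), of i] \<eta>g[OF assms(1)] by auto
    then show "cmp C (T i) B N h x = \<one>\<^bsub>homg C (T i) N\<^esub>"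
      using ex AB N g assms(1) by (simp add: cmp_assoc exact_at_def cmp_one_left)
  qed
  \<comment> \<open>As \<open>h\<close> is zero, exactness applies to the identity of
    \<open>B\<close> and yields a section \<open>c\<close> of \<open>g\<close>.\<close>
  then have "cmp C B B N h (idm C B) = \<one>\<^bsub>homg C B N\<^esub>"
    using AB N by (simp add: cmp_id_right)
  then obtain c where c: "c \<in> carrier (homg C B A)" "cmp C B A B g c = idm C B"
    using ex AB id_closed[OF AB(2)] by (auto simp: exact_at_def)
  have "carrier (fobj F X) = {\<one>\<^bsub>fobj F X\<^esub>}" if X: "X \<in> obj C" for X
  proof -
    have "\<pi> X b = \<one>\<^bsub>fobj F X\<^esub>" if b: "b \<in> carrier (homg C X B)" for b
    proof -
      \<comment> \<open>With the section every \<open>b\<close> lies in the image of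
        \<open>\<eta>\<close>, so the surjection \<open>\<pi>\<close> is zero.\<close>
      have "b = cmp C X A B g (cmp C X B A c b)"
        using AB X b c g by (simp add: cmp_assoc cmp_id_left)
      also have "\<dots> = \<eta> X (cmp C X B A c b)"
        using AB X b c \<eta>g by (simp add: cmp_closed)
      finally have "b \<in> kernel (homg C X B) (fobj F X) (\<pi> X)"
        using ker[OF X] cmp_closed[OF X AB(2,1) b c(1)] by blast
      then show ?thesis by (simp add: kernel_def)
    qed
    then show ?thesis using surj[OF X] one_closed[OF X AB(2)] by force
  qed
  then show ?thesis using F(1) by (simp add: zero_functors_def mod_cat_def)
qed

text \<open>The test functor is the image of \<open>f\<close>: it vanishes on \<open>T\<close>
  because \<open>f\<close> is a ghost, and the fibre makes it finitely presented. Once it is zero,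
  the element at \<open>X\<close> that comes from the identity, namely \<open>f\<close>, is
  zero.\<close>

lemma ghost_is_zero:
  fixes \<iota> :: "'m \<Rightarrow> 'b"
  assumes "inj \<iota>" and T: "\<And>i. T i \<in> obj C"
    and zero: "\<And>F :: ('o, 'm, 'b) cfun. F \<in> mod_cat C \<Longrightarrow>
      (\<And>i. carrier (fobj F (T i)) = {\<one>\<^bsub>fobj F (T i)\<^esub>}) \<Longrightarrow> F \<in> zero_functors C"
    and "X \<in> obj C" "Y \<in> obj C" "f \<in> carrier (homg C X Y)"
    and fibre: "N \<in> obj C" "g \<in> carrier (homg C N X)" "exact_at N X Y g f"
    and gh: "\<And>i x. x \<in> carrier (homg C (T i) X) \<Longrightarrow> cmp C (T i) X Y f x = \<one>\<^bsub>homg C (T i) Y\<^esub>"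
  shows "f = \<one>\<^bsub>homg C X Y\<^esub>"
proof -
  have "image_functor \<iota> X Y f \<in> zero_functors C"
  proof (rule zero)
    show "image_functor \<iota> X Y f \<in> mod_cat C" by (rule image_functor_mod) (use assms in auto)
    fix i show "carrier (fobj (image_functor \<iota> X Y f) (T i)) = {\<one>\<^bsub>fobj (image_functor \<iota> X Y f) (T i)\<^esub>}"
      using one_closed[OF T[of i] assms(4)] gh
      by (fastforce simp: image_functor_def image_group_def image_iff)
  qed
  then have "\<iota> ` cmp C X X Y f ` carrier (homg C X X) = {\<iota> \<one>\<^bsub>homg C X Y\<^esub>}"
    using assms(4) by (simp add: zero_functors_def image_functor_def image_group_def)
  then have "\<iota> (cmp C X X Y f (idm C X)) = \<iota> \<one>\<^bsub>homg C X Y\<^esub>"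
    using id_closed[OF assms(4)] by blast
  then show ?thesis using assms by (simp add: inj_eq cmp_id_right)
qed

end

section \<open>Modules inside an infinite universe\<close>

text \<open>Meaningful for infinite \<open>'u\<close>, where such a bijection exists. Surjectivity
  matters as much as injectivity: every element of \<open>'u\<close> is then a pair, and carriers of
  direct sums can be described by \<open>p1\<close> and \<open>p2\<close>.\<close>

definition pairing :: "'u \<times> 'u \<Rightarrow> 'u" where
  "pairing = (SOME f. bij f)"

locale module_universe =
  fixes R :: "('u, 'm) ring_scheme" (structure)
  assumes R: "ring R" and inf: "infinite (UNIV :: 'u set)"
begin

abbreviation "md \<equiv> right_module R"
abbreviation "hm \<equiv> rmod_hom R"

definition pr :: "'u \<Rightarrow> 'u \<Rightarrow> 'u" where "pr x y = pairing (x, y)"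
definition p1 :: "'u \<Rightarrow> 'u" where "p1 z = fst (inv_into UNIV pairing z)"
definition p2 :: "'u \<Rightarrow> 'u" where "p2 z = snd (inv_into UNIV pairing z)"

lemma bij_pairing: "bij (pairing :: 'u \<times> 'u \<Rightarrow> 'u)"
proof -
  obtain f :: "'u \<times> 'u \<Rightarrow> 'u" where "bij_betw f (UNIV \<times> UNIV) UNIV"
    using card_of_Times_same_infinite[OF inf] card_of_ordIso by blast
  then have "bij f" by simp
  then show ?thesis unfolding pairing_def by (rule someI[where P = bij])
qed

lemma pr_simps [simp]: "p1 (pr x y) = x" "p2 (pr x y) = y" "pr (p1 z) (p2 z) = z"
  using bij_pairing by (simp_all add: p1_def p2_def pr_def bij_is_inj bij_is_surj surj_f_inv_f)

lemma md_abelian_group: "md M \<Longrightarrow> abelian_group M"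
  by (rule right_module.axioms)

lemma md_abelian_monoid: "md M \<Longrightarrow> abelian_monoid M"
  by (rule abelian_group.axioms(1)[OF md_abelian_group])

lemma md_minus_zero: "md M \<Longrightarrow> \<ominus>\<^bsub>M\<^esub> \<zero>\<^bsub>M\<^esub> = \<zero>\<^bsub>M\<^esub>"
  by (drule md_abelian_group, rule abelian_group.minus_equality)
    (simp_all add: abelian_group_def abelian_monoid.l_zero abelian_monoid.zero_closed)

lemma md_zero_smult:
  assumes "md M" "r \<in> carrier R"
  shows "\<zero>\<^bsub>M\<^esub> \<cdot>\<^bsub>M\<^esub> r = \<zero>\<^bsub>M\<^esub>"
proof -
  interpret M: right_module R M by fact
  have "\<zero>\<^bsub>M\<^esub> \<cdot>\<^bsub>M\<^esub> r \<oplus>\<^bsub>M\<^esub> \<zero>\<^bsub>M\<^esub> \<cdot>\<^bsub>M\<^esub> r = \<zero>\<^bsub>M\<^esub> \<cdot>\<^bsub>M\<^esub> r"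
    using M.rsmult_distr_module[of "\<zero>\<^bsub>M\<^esub>" "\<zero>\<^bsub>M\<^esub>" r] assms(2) by simp
  then show ?thesis
    using M.rsmult_closed[of "\<zero>\<^bsub>M\<^esub>" r] assms(2) M.add.l_cancel_one by simp
qed

lemma md_minus_smult:
  assumes "md M" "x \<in> carrier M" "r \<in> carrier R"
  shows "(\<ominus>\<^bsub>M\<^esub> x) \<cdot>\<^bsub>M\<^esub> r = \<ominus>\<^bsub>M\<^esub> (x \<cdot>\<^bsub>M\<^esub> r)"
proof -
  interpret M: right_module R M by fact
  show ?thesis
    using assms(2,3) md_zero_smult[OF assms(1)] M.rsmult_distr_module[of "\<ominus>\<^bsub>M\<^esub> x" x r]
    by (intro M.minus_equality[symmetric]) (auto simp: M.l_neg intro!: M.rsmult_closed)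
qed

text \<open>The premise that \<open>M\<close> is a module stays explicit, so that one instantiation
  such as \<open>md_simps[OF cpx_md[OF Y]]\<close> covers the modules of a complex in all
  degrees.\<close>

lemmas md_simps =
  abelian_monoid.a_closed[OF md_abelian_monoid]
  abelian_monoid.zero_closed[OF md_abelian_monoid]
  abelian_group.a_inv_closed[OF md_abelian_group]
  right_module.rsmult_closed[of R]
  abelian_monoid.l_zero[OF md_abelian_monoid]
  abelian_monoid.r_zero[OF md_abelian_monoid]
  abelian_group.r_neg[OF md_abelian_group]
  abelian_group.l_neg[OF md_abelian_group]
  abelian_group.minus_minus[OF md_abelian_group]
  md_minus_zero
  abelian_group.minus_add[OF md_abelian_group]
  right_module.rsmult_distr_module[of R]
  md_zero_smult
  md_minus_smult
  right_module.rsmult_one[of R]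
  abelian_group.minus_eq[OF md_abelian_group]

lemmas md_ac =
  abelian_monoid.a_assoc[OF md_abelian_monoid]
  abelian_monoid.a_comm[OF md_abelian_monoid]
  abelian_monoid.a_lcomm[OF md_abelian_monoid]

text \<open>Under AC-rewriting a term and its negative need not end up next to each other.\<close>

lemma md_cancel_apart:
  assumes "md M" "x \<in> carrier M" "y \<in> carrier M"
  shows "x \<oplus>\<^bsub>M\<^esub> (y \<oplus>\<^bsub>M\<^esub> \<ominus>\<^bsub>M\<^esub> x) = y"
    and "z \<in> carrier M \<Longrightarrow> x \<oplus>\<^bsub>M\<^esub> (y \<oplus>\<^bsub>M\<^esub> (\<ominus>\<^bsub>M\<^esub> x \<oplus>\<^bsub>M\<^esub> z)) = y \<oplus>\<^bsub>M\<^esub> z"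
    and "z \<in> carrier M \<Longrightarrow> x \<oplus>\<^bsub>M\<^esub> (y \<oplus>\<^bsub>M\<^esub> (z \<oplus>\<^bsub>M\<^esub> \<ominus>\<^bsub>M\<^esub> x)) = y \<oplus>\<^bsub>M\<^esub> z"
    and "z \<in> carrier M \<Longrightarrow> (x \<oplus>\<^bsub>M\<^esub> y = x \<oplus>\<^bsub>M\<^esub> z) = (y = z)"
proof -
  interpret M: right_module R M by fact
  have xy: "x \<in> carrier M" "y \<in> carrier M" "\<ominus>\<^bsub>M\<^esub> x \<in> carrier M" using assms by auto
  show "x \<oplus>\<^bsub>M\<^esub> (y \<oplus>\<^bsub>M\<^esub> \<ominus>\<^bsub>M\<^esub> x) = y"
    using xy M.r_neg2[of x y] by (simp only: M.a_comm[of y])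
  assume z: "z \<in> carrier M"
  then show "x \<oplus>\<^bsub>M\<^esub> (y \<oplus>\<^bsub>M\<^esub> (\<ominus>\<^bsub>M\<^esub> x \<oplus>\<^bsub>M\<^esub> z)) = y \<oplus>\<^bsub>M\<^esub> z"
    using xy M.r_neg2[of x "y \<oplus>\<^bsub>M\<^esub> z"] by (simp only: M.a_lcomm[of y "\<ominus>\<^bsub>M\<^esub> x"] M.a_closed)
  with z show "x \<oplus>\<^bsub>M\<^esub> (y \<oplus>\<^bsub>M\<^esub> (z \<oplus>\<^bsub>M\<^esub> \<ominus>\<^bsub>M\<^esub> x)) = y \<oplus>\<^bsub>M\<^esub> z"
    using xy by (simp only: M.a_comm[of z])
  show "(x \<oplus>\<^bsub>M\<^esub> y = x \<oplus>\<^bsub>M\<^esub> z) = (y = z)" using xy z by simp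
qed

lemmas md_cancel =
  abelian_group.r_neg2[OF md_abelian_group]
  abelian_group.r_neg1[OF md_abelian_group]
  md_cancel_apart

lemmas md_all = md_simps md_ac md_cancel

lemma hm_simps:
  assumes "f \<in> hm M N" "md M" "md N"
  shows "x \<in> carrier M \<Longrightarrow> f x \<in> carrier N"
    and "\<lbrakk>x \<in> carrier M; y \<in> carrier M\<rbrakk> \<Longrightarrow> f (x \<oplus>\<^bsub>M\<^esub> y) = f x \<oplus>\<^bsub>N\<^esub> f y"
    and "f \<zero>\<^bsub>M\<^esub> = \<zero>\<^bsub>N\<^esub>"
    and "x \<in> carrier M \<Longrightarrow> f (\<ominus>\<^bsub>M\<^esub> x) = \<ominus>\<^bsub>N\<^esub> f x"
    and "\<lbrakk>x \<in> carrier M; r \<in> carrier R\<rbrakk> \<Longrightarrow> f (x \<cdot>\<^bsub>M\<^esub> r) = f x \<cdot>\<^bsub>N\<^esub> r"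
proof -
  interpret M: right_module R M by fact
  interpret N: right_module R N by fact
  show c: "f x \<in> carrier N" if "x \<in> carrier M" for x using that assms by (auto simp: rmod_hom_def)
  show a: "f (x \<oplus>\<^bsub>M\<^esub> y) = f x \<oplus>\<^bsub>N\<^esub> f y" if "x \<in> carrier M" "y \<in> carrier M" for x y
    using that assms by (auto simp: rmod_hom_def)
  show z: "f \<zero>\<^bsub>M\<^esub> = \<zero>\<^bsub>N\<^esub>"
    using a[of "\<zero>\<^bsub>M\<^esub>" "\<zero>\<^bsub>M\<^esub>"] c[of "\<zero>\<^bsub>M\<^esub>"] N.add.l_cancel_one by simp
  show "f (\<ominus>\<^bsub>M\<^esub> x) = \<ominus>\<^bsub>N\<^esub> f x" if "x \<in> carrier M"
    using a[of "\<ominus>\<^bsub>M\<^esub> x" x] that c z by (intro N.minus_equality[symmetric]) (auto simp: M.l_neg)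
  show "\<lbrakk>x \<in> carrier M; r \<in> carrier R\<rbrakk> \<Longrightarrow> f (x \<cdot>\<^bsub>M\<^esub> r) = f x \<cdot>\<^bsub>N\<^esub> r"
    using assms by (auto simp: rmod_hom_def)
qed

lemma hmI:
  assumes "\<And>x. x \<in> carrier M \<Longrightarrow> f x \<in> carrier N"
    and "\<And>x y. \<lbrakk>x \<in> carrier M; y \<in> carrier M\<rbrakk> \<Longrightarrow> f (x \<oplus>\<^bsub>M\<^esub> y) = f x \<oplus>\<^bsub>N\<^esub> f y"
    and "\<And>x r. \<lbrakk>x \<in> carrier M; r \<in> carrier R\<rbrakk> \<Longrightarrow> f (x \<cdot>\<^bsub>M\<^esub> r) = f x \<cdot>\<^bsub>N\<^esub> r"
  shows "f \<in> hm M N"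
  using assms by (auto simp: rmod_hom_def)

lemma hm_comp: "\<lbrakk>f \<in> hm M N; g \<in> hm N L\<rbrakk> \<Longrightarrow> (\<lambda>x. g (f x)) \<in> hm M L"
  by (auto simp: rmod_hom_def Pi_iff)

lemma hm_id: "(\<lambda>x. x) \<in> hm M M"
  by (auto simp: rmod_hom_def)

lemma hm_zero: "\<lbrakk>md N\<rbrakk> \<Longrightarrow> (\<lambda>x. \<zero>\<^bsub>N\<^esub>) \<in> hm M N"
  by (intro hmI) (simp_all add: md_simps)

lemma hm_add:
  assumes "f \<in> hm M N" "g \<in> hm M N" "md M" "md N"
  shows "(\<lambda>x. f x \<oplus>\<^bsub>N\<^esub> g x) \<in> hm M N"
  by (intro hmI) (simp_all add: md_simps[OF assms(4)] md_ac[OF assms(4)]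
      hm_simps[OF assms(1,3,4)] hm_simps[OF assms(2,3,4)])

lemma hm_neg:
  assumes "f \<in> hm M N" "md M" "md N"
  shows "(\<lambda>x. \<ominus>\<^bsub>N\<^esub> f x) \<in> hm M N"
  by (intro hmI) (simp_all add: md_simps[OF assms(3)] hm_simps[OF assms])

lemma hm_diff:
  assumes "f \<in> hm M N" "g \<in> hm M N" "md M" "md N"
  shows "(\<lambda>x. f x \<ominus>\<^bsub>N\<^esub> g x) \<in> hm M N"
  using hm_add[OF assms(1) hm_neg[OF assms(2-4)] assms(3,4)] by (simp add: md_simps[OF assms(4)])

lemma mdI:
  assumes "\<And>x y. \<lbrakk>x \<in> carrier M; y \<in> carrier M\<rbrakk> \<Longrightarrow> x \<oplus>\<^bsub>M\<^esub> y \<in> carrier M"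
    and "\<zero>\<^bsub>M\<^esub> \<in> carrier M"
    and "\<And>x y z. \<lbrakk>x \<in> carrier M; y \<in> carrier M; z \<in> carrier M\<rbrakk> \<Longrightarrow> (x \<oplus>\<^bsub>M\<^esub> y) \<oplus>\<^bsub>M\<^esub> z = x \<oplus>\<^bsub>M\<^esub> (y \<oplus>\<^bsub>M\<^esub> z)"
    and "\<And>x y. \<lbrakk>x \<in> carrier M; y \<in> carrier M\<rbrakk> \<Longrightarrow> x \<oplus>\<^bsub>M\<^esub> y = y \<oplus>\<^bsub>M\<^esub> x"
    and "\<And>x. x \<in> carrier M \<Longrightarrow> \<zero>\<^bsub>M\<^esub> \<oplus>\<^bsub>M\<^esub> x = x"
    and "\<And>x. x \<in> carrier M \<Longrightarrow> \<exists>y\<in>carrier M. y \<oplus>\<^bsub>M\<^esub> x = \<zero>\<^bsub>M\<^esub>"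
    and "\<And>x r. \<lbrakk>x \<in> carrier M; r \<in> carrier R\<rbrakk> \<Longrightarrow> x \<cdot>\<^bsub>M\<^esub> r \<in> carrier M"
    and "\<And>x y r. \<lbrakk>x \<in> carrier M; y \<in> carrier M; r \<in> carrier R\<rbrakk> \<Longrightarrow>
      (x \<oplus>\<^bsub>M\<^esub> y) \<cdot>\<^bsub>M\<^esub> r = x \<cdot>\<^bsub>M\<^esub> r \<oplus>\<^bsub>M\<^esub> y \<cdot>\<^bsub>M\<^esub> r"
    and "\<And>x r s. \<lbrakk>x \<in> carrier M; r \<in> carrier R; s \<in> carrier R\<rbrakk> \<Longrightarrow>
      x \<cdot>\<^bsub>M\<^esub> (r \<oplus> s) = x \<cdot>\<^bsub>M\<^esub> r \<oplus>\<^bsub>M\<^esub> x \<cdot>\<^bsub>M\<^esub> s"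
    and "\<And>x r s. \<lbrakk>x \<in> carrier M; r \<in> carrier R; s \<in> carrier R\<rbrakk> \<Longrightarrow>
      x \<cdot>\<^bsub>M\<^esub> (r \<otimes> s) = (x \<cdot>\<^bsub>M\<^esub> r) \<cdot>\<^bsub>M\<^esub> s"
    and "\<And>x. x \<in> carrier M \<Longrightarrow> x \<cdot>\<^bsub>M\<^esub> \<one> = x"
  shows "md M"
proof -
  have "abelian_group M" by (rule abelian_groupI) (use assms in auto)
  then show ?thesis using R assms by (intro right_module.intro right_module_axioms.intro) auto
qed

lemma md_regular: "md (regular_rmod R)"
proof -
  interpret ring R by (rule R)
  show ?thesis
    by (rule mdI) (auto simp: regular_rmod_def a_ac l_distr r_distr m_assoc intro: l_neg a_inv_closed)
qed

lemma regular_simps [simp]: "carrier (regular_rmod R) = carrier R" "zero (regular_rmod R) = zero R"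
  "add (regular_rmod R) = add R" "rsmult (regular_rmod R) = mult R"
  by (simp_all add: regular_rmod_def)

lemma zero_rmod_simps [simp]: "carrier (zero_rmod R) = {\<zero>}" "zero (zero_rmod R) = zero R"
  "add (zero_rmod R) = add R" "rsmult (zero_rmod R) = mult R"
  by (simp_all add: zero_rmod_def regular_rmod_def)

lemma md_zero: "md (zero_rmod R)"
proof -
  interpret ring R by (rule R)
  show ?thesis by (rule mdI) auto
qed

text \<open>Closure under negatives comes from multiplication by \<open>\<ominus> \<one>\<close>, as
  \<open>submod_md\<close> shows.\<close>

definition submod :: "('u, 'b) rmod \<Rightarrow> 'b set \<Rightarrow> bool" where
  "submod M L \<longleftrightarrow> L \<subseteq> carrier M \<and> \<zero>\<^bsub>M\<^esub> \<in> L \<and> (\<forall>x\<in>L. \<forall>y\<in>L. x \<oplus>\<^bsub>M\<^esub> y \<in> L) \<and>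
     (\<forall>x\<in>L. \<forall>r\<in>carrier R. x \<cdot>\<^bsub>M\<^esub> r \<in> L)"

lemma submod_carrier: "md M \<Longrightarrow> submod M (carrier M)"
  by (simp add: submod_def md_simps)

lemma submod_vimage:
  assumes "f \<in> hm M N" "md M" "md N" "submod N L"
  shows "submod M {x \<in> carrier M. f x \<in> L}"
  using assms(4) unfolding submod_def by (auto simp: hm_simps[OF assms(1-3)] md_simps[OF assms(2)])

lemma submod_image:
  assumes "f \<in> hm M N" "md M" "md N"
  shows "submod N (f ` carrier M)"
proof -
  note s = hm_simps[OF assms] md_simps[OF assms(2)]
  have "\<zero>\<^bsub>N\<^esub> \<in> f ` carrier M" by (rule image_eqI[of _ _ "\<zero>\<^bsub>M\<^esub>"]) (simp_all add: s)
  then show ?thesis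
    unfolding submod_def using s by (auto simp: s(2)[symmetric] s(5)[symmetric] simp del: s(2,5))
qed

lemma submod_md:
  assumes "md M" "submod M L"
  shows "md (M\<lparr>carrier := L\<rparr>)"
proof -
  interpret M: right_module R M by fact
  have c: "\<And>x. x \<in> L \<Longrightarrow> x \<in> carrier M" and L: "\<zero>\<^bsub>M\<^esub> \<in> L" "\<And>x y. \<lbrakk>x \<in> L; y \<in> L\<rbrakk> \<Longrightarrow> x \<oplus>\<^bsub>M\<^esub> y \<in> L"
    "\<And>x r. \<lbrakk>x \<in> L; r \<in> carrier R\<rbrakk> \<Longrightarrow> x \<cdot>\<^bsub>M\<^esub> r \<in> L" using assms(2) by (auto simp: submod_def)
  have n: "\<exists>y\<in>L. y \<oplus>\<^bsub>M\<^esub> x = \<zero>\<^bsub>M\<^esub>" if "x \<in> L" for x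
  proof (rule bexI)
    have "x \<cdot>\<^bsub>M\<^esub> (\<ominus> \<one>) \<oplus>\<^bsub>M\<^esub> x = x \<cdot>\<^bsub>M\<^esub> (\<ominus> \<one> \<oplus> \<one>)"
      using c[OF that] by (simp add: M.rsmult_distr_ring M.rsmult_one)
    also have "\<dots> = x \<cdot>\<^bsub>M\<^esub> \<zero>" by (simp add: M.R.l_neg)
    also have "\<dots> = \<zero>\<^bsub>M\<^esub>"
      using M.rsmult_distr_ring[OF c[OF that], of "\<zero>" "\<zero>"] M.rsmult_closed[OF c[OF that], of "\<zero>"]
        M.add.l_cancel_one by simp
    finally show "x \<cdot>\<^bsub>M\<^esub> (\<ominus> \<one>) \<oplus>\<^bsub>M\<^esub> x = \<zero>\<^bsub>M\<^esub>" .
  qed (use L that in auto)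
  show ?thesis
    by (rule mdI) (use L n c in \<open>auto simp: M.a_ac M.rsmult_distr_module M.rsmult_distr_ring
        M.rsmult_assoc M.rsmult_one\<close>)
qed

section \<open>Projective modules and direct sums\<close>

lemma proj_md: "projective_rmod R P \<Longrightarrow> md P"
  by (simp add: projective_rmod_def)

text \<open>Projectivity lifts along surjections only, so the target is cut down to the image of
  \<open>p\<close>, which contains all values of \<open>f\<close>. This is the form in which
  homotopies are built.\<close>

lemma proj_lift:
  fixes P :: "('u, 'u) rmod" and M N :: "('u, 'u) rmod"
  assumes "projective_rmod R P" "md M" "md N" "p \<in> hm M N" "f \<in> hm P N"
    and "\<And>x. x \<in> carrier P \<Longrightarrow> \<exists>y\<in>carrier M. p y = f x"
  shows "\<exists>g\<in>hm P M. \<forall>x\<in>carrier P. p (g x) = f x"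
proof -
  let ?N = "N\<lparr>carrier := p ` carrier M\<rparr>"
  have "md ?N" by (rule submod_md[OF assms(3) submod_image[OF assms(4,2,3)]])
  moreover have "p \<in> hm M ?N" "f \<in> hm P ?N"
    using assms by (auto simp: rmod_hom_def Pi_iff) (metis imageI)
  ultimately show ?thesis using assms(1,2) unfolding projective_rmod_def by auto
qed

definition dsum :: "('u, 'u) rmod \<Rightarrow> ('u, 'u) rmod \<Rightarrow> ('u, 'u) rmod" where
  "dsum M N = \<lparr>carrier = {z. p1 z \<in> carrier M \<and> p2 z \<in> carrier N}, mult = undefined, one = undefined,
     zero = pr \<zero>\<^bsub>M\<^esub> \<zero>\<^bsub>N\<^esub>, add = (\<lambda>x y. pr (p1 x \<oplus>\<^bsub>M\<^esub> p1 y) (p2 x \<oplus>\<^bsub>N\<^esub> p2 y)),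
     rsmult = (\<lambda>x r. pr (p1 x \<cdot>\<^bsub>M\<^esub> r) (p2 x \<cdot>\<^bsub>N\<^esub> r))\<rparr>"

lemma dsum_simps: "z \<in> carrier (dsum M N) \<longleftrightarrow> p1 z \<in> carrier M \<and> p2 z \<in> carrier N"
  "\<zero>\<^bsub>dsum M N\<^esub> = pr \<zero>\<^bsub>M\<^esub> \<zero>\<^bsub>N\<^esub>" "x \<oplus>\<^bsub>dsum M N\<^esub> y = pr (p1 x \<oplus>\<^bsub>M\<^esub> p1 y) (p2 x \<oplus>\<^bsub>N\<^esub> p2 y)"
  "x \<cdot>\<^bsub>dsum M N\<^esub> r = pr (p1 x \<cdot>\<^bsub>M\<^esub> r) (p2 x \<cdot>\<^bsub>N\<^esub> r)"
  by (simp_all add: dsum_def)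

lemma pr_eq: "pr a b = pr c d \<longleftrightarrow> a = c \<and> b = d"
  by (metis pr_simps(1,2))

lemma eq_pr: "z = pr c d \<longleftrightarrow> p1 z = c \<and> p2 z = d"
  by (metis pr_simps)

lemma md_dsum:
  assumes "md M" "md N"
  shows "md (dsum M N)"
proof -
  interpret M: right_module R M by fact
  interpret N: right_module R N by fact
  show ?thesis
  proof (rule mdI)
    fix x assume "x \<in> carrier (dsum M N)"
    then show "\<exists>y\<in>carrier (dsum M N). y \<oplus>\<^bsub>dsum M N\<^esub> x = \<zero>\<^bsub>dsum M N\<^esub>"
      by (intro bexI[of _ "pr (\<ominus>\<^bsub>M\<^esub> p1 x) (\<ominus>\<^bsub>N\<^esub> p2 x)"]) (auto simp: dsum_simps M.l_neg N.l_neg)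
  qed (auto simp: dsum_simps pr_eq M.a_ac N.a_ac M.rsmult_distr_module N.rsmult_distr_module
      M.rsmult_distr_ring N.rsmult_distr_ring M.rsmult_assoc N.rsmult_assoc M.rsmult_one N.rsmult_one
      M.rsmult_closed N.rsmult_closed)
qed

lemma dsum_neg:
  assumes "md M" "md N" "z \<in> carrier (dsum M N)"
  shows "\<ominus>\<^bsub>dsum M N\<^esub> z = pr (\<ominus>\<^bsub>M\<^esub> p1 z) (\<ominus>\<^bsub>N\<^esub> p2 z)"
proof -
  interpret D: right_module R "dsum M N" by (rule md_dsum) fact+
  interpret M: right_module R M by fact
  interpret N: right_module R N by fact
  show ?thesis
    using assms(3) by (intro D.minus_equality) (auto simp: dsum_simps M.l_neg N.l_neg)
qed

lemma hm_p1: "p1 \<in> hm (dsum M N) M" and hm_p2: "p2 \<in> hm (dsum M N) N"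
  by (auto intro!: hmI simp: dsum_simps)

lemma hm_pr: "\<lbrakk>f \<in> hm L M; g \<in> hm L N\<rbrakk> \<Longrightarrow> (\<lambda>x. pr (f x) (g x)) \<in> hm L (dsum M N)"
  by (auto intro!: hmI simp: dsum_simps rmod_hom_def)

lemma hm_in1: "\<lbrakk>md M; md N\<rbrakk> \<Longrightarrow> (\<lambda>x. pr x \<zero>\<^bsub>N\<^esub>) \<in> hm M (dsum M N)"
  and hm_in2: "\<lbrakk>md M; md N\<rbrakk> \<Longrightarrow> (\<lambda>x. pr \<zero>\<^bsub>M\<^esub> x) \<in> hm N (dsum M N)"
  by (intro hm_pr hm_id hm_zero; assumption)+

lemma proj_regular: "projective_rmod R (regular_rmod R)"
  unfolding projective_rmod_def
proof (intro conjI allI ballI impI md_regular)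
  interpret ring R by (rule R)
  fix M N :: "('u, 'u) rmod" and p f
  assume p: "p \<in> hm M N" and f: "f \<in> hm (regular_rmod R) N" and M: "md M" and N: "md N"
    and s: "p ` carrier M = carrier N"
  interpret M: right_module R M by fact
  have "f \<one> \<in> carrier N" using hm_simps[OF f md_regular N] by simp
  then obtain m where m: "m \<in> carrier M" "p m = f \<one>" using s by (metis imageE)
  show "\<exists>g\<in>hm (regular_rmod R) M. \<forall>x\<in>carrier (regular_rmod R). p (g x) = f x"
  proof (intro bexI ballI)
    show "(\<lambda>r. m \<cdot>\<^bsub>M\<^esub> r) \<in> hm (regular_rmod R) M"
      using m by (intro hmI) (simp_all add: M.rsmult_closed M.rsmult_distr_ring M.rsmult_assoc)
    fix x assume "x \<in> carrier (regular_rmod R)"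
    then show "p (m \<cdot>\<^bsub>M\<^esub> x) = f x"
      using hm_simps(5)[OF p M N m(1), of x] hm_simps(5)[OF f md_regular N, of "\<one>" x] m by simp
  qed
qed

lemma proj_zero: "projective_rmod R (zero_rmod R)"
  unfolding projective_rmod_def
proof (intro conjI allI ballI impI md_zero)
  fix M N :: "('u, 'u) rmod" and p f
  assume p: "p \<in> hm M N" and f: "f \<in> hm (zero_rmod R) N" and M: "md M" and N: "md N"
  show "\<exists>g\<in>hm (zero_rmod R) M. \<forall>x\<in>carrier (zero_rmod R). p (g x) = f x"
    using hm_simps(3)[OF p M N] hm_simps(3)[OF f md_zero N]
    by (intro bexI[OF _ hm_zero[OF M]]) simp
qed

text \<open>The restrictions of \<open>f\<close> to the two summands are lifted separately, and the
  lifts are added after projecting.\<close>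

lemma proj_dsum:
  assumes P: "projective_rmod R P" and Q: "projective_rmod R Q"
  shows "projective_rmod R (dsum P Q)"
  unfolding projective_rmod_def
proof (intro conjI allI ballI impI)
  have mP: "md P" and mQ: "md Q" using P Q by (simp_all add: projective_rmod_def)
  show mD: "md (dsum P Q)" by (rule md_dsum) fact+
  fix M N :: "('u, 'u) rmod" and p f
  assume p: "p \<in> hm M N" and f: "f \<in> hm (dsum P Q) N" and M: "md M" and N: "md N"
    and s: "p ` carrier M = carrier N"
  have "(\<lambda>x. f (pr x \<zero>\<^bsub>Q\<^esub>)) \<in> hm P N" "(\<lambda>x. f (pr \<zero>\<^bsub>P\<^esub> x)) \<in> hm Q N"
    using hm_comp[OF hm_in1[OF mP mQ] f] hm_comp[OF hm_in2[OF mP mQ] f] .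
  then obtain g h where g: "g \<in> hm P M" "\<And>x. x \<in> carrier P \<Longrightarrow> p (g x) = f (pr x \<zero>\<^bsub>Q\<^esub>)"
    and h: "h \<in> hm Q M" "\<And>x. x \<in> carrier Q \<Longrightarrow> p (h x) = f (pr \<zero>\<^bsub>P\<^esub> x)"
    using P Q M N p s unfolding projective_rmod_def by meson
  show "\<exists>g\<in>hm (dsum P Q) M. \<forall>x\<in>carrier (dsum P Q). p (g x) = f x"
  proof (intro bexI ballI)
    show "(\<lambda>z. g (p1 z) \<oplus>\<^bsub>M\<^esub> h (p2 z)) \<in> hm (dsum P Q) M"
      by (intro hm_add hm_comp[OF hm_p1 g(1)] hm_comp[OF hm_p2 h(1)] mD M)
    fix z assume "z \<in> carrier (dsum P Q)"
    then have z: "p1 z \<in> carrier P" "p2 z \<in> carrier Q" by (auto simp: dsum_simps)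
    have "p (g (p1 z) \<oplus>\<^bsub>M\<^esub> h (p2 z)) = f (pr (p1 z) \<zero>\<^bsub>Q\<^esub>) \<oplus>\<^bsub>N\<^esub> f (pr \<zero>\<^bsub>P\<^esub> (p2 z))"
      using z g h hm_simps[OF p M N] hm_simps[OF g(1) mP M] hm_simps[OF h(1) mQ M] by simp
    also have "\<dots> = f (pr (p1 z) \<zero>\<^bsub>Q\<^esub> \<oplus>\<^bsub>dsum P Q\<^esub> pr \<zero>\<^bsub>P\<^esub> (p2 z))"
      using z md_simps(2)[OF mP] md_simps(2)[OF mQ]
      by (subst hm_simps(2)[OF f mD N]) (auto simp: dsum_simps)
    also have "\<dots> = f z"
      using z md_simps[OF mP] md_simps[OF mQ] by (simp add: dsum_simps)
    finally show "p (g (p1 z) \<oplus>\<^bsub>M\<^esub> h (p2 z)) = f z" .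
  qed
qed

section \<open>Finite generation and free modules\<close>

lemma submod_finsum:
  assumes "md M" "submod M L" "finite S" "S \<subseteq> L" "c \<in> S \<rightarrow> carrier R"
  shows "(\<Oplus>\<^bsub>M\<^esub>s\<in>S. s \<cdot>\<^bsub>M\<^esub> c s) \<in> L"
proof -
  interpret M: right_module R M by fact
  have L: "L \<subseteq> carrier M" using assms(2) by (simp add: submod_def)
  show ?thesis
    using assms(3-5)
  proof (induction S rule: finite_induct)
    case empty
    then show ?case using assms(2) by (simp add: submod_def)
  next
    case (insert x F)
    have "(\<Oplus>\<^bsub>M\<^esub>s\<in>insert x F. s \<cdot>\<^bsub>M\<^esub> c s) = x \<cdot>\<^bsub>M\<^esub> c x \<oplus>\<^bsub>M\<^esub> (\<Oplus>\<^bsub>M\<^esub>s\<in>F. s \<cdot>\<^bsub>M\<^esub> c s)"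
      using insert L by (intro M.finsum_insert) (auto intro!: M.rsmult_closed)
    also have "\<dots> \<in> L" using insert assms(2) by (auto simp: submod_def)
    finally show ?case .
  qed
qed

text \<open>Generation is used in this form: a submodule containing the generators is everything.
  Coefficient families are confined to this lemma, its helper \<open>submod_finsum\<close> and the
  converse \<open>fgI\<close>.\<close>

lemma fgD:
  assumes "md M" "fg_rmod R M"
  obtains S where "finite S" "S \<subseteq> carrier M" "\<And>L. submod M L \<Longrightarrow> S \<subseteq> L \<Longrightarrow> L = carrier M"
proof -
  obtain S where S: "finite S" "S \<subseteq> carrier M"
    "\<And>x. x \<in> carrier M \<Longrightarrow> \<exists>c\<in>S \<rightarrow> carrier R. x = (\<Oplus>\<^bsub>M\<^esub>s\<in>S. s \<cdot>\<^bsub>M\<^esub> c s)"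
    using assms(2) unfolding fg_rmod_def by blast
  show thesis
  proof (rule that[OF S(1,2)])
    fix L assume L: "submod M L" "S \<subseteq> L"
    have "x \<in> L" if "x \<in> carrier M" for x
      using S(3)[OF that] submod_finsum[OF assms(1) L(1) S(1) L(2)] by blast
    then show "L = carrier M" using L by (auto simp: submod_def)
  qed
qed

text \<open>The linear combinations \<open>?L\<close> of \<open>S\<close> form a submodule
  containing \<open>S\<close>, so the assumption makes them exhaust \<open>M\<close>.\<close>

lemma fgI:
  assumes M: "md M" and S: "finite S" "S \<subseteq> carrier M"
    and "\<And>L. submod M L \<Longrightarrow> S \<subseteq> L \<Longrightarrow> L = carrier M"
  shows "fg_rmod R M"
proof -
  interpret M: right_module R M by fact
  let ?s = "\<lambda>c. (\<Oplus>\<^bsub>M\<^esub>s\<in>S. s \<cdot>\<^bsub>M\<^esub> c s)"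
  let ?L = "?s ` (S \<rightarrow> carrier R)"
  have z: "x \<cdot>\<^bsub>M\<^esub> \<zero> = \<zero>\<^bsub>M\<^esub>" if "x \<in> carrier M" for x
    using M.rsmult_distr_ring[OF that, of "\<zero>" "\<zero>"] M.rsmult_closed[OF that, of "\<zero>"]
        M.add.l_cancel_one by simp
  have cl: "(\<lambda>s. s \<cdot>\<^bsub>M\<^esub> c s) \<in> S \<rightarrow> carrier M" if "c \<in> S \<rightarrow> carrier R" for c
    using that S by (auto intro!: M.rsmult_closed)
  have "submod M ?L"
    unfolding submod_def
  proof (intro conjI ballI)
    show "?L \<subseteq> carrier M" using cl by (auto intro!: M.finsum_closed)
    have "?s (\<lambda>s. \<zero>) = (\<Oplus>\<^bsub>M\<^esub>s\<in>S. \<zero>\<^bsub>M\<^esub>)" using S z by (intro M.finsum_cong') auto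
    then have "?s (\<lambda>s. \<zero>) = \<zero>\<^bsub>M\<^esub>" by simp
    then show "\<zero>\<^bsub>M\<^esub> \<in> ?L" by (intro image_eqI[of _ _ "\<lambda>s. \<zero>"]) auto
    fix x assume "x \<in> ?L"
    then obtain c where c: "c \<in> S \<rightarrow> carrier R" "x = ?s c" by auto
    { fix y assume "y \<in> ?L"
      then obtain d where d: "d \<in> S \<rightarrow> carrier R" "y = ?s d" by auto
      have "x \<oplus>\<^bsub>M\<^esub> y = (\<Oplus>\<^bsub>M\<^esub>s\<in>S. s \<cdot>\<^bsub>M\<^esub> c s \<oplus>\<^bsub>M\<^esub> s \<cdot>\<^bsub>M\<^esub> d s)"
        using c d cl by (simp add: M.finsum_addf)
      also have "\<dots> = ?s (\<lambda>s. c s \<oplus> d s)"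
        using c d S by (intro M.finsum_cong') (auto intro!: M.rsmult_closed M.rsmult_distr_ring[symmetric])
      finally show "x \<oplus>\<^bsub>M\<^esub> y \<in> ?L" using c d by (auto intro!: image_eqI) }
    { fix r assume r: "r \<in> carrier R"
      \<comment> \<open>Stated for all finite subsets of \<open>S\<close>, so that induction on
        finite sets applies while \<open>c\<close> keeps its domain \<open>S\<close>.\<close>
      have "(\<Oplus>\<^bsub>M\<^esub>s\<in>T. s \<cdot>\<^bsub>M\<^esub> c s) \<cdot>\<^bsub>M\<^esub> r = (\<Oplus>\<^bsub>M\<^esub>s\<in>T. s \<cdot>\<^bsub>M\<^esub> (c s \<otimes> r))"
        if "T \<subseteq> S" "finite T" for T
        using that(2,1)
      proof (induction T rule: finite_induct)
        case empty
        then show ?case using md_simps(13)[OF M r] by simp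
      next
        case (insert t T)
        have 1: "(\<lambda>s. s \<cdot>\<^bsub>M\<^esub> c s) \<in> T \<rightarrow> carrier M" "t \<cdot>\<^bsub>M\<^esub> c t \<in> carrier M"
          using insert cl[OF c(1)] by auto
        have 2: "(\<lambda>s. s \<cdot>\<^bsub>M\<^esub> (c s \<otimes> r)) \<in> T \<rightarrow> carrier M" "t \<cdot>\<^bsub>M\<^esub> (c t \<otimes> r) \<in> carrier M"
          using insert c S r by (auto intro!: M.rsmult_closed)
        have 3: "(t \<cdot>\<^bsub>M\<^esub> c t) \<cdot>\<^bsub>M\<^esub> r = t \<cdot>\<^bsub>M\<^esub> (c t \<otimes> r)"
          using insert c S r by (subst M.rsmult_assoc) auto
        show ?case using insert 1 2 3 r
          by (simp add: M.finsum_insert M.rsmult_distr_module M.finsum_closed)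
      qed
      then have "x \<cdot>\<^bsub>M\<^esub> r = ?s (\<lambda>s. c s \<otimes> r)" using c S by simp
      then show "x \<cdot>\<^bsub>M\<^esub> r \<in> ?L" using c r by (auto intro!: image_eqI) }
  qed
  moreover have "S \<subseteq> ?L"
  proof
    fix t assume t: "t \<in> S"
    have "?s (\<lambda>s. if t = s then \<one> else \<zero>) = (\<Oplus>\<^bsub>M\<^esub>s\<in>S. if t = s then s else \<zero>\<^bsub>M\<^esub>)"
      using S z by (intro M.finsum_cong') (auto simp: M.rsmult_one)
    also have "\<dots> = t" using t S by (subst M.finsum_singleton) auto
    finally show "t \<in> ?L" by (intro image_eqI[of _ _ "\<lambda>s. if t = s then \<one> else \<zero>"]) auto
  qed
  ultimately have "?L = carrier M" by (rule assms(4))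
  then show ?thesis unfolding fg_rmod_def using S by (intro exI[of _ S]) blast
qed

lemma fg_zero: "fg_rmod R (zero_rmod R)"
  by (rule fgI[OF md_zero, of "{}"]) (auto simp: submod_def)

lemma fg_regular: "fg_rmod R (regular_rmod R)"
proof (rule fgI[OF md_regular, of "{\<one>}"])
  interpret ring R by (rule R)
  show "{\<one>} \<subseteq> carrier (regular_rmod R)" by simp
  fix L assume L: "submod (regular_rmod R) L" "{\<one>} \<subseteq> L"
  then have "\<And>r. r \<in> carrier R \<Longrightarrow> \<one> \<otimes> r \<in> L" by (auto simp: submod_def)
  then show "L = carrier (regular_rmod R)" using L by (auto simp: submod_def)
qed simp

lemma fg_dsum:
  assumes "md M" "md N" "fg_rmod R M" "fg_rmod R N"
  shows "fg_rmod R (dsum M N)"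
proof -
  obtain S where S: "finite S" "S \<subseteq> carrier M" "\<And>L. submod M L \<Longrightarrow> S \<subseteq> L \<Longrightarrow> L = carrier M"
    using fgD[OF assms(1,3)] by blast
  obtain T where T: "finite T" "T \<subseteq> carrier N" "\<And>L. submod N L \<Longrightarrow> T \<subseteq> L \<Longrightarrow> L = carrier N"
    using fgD[OF assms(2,4)] by blast
  have mD: "md (dsum M N)" by (rule md_dsum) fact+
  show ?thesis
  proof (rule fgI[OF mD, of "(\<lambda>x. pr x \<zero>\<^bsub>N\<^esub>) ` S \<union> (\<lambda>x. pr \<zero>\<^bsub>M\<^esub> x) ` T"])
    show "(\<lambda>x. pr x \<zero>\<^bsub>N\<^esub>) ` S \<union> (\<lambda>x. pr \<zero>\<^bsub>M\<^esub> x) ` T \<subseteq> carrier (dsum M N)"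
      using S T md_simps[OF assms(1)] md_simps[OF assms(2)] by (auto simp: dsum_simps)
    fix L assume L: "submod (dsum M N) L" "(\<lambda>x. pr x \<zero>\<^bsub>N\<^esub>) ` S \<union> (\<lambda>x. pr \<zero>\<^bsub>M\<^esub> x) ` T \<subseteq> L"
    have 1: "{x \<in> carrier M. pr x \<zero>\<^bsub>N\<^esub> \<in> L} = carrier M"
      using S L by (intro S(3) submod_vimage[OF hm_in1 assms(1) mD] assms) auto
    have 2: "{x \<in> carrier N. pr \<zero>\<^bsub>M\<^esub> x \<in> L} = carrier N"
      using T L by (intro T(3) submod_vimage[OF hm_in2 assms(2) mD] assms) auto
    have "z \<in> L" if "z \<in> carrier (dsum M N)" for z
    proof -
      have z: "p1 z \<in> carrier M" "p2 z \<in> carrier N" using that by (auto simp: dsum_simps)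
      then have "pr (p1 z) \<zero>\<^bsub>N\<^esub> \<in> L" "pr \<zero>\<^bsub>M\<^esub> (p2 z) \<in> L" using 1 2 by auto
      then have "pr (p1 z) \<zero>\<^bsub>N\<^esub> \<oplus>\<^bsub>dsum M N\<^esub> pr \<zero>\<^bsub>M\<^esub> (p2 z) \<in> L" using L by (simp add: submod_def)
      then show ?thesis
        using z md_simps[OF assms(1)] md_simps[OF assms(2)] by (simp add: dsum_simps)
    qed
    then show "L = carrier (dsum M N)" using L by (auto simp: submod_def)
  qed (use S T in auto)
qed

text \<open>A second model of the free modules. Elements of \<open>free_rmod\<close> are functions
  of type \<open>nat \<Rightarrow> 'u\<close>, so that model cannot occur in a complex; this one
  lives in \<open>'u\<close>.\<close>

primrec free :: "nat \<Rightarrow> ('u, 'u) rmod" where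
  "free 0 = zero_rmod R"
| "free (Suc n) = dsum (regular_rmod R) (free n)"

lemma free_props: "projective_rmod R (free n)" "fg_rmod R (free n)"
proof (induction n)
  case (Suc n)
  { case 1 then show ?case using Suc by (simp add: proj_dsum proj_regular) }
  { case 2 then show ?case using Suc by (simp add: fg_dsum fg_regular md_regular proj_md) }
qed (simp_all add: proj_zero fg_zero)

lemma md_free: "md (free n)"
  using free_props proj_md by blast

lemma smult_hom: "\<lbrakk>md M; m \<in> carrier M\<rbrakk> \<Longrightarrow> (\<lambda>r. m \<cdot>\<^bsub>M\<^esub> r) \<in> hm (regular_rmod R) M"
  by (intro hmI) (simp_all add: right_module.rsmult_closed right_module.rsmult_distr_ring
      right_module.rsmult_assoc)

text \<open>Each generator contributes one more copy of \<open>R\<close>. Keeping the image inside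
  \<open>L\<close> allows a submodule to be covered, which is needed for the annihilator of a ring
  element.\<close>

lemma free_cover:
  fixes M :: "('u, 'u) rmod"
  assumes M: "md M" and "finite S" "S \<subseteq> L" "submod M L"
  shows "\<exists>k. \<exists>a\<in>hm (free k) M. S \<subseteq> a ` carrier (free k) \<and> a ` carrier (free k) \<subseteq> L"
  using assms(2,3)
proof (induction S rule: finite_induct)
  case empty
  show ?case
    using hm_zero[OF M, of "free 0"] assms(4) by (intro exI[of _ 0] bexI[of _ "\<lambda>x. \<zero>\<^bsub>M\<^esub>"]) (auto simp: submod_def)
next
  case (insert s S)
  then obtain k a where a: "a \<in> hm (free k) M" "S \<subseteq> a ` carrier (free k)" "a ` carrier (free k) \<subseteq> L"
    by auto
  interpret ring R by (rule R)
  interpret M: right_module R M by fact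
  have s: "s \<in> L" "s \<in> carrier M" using insert assms(4) by (auto simp: submod_def)
  have z: "s \<cdot>\<^bsub>M\<^esub> \<zero> = \<zero>\<^bsub>M\<^esub>"
    using hm_simps(3)[OF smult_hom[OF M s(2)] md_regular M] by simp
  have aL: "a y \<in> L" if "y \<in> carrier (free k)" for y using a(3) that by blast
  let ?b = "\<lambda>z. s \<cdot>\<^bsub>M\<^esub> p1 z \<oplus>\<^bsub>M\<^esub> a (p2 z)"
  note as = hm_simps[OF a(1) md_free M] and fs = md_simps[OF md_free[of k]]
  have "?b \<in> hm (free (Suc k)) M"
    using hm_add[OF hm_comp[OF hm_p1 smult_hom[OF M s(2)]] hm_comp[OF hm_p2 a(1)]] md_free[of "Suc k"] M
    by simp
  moreover have "insert s S \<subseteq> ?b ` carrier (free (Suc k))"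
  proof
    fix t assume "t \<in> insert s S"
    then consider "t = s" | "t \<in> S" by auto
    then show "t \<in> ?b ` carrier (free (Suc k))"
    proof cases
      case 1
      then show ?thesis using s
        by (intro image_eqI[of _ _ "pr \<one> \<zero>\<^bsub>free k\<^esub>"]) (auto simp: dsum_simps as fs M.rsmult_one)
    next
      case 2
      then obtain x where "x \<in> carrier (free k)" "t = a x" using a(2) by auto
      then show ?thesis
        by (intro image_eqI[of _ _ "pr \<zero> x"]) (auto simp: dsum_simps as z)
    qed
  qed
  moreover have "?b ` carrier (free (Suc k)) \<subseteq> L"
    using s aL assms(4) by (auto simp: dsum_simps submod_def)
  ultimately show ?case by blast
qed

lemma fg_cover:
  fixes M :: "('u, 'u) rmod"
  assumes "md M" "fg_rmod R M"
  obtains k a where "a \<in> hm (free k) M" "a ` carrier (free k) = carrier M"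
proof -
  obtain S where S: "finite S" "S \<subseteq> carrier M" "\<And>L. submod M L \<Longrightarrow> S \<subseteq> L \<Longrightarrow> L = carrier M"
    using fgD[OF assms] by blast
  obtain k a where a: "a \<in> hm (free k) M" "S \<subseteq> a ` carrier (free k)"
    using free_cover[OF assms(1) S(1,2) submod_carrier[OF assms(1)]] by blast
  show thesis by (rule that[OF a(1) S(3)[OF submod_image[OF a(1) md_free assms(1)] a(2)]])
qed

section \<open>Complexes and homotopies\<close>

abbreviation ccomp :: "'u cmap \<Rightarrow> 'u cmap \<Rightarrow> 'u cmap" (infixr "**" 75) where
  "f ** g \<equiv> chain_comp f g"

abbreviation "cpx \<equiv> complexes R"
abbreviation "cm \<equiv> chain_map R"
abbreviation "hot \<equiv> homotopic R"

lemma cpx_md: "X \<in> cpx \<Longrightarrow> md (cobj X n)"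
  by (simp add: complexes_def)

lemma cpx_d: "\<lbrakk>X \<in> cpx; m = n + 1\<rbrakk> \<Longrightarrow> cdiff X n \<in> hm (cobj X n) (cobj X m)"
  by (simp add: complexes_def)

text \<open>The equations between degrees let rewriting apply to indices such as \<open>n\<close> and \<open>n - 1\<close>.\<close>

lemma cpx_simps:
  assumes "X \<in> cpx"
  shows "md (cobj X n)"
    and "\<lbrakk>m = n + 1; x \<in> carrier (cobj X n)\<rbrakk> \<Longrightarrow> cdiff X n x \<in> carrier (cobj X m)"
    and "\<lbrakk>x \<in> carrier (cobj X n); y \<in> carrier (cobj X n)\<rbrakk> \<Longrightarrow>
      cdiff X n (x \<oplus>\<^bsub>cobj X n\<^esub> y) = cdiff X n x \<oplus>\<^bsub>cobj X (n + 1)\<^esub> cdiff X n y"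
    and "cdiff X n \<zero>\<^bsub>cobj X n\<^esub> = \<zero>\<^bsub>cobj X (n + 1)\<^esub>"
    and "x \<in> carrier (cobj X n) \<Longrightarrow> cdiff X n (\<ominus>\<^bsub>cobj X n\<^esub> x) = \<ominus>\<^bsub>cobj X (n + 1)\<^esub> cdiff X n x"
    and "\<lbrakk>x \<in> carrier (cobj X n); r \<in> carrier R\<rbrakk> \<Longrightarrow>
      cdiff X n (x \<cdot>\<^bsub>cobj X n\<^esub> r) = cdiff X n x \<cdot>\<^bsub>cobj X (n + 1)\<^esub> r"
    and "\<lbrakk>m = n + 1; x \<in> carrier (cobj X n)\<rbrakk> \<Longrightarrow> cdiff X m (cdiff X n x) = \<zero>\<^bsub>cobj X (m + 1)\<^esub>"
  using assms hm_simps[OF cpx_d[OF assms refl, of n] cpx_md[OF assms] cpx_md[OF assms]]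
  by (auto simp: complexes_def)

lemma cpxI:
  assumes "\<And>n. md (cobj X n)" "\<And>n. cdiff X n \<in> hm (cobj X n) (cobj X (n + 1))"
    and "\<And>n x. x \<in> carrier (cobj X n) \<Longrightarrow> cdiff X (n + 1) (cdiff X n x) = \<zero>\<^bsub>cobj X (n + 1 + 1)\<^esub>"
  shows "X \<in> cpx"
  using assms by (auto simp: complexes_def)

lemma cm_simps:
  assumes "cm X Y f" "X \<in> cpx" "Y \<in> cpx"
  shows "x \<in> carrier (cobj X n) \<Longrightarrow> f n x \<in> carrier (cobj Y n)"
    and "\<lbrakk>x \<in> carrier (cobj X n); y \<in> carrier (cobj X n)\<rbrakk> \<Longrightarrow>
      f n (x \<oplus>\<^bsub>cobj X n\<^esub> y) = f n x \<oplus>\<^bsub>cobj Y n\<^esub> f n y"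
    and "f n \<zero>\<^bsub>cobj X n\<^esub> = \<zero>\<^bsub>cobj Y n\<^esub>"
    and "x \<in> carrier (cobj X n) \<Longrightarrow> f n (\<ominus>\<^bsub>cobj X n\<^esub> x) = \<ominus>\<^bsub>cobj Y n\<^esub> f n x"
    and "\<lbrakk>x \<in> carrier (cobj X n); r \<in> carrier R\<rbrakk> \<Longrightarrow> f n (x \<cdot>\<^bsub>cobj X n\<^esub> r) = f n x \<cdot>\<^bsub>cobj Y n\<^esub> r"
    and "\<lbrakk>m = n + 1; x \<in> carrier (cobj X n)\<rbrakk> \<Longrightarrow> f m (cdiff X n x) = cdiff Y n (f n x)"
  using assms(1) hm_simps[of "f n" "cobj X n" "cobj Y n", OF _ cpx_md[OF assms(2)] cpx_md[OF assms(3)]]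
  by (auto simp: chain_map_def)

lemma cm_hm: "cm X Y f \<Longrightarrow> f n \<in> hm (cobj X n) (cobj Y n)"
  by (simp add: chain_map_def)

lemma cmI:
  assumes "\<And>n. f n \<in> hm (cobj X n) (cobj Y n)"
    and "\<And>n x. x \<in> carrier (cobj X n) \<Longrightarrow> f (n + 1) (cdiff X n x) = cdiff Y n (f n x)"
  shows "cm X Y f"
  using assms by (simp add: chain_map_def)

lemma deg_simps:
  assumes "\<And>n. h n \<in> hm (cobj X n) (cobj Y (n - 1))" "X \<in> cpx" "Y \<in> cpx"
  shows "\<lbrakk>m = n - 1; x \<in> carrier (cobj X n)\<rbrakk> \<Longrightarrow> h n x \<in> carrier (cobj Y m)"
    and "\<lbrakk>x \<in> carrier (cobj X n); y \<in> carrier (cobj X n)\<rbrakk> \<Longrightarrow>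
      h n (x \<oplus>\<^bsub>cobj X n\<^esub> y) = h n x \<oplus>\<^bsub>cobj Y (n - 1)\<^esub> h n y"
    and "h n \<zero>\<^bsub>cobj X n\<^esub> = \<zero>\<^bsub>cobj Y (n - 1)\<^esub>"
    and "x \<in> carrier (cobj X n) \<Longrightarrow> h n (\<ominus>\<^bsub>cobj X n\<^esub> x) = \<ominus>\<^bsub>cobj Y (n - 1)\<^esub> h n x"
    and "\<lbrakk>x \<in> carrier (cobj X n); r \<in> carrier R\<rbrakk> \<Longrightarrow> h n (x \<cdot>\<^bsub>cobj X n\<^esub> r) = h n x \<cdot>\<^bsub>cobj Y (n - 1)\<^esub> r"
  using hm_simps[OF assms(1) cpx_md[OF assms(2)] cpx_md[OF assms(3)]] by auto

definition htpy :: "'u cpx \<Rightarrow> 'u cpx \<Rightarrow> 'u cmap \<Rightarrow> 'u cmap \<Rightarrow> 'u cmap \<Rightarrow> bool" where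
  "htpy X Y f g h \<longleftrightarrow> (\<forall>n. h n \<in> hm (cobj X n) (cobj Y (n - 1))) \<and>
     (\<forall>n. \<forall>x\<in>carrier (cobj X n). f n x =
        g n x \<oplus>\<^bsub>cobj Y n\<^esub> (cdiff Y (n - 1) (h n x) \<oplus>\<^bsub>cobj Y n\<^esub> h (n + 1) (cdiff X n x)))"

lemma htpyD:
  assumes "htpy X Y f g h"
  shows "h n \<in> hm (cobj X n) (cobj Y (n - 1))"
    and "x \<in> carrier (cobj X n) \<Longrightarrow> f n x =
      g n x \<oplus>\<^bsub>cobj Y n\<^esub> (cdiff Y (n - 1) (h n x) \<oplus>\<^bsub>cobj Y n\<^esub> h (n + 1) (cdiff X n x))"
  using assms by (auto simp: htpy_def)

lemma hotI:
  assumes "\<And>n. h n \<in> hm (cobj X n) (cobj Y (n - 1))"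
    and "\<And>n x. x \<in> carrier (cobj X n) \<Longrightarrow> f n x =
      g n x \<oplus>\<^bsub>cobj Y n\<^esub> (cdiff Y (n - 1) (h n x) \<oplus>\<^bsub>cobj Y n\<^esub> h (n + 1) (cdiff X n x))"
  shows "hot X Y f g"
  using assms unfolding homotopic_def by blast

lemma hotE:
  assumes "hot X Y f g"
  obtains h where "htpy X Y f g h"
  using assms unfolding homotopic_def htpy_def by blast

lemma cm_id: "cm X X chain_id"
  by (simp add: chain_map_def chain_id_def hm_id)

lemma cm_zero: "X \<in> cpx \<Longrightarrow> Y \<in> cpx \<Longrightarrow> cm X Y (chain_zero Y)"
  by (simp add: chain_map_def chain_zero_def hm_zero cpx_simps)

lemma cm_comp: "\<lbrakk>cm X Y f; cm Y Z g; X \<in> cpx; Y \<in> cpx\<rbrakk> \<Longrightarrow> cm X Z (g ** f)"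
  using cm_simps(1)[of X Y f] by (auto simp: chain_map_def chain_comp_def intro: hm_comp)

lemma cm_add:
  assumes "cm X Y f" "cm X Y g" "X \<in> cpx" "Y \<in> cpx"
  shows "cm X Y (chain_add Y f g)"
  using hm_add[OF cm_hm[OF assms(1)] cm_hm[OF assms(2)] cpx_md[OF assms(3)] cpx_md[OF assms(4)]]
    cm_simps[OF assms(1,3,4)] cm_simps[OF assms(2,3,4)] cpx_simps[OF assms(4)] cpx_simps(2)[OF assms(3)]
  by (intro cmI) (simp_all add: chain_add_def)

definition chain_neg :: "'u cpx \<Rightarrow> 'u cmap \<Rightarrow> 'u cmap" where
  "chain_neg Y f = (\<lambda>n x. \<ominus>\<^bsub>cobj Y n\<^esub> f n x)"

lemma cm_neg:
  assumes "cm X Y f" "X \<in> cpx" "Y \<in> cpx"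
  shows "cm X Y (chain_neg Y f)"
  using hm_neg[OF cm_hm[OF assms(1)] cpx_md[OF assms(2)] cpx_md[OF assms(3)]]
    cm_simps[OF assms] cpx_simps[OF assms(3)] cpx_simps(2)[OF assms(2)]
  by (intro cmI) (simp_all add: chain_neg_def)

text \<open>Maps are total functions on \<open>'u\<close> whose values outside the carriers are
  arbitrary, so chain maps can be compared on carriers only; the zero homotopy turns such agreement
  into a homotopy.\<close>

lemma hot_eq:
  assumes "X \<in> cpx" "Y \<in> cpx" "\<And>n x. x \<in> carrier (cobj X n) \<Longrightarrow> f n x = g n x"
    "cm X Y f"
  shows "hot X Y f g"
proof (rule hotI)
  show "\<And>n. (\<lambda>x. \<zero>\<^bsub>cobj Y (n - 1)\<^esub>) \<in> hm (cobj X n) (cobj Y (n - 1))"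
    by (rule hm_zero[OF cpx_md[OF assms(2)]])
  fix n x assume x: "x \<in> carrier (cobj X n)"
  then have "g n x \<in> carrier (cobj Y n)" using cm_simps[OF assms(4,1,2)] assms(3) by metis
  then show "f n x = g n x \<oplus>\<^bsub>cobj Y n\<^esub>
      (cdiff Y (n - 1) \<zero>\<^bsub>cobj Y (n - 1)\<^esub> \<oplus>\<^bsub>cobj Y n\<^esub> \<zero>\<^bsub>cobj Y (n + 1 - 1)\<^esub>)"
    using x assms(3) by (simp add: cpx_simps[OF assms(2)] md_simps[OF cpx_md[OF assms(2)]])
qed

lemma hot_refl: "\<lbrakk>X \<in> cpx; Y \<in> cpx; cm X Y f\<rbrakk> \<Longrightarrow> hot X Y f f"
  by (rule hot_eq) auto

lemma hot_sym:
  assumes "hot X Y f g" "X \<in> cpx" "Y \<in> cpx" "cm X Y g"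
  shows "hot X Y g f"
proof -
  obtain h where t: "htpy X Y f g h"
    using assms(1) by (rule hotE)
  note h = htpyD(1)[OF t] and e = htpyD(2)[OF t]
  show ?thesis
  proof (rule hotI)
    show "\<And>n. (\<lambda>x. \<ominus>\<^bsub>cobj Y (n - 1)\<^esub> h n x) \<in> hm (cobj X n) (cobj Y (n - 1))"
      by (intro hm_neg h cpx_md assms)
  qed (simp add: e deg_simps[OF h assms(2,3)] cm_simps[OF assms(4,2,3)] cpx_simps[OF assms(2)]
      cpx_simps[OF assms(3)] md_all[OF cpx_md[OF assms(3)]])
qed

lemma hot_trans:
  assumes "hot X Y f g" "hot X Y g k" "X \<in> cpx" "Y \<in> cpx" "cm X Y k"
  shows "hot X Y f k"
proof -
  obtain h where t: "htpy X Y f g h"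
    using assms(1) by (rule hotE)
  note h = htpyD(1)[OF t] and e = htpyD(2)[OF t]
  obtain h' where t': "htpy X Y g k h'"
    using assms(2) by (rule hotE)
  note h' = htpyD(1)[OF t'] and e' = htpyD(2)[OF t']
  show ?thesis
  proof (rule hotI)
    show "\<And>n. (\<lambda>x. h n x \<oplus>\<^bsub>cobj Y (n - 1)\<^esub> h' n x) \<in> hm (cobj X n) (cobj Y (n - 1))"
      by (intro hm_add h h' cpx_md assms)
  qed (simp add: e e' deg_simps[OF h assms(3,4)] deg_simps[OF h' assms(3,4)] cm_simps[OF assms(5,3,4)]
      cpx_simps[OF assms(3)] cpx_simps[OF assms(4)] md_all[OF cpx_md[OF assms(4)]])
qed

lemma hot_pre:
  assumes "hot X Y f g" "cm W X u" "W \<in> cpx" "X \<in> cpx" "Y \<in> cpx"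
  shows "hot W Y (f ** u) (g ** u)"
proof -
  obtain h where t: "htpy X Y f g h"
    using assms(1) by (rule hotE)
  note h = htpyD(1)[OF t] and e = htpyD(2)[OF t]
  show ?thesis
  proof (rule hotI)
    show "\<And>n. (\<lambda>x. h n (u n x)) \<in> hm (cobj W n) (cobj Y (n - 1))"
      by (rule hm_comp[OF cm_hm[OF assms(2)] h])
  qed (simp add: chain_comp_def e cm_simps[OF assms(2-4)])
qed

lemma hot_post:
  assumes "hot X Y f g" "cm Y Z s" "X \<in> cpx" "Y \<in> cpx" "Z \<in> cpx" "cm X Y g"
  shows "hot X Z (s ** f) (s ** g)"
proof -
  obtain h where t: "htpy X Y f g h"
    using assms(1) by (rule hotE)
  note h = htpyD(1)[OF t] and e = htpyD(2)[OF t]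
  show ?thesis
  proof (rule hotI)
    show "\<And>n. (\<lambda>x. s (n - 1) (h n x)) \<in> hm (cobj X n) (cobj Z (n - 1))"
      by (rule hm_comp[OF h cm_hm[OF assms(2)]])
  qed (simp add: chain_comp_def e cm_simps[OF assms(2,4,5)] cm_simps[OF assms(6,3,4)]
      deg_simps[OF h assms(3,4)] cpx_simps[OF assms(3)] cpx_simps[OF assms(4)]
      md_simps[OF cpx_md[OF assms(4)]])
qed

lemma hot_add:
  assumes "hot X Y f g" "hot X Y f' g'" "X \<in> cpx" "Y \<in> cpx" "cm X Y g" "cm X Y g'"
  shows "hot X Y (chain_add Y f f') (chain_add Y g g')"
proof -
  obtain h where t: "htpy X Y f g h"
    using assms(1) by (rule hotE)
  note h = htpyD(1)[OF t] and e = htpyD(2)[OF t]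
  obtain h' where t': "htpy X Y f' g' h'"
    using assms(2) by (rule hotE)
  note h' = htpyD(1)[OF t'] and e' = htpyD(2)[OF t']
  show ?thesis
  proof (rule hotI)
    show "\<And>n. (\<lambda>x. h n x \<oplus>\<^bsub>cobj Y (n - 1)\<^esub> h' n x) \<in> hm (cobj X n) (cobj Y (n - 1))"
      by (intro hm_add h h' cpx_md assms)
  qed (simp add: chain_add_def e e' deg_simps[OF h assms(3,4)] deg_simps[OF h' assms(3,4)]
      cm_simps[OF assms(5,3,4)] cm_simps[OF assms(6,3,4)]
      cpx_simps[OF assms(3)] cpx_simps[OF assms(4)] md_all[OF cpx_md[OF assms(4)]])
qed

section \<open>Cohomology\<close>

lemma cocyclesI: "\<lbrakk>x \<in> carrier (cobj X n); cdiff X n x = \<zero>\<^bsub>cobj X (n + 1)\<^esub>\<rbrakk> \<Longrightarrow> x \<in> cocycles X n"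
  by (simp add: cocycles_def)

lemma coboundariesI: "\<lbrakk>m = n - 1; w \<in> carrier (cobj X m); x = cdiff X m w\<rbrakk> \<Longrightarrow> x \<in> coboundaries X n"
  by (simp add: coboundaries_def)

lemma submod_cocycles: "X \<in> cpx \<Longrightarrow> submod (cobj X n) (cocycles X n)"
  by (auto simp: submod_def cocycles_def cpx_simps md_simps[OF cpx_md])

lemma submod_coboundaries:
  assumes "X \<in> cpx"
  shows "submod (cobj X n) (coboundaries X n)"
  unfolding coboundaries_def
  by (rule submod_image[OF cpx_d[OF assms] cpx_md[OF assms] cpx_md[OF assms]]) simp

lemma coboundaries_cocycles: "X \<in> cpx \<Longrightarrow> coboundaries X n \<subseteq> cocycles X n"
  by (auto simp: coboundaries_def cocycles_def cpx_simps)

text \<open>Quasi-isomorphisms in terms of representatives: the first clause is injectivity on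
  cohomology, the second surjectivity.\<close>

definition qis :: "'u cpx \<Rightarrow> 'u cpx \<Rightarrow> 'u cmap \<Rightarrow> bool" where
  "qis X Y f \<longleftrightarrow> (\<forall>n. (\<forall>x\<in>cocycles X n. f n x \<in> coboundaries Y n \<longrightarrow> x \<in> coboundaries X n) \<and>
     (\<forall>y\<in>cocycles Y n. \<exists>x\<in>cocycles X n. \<exists>b\<in>coboundaries Y n. y = b \<oplus>\<^bsub>cobj Y n\<^esub> f n x))"

lemma cm_cocycles: "\<lbrakk>cm X Y f; X \<in> cpx; Y \<in> cpx; x \<in> cocycles X n\<rbrakk> \<Longrightarrow> f n x \<in> cocycles Y n"
  using cm_simps(6)[of X Y f "n + 1" n x] by (simp add: cocycles_def cm_simps)

lemma cm_coboundaries: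
  assumes "cm X Y f" "X \<in> cpx" "Y \<in> cpx" "x \<in> coboundaries X n"
  shows "f n x \<in> coboundaries Y n"
  using assms(4) cm_simps(6)[OF assms(1-3), of n "n - 1"] cm_simps(1)[OF assms(1-3)]
  unfolding coboundaries_def by auto

lemma abelian_subgroup_sub:
  assumes "md M" "submod M L"
  shows "abelian_subgroup L M"
proof -
  interpret M: right_module R M by fact
  interpret L: right_module R "M\<lparr>carrier := L\<rparr>" by (rule submod_md) fact+
  have "subgroup L (add_monoid M)"
  proof (rule group.subgroupI)
    show "group (add_monoid M)" using M.a_group .
    fix a assume a: "a \<in> L"
    then obtain b where b: "b \<in> L" "b \<oplus>\<^bsub>M\<^esub> a = \<zero>\<^bsub>M\<^esub>" using L.l_neg[of a] L.a_inv_closed[of a] by auto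
    have "inv\<^bsub>add_monoid M\<^esub> a = b"
      using a b assms(2) M.minus_equality[of b a] by (auto simp: submod_def a_inv_def)
    then show "inv\<^bsub>add_monoid M\<^esub> a \<in> L" using b by simp
  qed (use assms(2) in \<open>auto simp: submod_def\<close>)
  then show ?thesis by (intro abelian_subgroupI3 additive_subgroupI M.abelian_group_axioms)
qed

lemma coset_eq_iff:
  assumes "md M" "submod M L" "z \<in> carrier M" "w \<in> carrier M"
  shows "L +>\<^bsub>M\<^esub> z = L +>\<^bsub>M\<^esub> w \<longleftrightarrow> (\<exists>b\<in>L. z = b \<oplus>\<^bsub>M\<^esub> w)"
proof -
  interpret abelian_subgroup L M by (rule abelian_subgroup_sub[OF assms(1,2)])
  have "L +>\<^bsub>M\<^esub> z = L +>\<^bsub>M\<^esub> w \<longleftrightarrow> z \<in> L +>\<^bsub>M\<^esub> w"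
    using a_rcos_self[OF assms(3)] a_repr_independence'[OF _ assms(4)] by auto
  then show ?thesis by (auto simp: a_r_coset_def')
qed

text \<open>Factor groups are dealt with here once; afterwards only cocycles and coboundaries occur.
  The induced map sends the coset of \<open>z\<close> to that of \<open>f n z\<close>, and
  bijectivity is read off from equalities of cosets.\<close>

lemma quasi_iso_iff:
  assumes X: "X \<in> cpx" and Y: "Y \<in> cpx" and f: "cm X Y f"
  shows "quasi_iso R X Y f \<longleftrightarrow> qis X Y f"
proof -
  have "(\<lambda>c. coboundaries Y n <+>\<^bsub>cobj Y n\<^esub> f n ` c) \<in> iso (cohomology X n) (cohomology Y n) \<longleftrightarrow>
    (\<forall>x\<in>cocycles X n. f n x \<in> coboundaries Y n \<longrightarrow> x \<in> coboundaries X n) \<and>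
     (\<forall>y\<in>cocycles Y n. \<exists>x\<in>cocycles X n. \<exists>b\<in>coboundaries Y n. y = b \<oplus>\<^bsub>cobj Y n\<^esub> f n x)"
    (is "?\<phi> \<in> _ \<longleftrightarrow> ?I \<and> ?S") for n
  proof -
    let ?ZX = "(cobj X n)\<lparr>carrier := cocycles X n\<rparr>" and ?ZY = "(cobj Y n)\<lparr>carrier := cocycles Y n\<rparr>"
    let ?BX = "coboundaries X n" and ?BY = "coboundaries Y n"
    \<comment> \<open>The cohomology is a quotient of the group of cocycles, so the coset lemmas are
      applied inside \<open>?ZX\<close> and \<open>?ZY\<close>, not inside the full modules.\<close>
    have sX: "submod ?ZX ?BX" and sY: "submod ?ZY ?BY"
      using submod_coboundaries[OF X, of n] submod_coboundaries[OF Y, of n]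
        coboundaries_cocycles[OF X, of n] coboundaries_cocycles[OF Y, of n] by (auto simp: submod_def)
    have mX: "md ?ZX" and mY: "md ?ZY"
      by (auto intro!: submod_md submod_cocycles cpx_md X Y)
    interpret GX: abelian_subgroup ?BX ?ZX by (rule abelian_subgroup_sub[OF mX sX])
    interpret GY: abelian_subgroup ?BY ?ZY by (rule abelian_subgroup_sub[OF mY sY])
    let ?cX = "\<lambda>z. ?BX +>\<^bsub>?ZX\<^esub> z" and ?cY = "\<lambda>z. ?BY +>\<^bsub>?ZY\<^esub> z"
    have fz: "f n z \<in> cocycles Y n" if "z \<in> cocycles X n" for z
      using cm_cocycles[OF f X Y that] .
    have zc: "\<And>z. z \<in> cocycles X n \<Longrightarrow> z \<in> carrier (cobj X n)"
      "\<And>z. z \<in> cocycles Y n \<Longrightarrow> z \<in> carrier (cobj Y n)" by (auto simp: cocycles_def)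
    have bz: "\<And>z. z \<in> ?BX \<Longrightarrow> z \<in> cocycles X n" "\<And>z. z \<in> ?BY \<Longrightarrow> z \<in> cocycles Y n"
      using coboundaries_cocycles X Y by blast+
    have carX: "carrier (cohomology X n) = ?cX ` cocycles X n"
      and carY: "carrier (cohomology Y n) = ?cY ` cocycles Y n"
      by (auto simp: cohomology_def A_FactGroup_def' A_RCOSETS_def' a_r_coset_def')
    have mulX: "mult (cohomology X n) a b = a <+>\<^bsub>?ZX\<^esub> b"
      and mulY: "mult (cohomology Y n) a b = a <+>\<^bsub>?ZY\<^esub> b" for a b
      by (simp_all add: cohomology_def)
    have \<phi>: "?\<phi> (?cX z) = ?cY (f n z)" if z: "z \<in> cocycles X n" for z
    proof -
      have 1: "?\<phi> (?cX z) = {b \<oplus>\<^bsub>cobj Y n\<^esub> f n (a \<oplus>\<^bsub>cobj X n\<^esub> z) |b a. b \<in> ?BY \<and> a \<in> ?BX}"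
        by (auto simp: set_add_def' a_r_coset_def')
      have 2: "b \<oplus>\<^bsub>cobj Y n\<^esub> f n (a \<oplus>\<^bsub>cobj X n\<^esub> z) = (b \<oplus>\<^bsub>cobj Y n\<^esub> f n a) \<oplus>\<^bsub>cobj Y n\<^esub> f n z"
        if "b \<in> ?BY" "a \<in> ?BX" for a b
        using that z bz zc by (simp add: cm_simps[OF f X Y] md_ac(1)[OF cpx_md[OF Y]])
      have 3: "b \<oplus>\<^bsub>cobj Y n\<^esub> f n a \<in> ?BY" if "b \<in> ?BY" "a \<in> ?BX" for a b
        using that submod_coboundaries[OF Y, of n] cm_coboundaries[OF f X Y] by (auto simp: submod_def)
      have 4: "\<zero>\<^bsub>cobj X n\<^esub> \<in> ?BX" using submod_coboundaries[OF X, of n] by (simp add: submod_def)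
      have 5: "b = b \<oplus>\<^bsub>cobj Y n\<^esub> f n \<zero>\<^bsub>cobj X n\<^esub>" if "b \<in> ?BY" for b
        using that bz zc by (simp add: cm_simps[OF f X Y] md_simps[OF cpx_md[OF Y]])
      \<comment> \<open>\<open>f\<close> maps coboundaries to coboundaries, so all these sums lie in
        the coset of \<open>f n z\<close>; taking \<open>a\<close> to be zero shows that they fill
        it.\<close>
      have "?\<phi> (?cX z) = {b \<oplus>\<^bsub>cobj Y n\<^esub> f n z |b. b \<in> ?BY}"
        unfolding 1 using 2 3 4 5 by (smt (verit) Collect_cong)
      then show ?thesis by (auto simp: a_r_coset_def')
    qed
    have eqX: "?cX z = ?cX w \<longleftrightarrow> (\<exists>b\<in>?BX. z = b \<oplus>\<^bsub>cobj X n\<^esub> w)"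
      if "z \<in> cocycles X n" "w \<in> cocycles X n" for z w
      using coset_eq_iff[OF mX sX, of z w] that by simp
    have eqY: "?cY z = ?cY w \<longleftrightarrow> (\<exists>b\<in>?BY. z = b \<oplus>\<^bsub>cobj Y n\<^esub> w)"
      if "z \<in> cocycles Y n" "w \<in> cocycles Y n" for z w
      using coset_eq_iff[OF mY sY, of z w] that by simp
    have hom: "?\<phi> \<in> hom (cohomology X n) (cohomology Y n)"
    proof (rule homI)
      fix c assume "c \<in> carrier (cohomology X n)"
      then show "?\<phi> c \<in> carrier (cohomology Y n)" using \<phi> fz by (auto simp: carX carY)
    next
      fix c d assume "c \<in> carrier (cohomology X n)" "d \<in> carrier (cohomology X n)"
      then obtain z w where zw: "z \<in> cocycles X n" "c = ?cX z" "w \<in> cocycles X n" "d = ?cX w"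
        by (auto simp: carX)
      have s: "z \<oplus>\<^bsub>cobj X n\<^esub> w \<in> cocycles X n"
        using submod_cocycles[OF X, of n] zw by (simp add: submod_def)
      have "c <+>\<^bsub>?ZX\<^esub> d = ?cX (z \<oplus>\<^bsub>cobj X n\<^esub> w)" using GX.a_rcos_sum[of z w] zw by simp
      moreover have "?\<phi> c <+>\<^bsub>?ZY\<^esub> ?\<phi> d = ?cY (f n z \<oplus>\<^bsub>cobj Y n\<^esub> f n w)"
        using GY.a_rcos_sum[of "f n z" "f n w"] zw fz \<phi> by simp
      ultimately show "?\<phi> (c \<otimes>\<^bsub>cohomology X n\<^esub> d) = ?\<phi> c \<otimes>\<^bsub>cohomology Y n\<^esub> ?\<phi> d"
        using \<phi>[OF s] zw zc by (simp add: mulX mulY cm_simps[OF f X Y])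
    qed
    have inj: "inj_on ?\<phi> (carrier (cohomology X n)) \<longleftrightarrow> ?I"
    proof
      assume i: "inj_on ?\<phi> (carrier (cohomology X n))"
      show ?I
      proof (intro ballI impI)
        fix x assume x: "x \<in> cocycles X n" "f n x \<in> ?BY"
        have z: "\<zero>\<^bsub>cobj X n\<^esub> \<in> cocycles X n" using submod_cocycles[OF X, of n] by (simp add: submod_def)
        have "?cY (f n x) = ?cY (f n \<zero>\<^bsub>cobj X n\<^esub>)"
          unfolding eqY[OF fz[OF x(1)] fz[OF z]]
          using x fz[OF x(1)] zc
          by (intro bexI[of _ "f n x"]) (simp_all add: cm_simps[OF f X Y] md_simps[OF cpx_md[OF Y]])
        then have "?\<phi> (?cX x) = ?\<phi> (?cX \<zero>\<^bsub>cobj X n\<^esub>)" using \<phi> x z by simp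
        then have "?cX x = ?cX \<zero>\<^bsub>cobj X n\<^esub>" using i x z by (auto simp: carX dest: inj_onD)
        then obtain b where "b \<in> ?BX" "x = b \<oplus>\<^bsub>cobj X n\<^esub> \<zero>\<^bsub>cobj X n\<^esub>" using eqX[OF x(1) z] by auto
        then show "x \<in> ?BX" using bz zc by (simp add: md_simps[OF cpx_md[OF X]])
      qed
    next
      assume I: ?I
      show "inj_on ?\<phi> (carrier (cohomology X n))"
        unfolding carX
      proof (rule inj_onI, elim imageE)
        fix c d z w assume "?\<phi> c = ?\<phi> d" and zw: "c = ?cX z" "z \<in> cocycles X n" "d = ?cX w" "w \<in> cocycles X n"
        then have "?cY (f n z) = ?cY (f n w)" using \<phi> by simp
        then obtain b where b: "b \<in> ?BY" "f n z = b \<oplus>\<^bsub>cobj Y n\<^esub> f n w" 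
          using eqY[OF fz[OF zw(2)] fz[OF zw(4)]] by blast
        \<comment> \<open>The difference \<open>z - w\<close> is a cocycle whose image is the
          coboundary \<open>b\<close>, so \<open>?I\<close> applies to it.\<close>
        have d: "z \<ominus>\<^bsub>cobj X n\<^esub> w \<in> cocycles X n"
          using zw(2,4) by (simp add: cocycles_def cpx_simps[OF X] md_simps[OF cpx_md[OF X]])
        have "f n (z \<ominus>\<^bsub>cobj X n\<^esub> w) = b"
          using b(2) zc(1)[OF zw(2)] zc(1)[OF zw(4)] zc(2)[OF bz(2)[OF b(1)]]
          by (simp add: cm_simps[OF f X Y] md_all[OF cpx_md[OF Y]] md_simps[OF cpx_md[OF X]])
        then have "z \<ominus>\<^bsub>cobj X n\<^esub> w \<in> ?BX" using I d b by simp
        moreover have "z = (z \<ominus>\<^bsub>cobj X n\<^esub> w) \<oplus>\<^bsub>cobj X n\<^esub> w"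
          using zw zc by (simp add: md_all[OF cpx_md[OF X]])
        ultimately show "c = d" using eqX zw by blast
      qed
    qed
    have surj: "?\<phi> ` carrier (cohomology X n) = carrier (cohomology Y n) \<longleftrightarrow> ?S"
    proof -
      have "?\<phi> ` carrier (cohomology X n) = (\<lambda>z. ?cY (f n z)) ` cocycles X n"
        unfolding carX image_image using \<phi> by (intro image_cong) auto
      moreover have "(\<lambda>z. ?cY (f n z)) ` cocycles X n = ?cY ` cocycles Y n \<longleftrightarrow>
          (\<forall>y\<in>cocycles Y n. \<exists>x\<in>cocycles X n. ?cY y = ?cY (f n x))"
        using fz by (subst set_eq_subset) (auto simp: subset_eq image_iff)
      ultimately show ?thesis using eqY fz by (simp add: carY)
    qed
    show ?thesis using hom inj surj by (simp add: iso_def bij_betw_def)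
  qed
  then show ?thesis using f by (simp add: quasi_iso_def qis_def)
qed

section \<open>Fibres, shifts and lifting along quasi-isomorphisms\<close>

text \<open>Degrees need a normal form, because \<open>cobj X (1 + n)\<close> and
  \<open>cobj X (n + 1)\<close> differ syntactically.\<close>

lemma index_simps: "1 + n = n + (1 :: int)" "numeral k + n = n + (numeral k :: int)"
  by simp_all

definition acyclic_cpx :: "'u cpx \<Rightarrow> bool" where
  "acyclic_cpx N \<longleftrightarrow> (\<forall>n. cocycles N n \<subseteq> coboundaries N n)"

text \<open>The upper bound is the degree from which homotopies are constructed downwards.\<close>

definition bounded_above_projective :: "'u cpx \<Rightarrow> bool" where
  "bounded_above_projective P \<longleftrightarrow> P \<in> cpx \<and> (\<forall>n. projective_rmod R (cobj P n)) \<and>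
     (\<exists>b. \<forall>n>b. carrier (cobj P n) = {\<zero>\<^bsub>cobj P n\<^esub>})"

text \<open>Downward recursion on the degree: once the homotopy \<open>h\<close> is known in degree
  \<open>n + 1\<close>, the difference \<open>f - h d\<close> takes values in cocycles, which are
  coboundaries of \<open>N\<close>, and projectivity lifts it through the differential.\<close>

lemma null_of_acyclic:
  assumes P: "bounded_above_projective P" and N: "N \<in> cpx" "acyclic_cpx N" and f: "cm P N f"
  shows "hot P N f (chain_zero N)"
proof -
  have Pc: "P \<in> cpx" and Pp: "\<And>n. projective_rmod R (cobj P n)"
    using P by (auto simp: bounded_above_projective_def)
  obtain b where b: "\<And>n. n > b \<Longrightarrow> carrier (cobj P n) = {\<zero>\<^bsub>cobj P n\<^esub>}"
    using P by (auto simp: bounded_above_projective_def)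
  note fs = cm_simps[OF f Pc N(1)] and Ps = cpx_simps[OF Pc] and Ns = cpx_simps[OF N(1)]
    and Nm = md_all[OF cpx_md[OF N(1)]]
  \<comment> \<open>\<open>k\<close> counts downwards and \<open>h\<close> is the homotopy in degree
    \<open>b + 1 - k\<close>. The equation is required on coboundaries only: this is what makes
    \<open>f - h d\<close> a cocycle one degree lower.\<close>
  define Q where "Q k h \<longleftrightarrow> h \<in> hm (cobj P (b + 1 - int k)) (cobj N (b - int k)) \<and>
    (\<forall>y\<in>carrier (cobj P (b - int k)).
       cdiff N (b - int k) (h (cdiff P (b - int k) y)) = f (b + 1 - int k) (cdiff P (b - int k) y))"
    for k :: nat and h :: "'u \<Rightarrow> 'u"
  \<comment> \<open>The homotopy identity in degree \<open>b - k\<close>, which links two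
    consecutive components and therefore has to be carried through the dependent choice.\<close>
  define S where "S k h h' \<longleftrightarrow> (\<forall>x\<in>carrier (cobj P (b - int k)).
       f (b - int k) x = cdiff N (b - int k - 1) (h' x) \<oplus>\<^bsub>cobj N (b - int k)\<^esub> h (cdiff P (b - int k) x))"
    for k :: nat and h h' :: "'u \<Rightarrow> 'u"
  have "\<exists>H. \<forall>k. Q k (H k) \<and> S k (H k) (H (Suc k))"
  proof (rule dependent_nat_choice)
    have 0: "cdiff P b y = \<zero>\<^bsub>cobj P (b + 1)\<^esub>" if "y \<in> carrier (cobj P b)" for y
      using Ps(2)[OF refl that] b[of "b + 1"] by simp
    show "\<exists>h. Q 0 h"
      using hm_zero[OF Ns(1)[of b], where M = "cobj P (b + 1)"] 0
      by (intro exI[of _ "\<lambda>x. \<zero>\<^bsub>cobj N b\<^esub>"]) (simp add: Q_def fs Ns)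
  next
    fix h k assume h: "Q k h"
    define n where "n = b - int k"
    have n: "b + 1 - int k = n + 1" "b - int k = n" "b - int (Suc k) = n - 1" "b + 1 - int (Suc k) = n"
      by (simp_all add: n_def)
    have hh: "h \<in> hm (cobj P (n + 1)) (cobj N n)" and hd: "\<And>y. y \<in> carrier (cobj P n) \<Longrightarrow>
        cdiff N n (h (cdiff P n y)) = f (n + 1) (cdiff P n y)"
      using h by (simp_all add: Q_def n)
    note hs = hm_simps[OF hh cpx_md[OF Pc] cpx_md[OF N(1)]]
    let ?g = "\<lambda>x. f n x \<ominus>\<^bsub>cobj N n\<^esub> h (cdiff P n x)"
    have "\<exists>h'\<in>hm (cobj P n) (cobj N (n - 1)). \<forall>x\<in>carrier (cobj P n). cdiff N (n - 1) (h' x) = ?g x"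
    proof (rule proj_lift[OF Pp cpx_md[OF N(1)] cpx_md[OF N(1)]])
      show "cdiff N (n - 1) \<in> hm (cobj N (n - 1)) (cobj N n)" by (rule cpx_d[OF N(1)]) simp
      show "?g \<in> hm (cobj P n) (cobj N n)"
        by (intro hm_add hm_neg hm_diff cm_hm[OF f] hm_comp[OF cpx_d[OF Pc refl] hh] cpx_md Pc N(1))
      fix x assume x: "x \<in> carrier (cobj P n)"
      have "?g x \<in> cocycles N n"
        using x by (intro cocyclesI) (simp_all add: fs Ps Ns hs hd Nm)
      then show "\<exists>y\<in>carrier (cobj N (n - 1)). cdiff N (n - 1) y = ?g x"
        using N(2) by (fastforce simp: acyclic_cpx_def coboundaries_def)
    qed
    then obtain h' where h': "h' \<in> hm (cobj P n) (cobj N (n - 1))"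
      "\<And>x. x \<in> carrier (cobj P n) \<Longrightarrow> cdiff N (n - 1) (h' x) = ?g x" by blast
    have "S k h h'"
      unfolding S_def n using h'(2) by (auto simp: fs Ps Ns hs Nm)
    moreover have "Q (Suc k) h'"
      unfolding Q_def n using h' by (auto simp: fs Ps Ns hs Nm)
    ultimately show "\<exists>h'. Q (Suc k) h' \<and> S k h h'" by blast
  qed
  then obtain H where H: "\<And>k. Q k (H k)" "\<And>k. S k (H k) (H (Suc k))" by blast
  \<comment> \<open>Back to integer degrees. The recursion starts at \<open>b + 1\<close>, where
    \<open>P\<close> is already zero, and the homotopy is zero above that.\<close>
  define h where "h n = (if n \<le> b + 1 then H (nat (b + 1 - n)) else (\<lambda>x. \<zero>\<^bsub>cobj N (n - 1)\<^esub>))" for n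
  have hh: "h n \<in> hm (cobj P n) (cobj N (n - 1))" for n
  proof (cases "n \<le> b + 1")
    case True
    then have "b + 1 - int (nat (b + 1 - n)) = n" "b - int (nat (b + 1 - n)) = n - 1" by simp_all
    then show ?thesis using H(1)[of "nat (b + 1 - n)"] True by (simp add: Q_def h_def)
  qed (simp add: h_def hm_zero[OF cpx_md[OF N(1)]])
  note hs = deg_simps[OF hh Pc N(1)]
  show ?thesis
  proof (rule hotI[OF hh])
    fix n x assume x: "x \<in> carrier (cobj P n)"
    show "f n x = chain_zero N n x \<oplus>\<^bsub>cobj N n\<^esub> (cdiff N (n - 1) (h n x) \<oplus>\<^bsub>cobj N n\<^esub> h (n + 1) (cdiff P n x))"
    proof (cases "n \<le> b")
      case True
      define k where "k = nat (b - n)"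
      have k: "b - int k = n" "nat (b + 1 - n) = Suc k" "nat (b - n) = k" using True by (simp_all add: k_def)
      have "f n x = cdiff N (n - 1) (H (Suc k) x) \<oplus>\<^bsub>cobj N n\<^esub> H k (cdiff P n x)"
        using H(2)[of k] x by (simp add: S_def k)
      moreover have "h n = H (Suc k)" "h (n + 1) = H k" using True k by (simp_all add: h_def)
      ultimately show ?thesis
        using x fs(1)[OF x] by (simp add: chain_zero_def Nm)
    next
      case False
      then have "x = \<zero>\<^bsub>cobj P n\<^esub>" using b[of n] x by simp
      then show ?thesis by (simp add: fs hs Ps Ns Nm chain_zero_def)
    qed
  qed
qed

text \<open>The homotopy fibre. A chain map into it is a chain map \<open>u\<close> to
  \<open>X\<close> together with a null homotopy of the composite of \<open>u\<close> with
  \<open>f\<close>. The cone is obtained as \<open>shift 1 (fib X Y f)\<close>.\<close>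

definition fib :: "'u cpx \<Rightarrow> 'u cpx \<Rightarrow> 'u cmap \<Rightarrow> 'u cpx" where
  "fib X Y f = \<lparr>cobj = (\<lambda>n. dsum (cobj X n) (cobj Y (n - 1))),
     cdiff = (\<lambda>n z. pr (cdiff X n (p1 z))
       (f n (p1 z) \<ominus>\<^bsub>cobj Y n\<^esub> cdiff Y (n - 1) (p2 z)))\<rparr>"

lemma fib_sel: "cobj (fib X Y f) n = dsum (cobj X n) (cobj Y (n - 1))"
  "cdiff (fib X Y f) n z = pr (cdiff X n (p1 z))
       (f n (p1 z) \<ominus>\<^bsub>cobj Y n\<^esub> cdiff Y (n - 1) (p2 z))"
  by (simp_all add: fib_def)

lemma fib_cpx:
  assumes X: "X \<in> cpx" and Y: "Y \<in> cpx" and f: "cm X Y f"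
  shows "fib X Y f \<in> cpx"
proof (rule cpxI)
  note s = cm_simps[OF f X Y] cpx_simps[OF X] cpx_simps[OF Y] md_all[OF cpx_md[OF X]] md_all[OF cpx_md[OF Y]]
  show "md (cobj (fib X Y f) n)" for n by (simp add: fib_sel md_dsum cpx_md X Y)
  show "cdiff (fib X Y f) n \<in> hm (cobj (fib X Y f) n) (cobj (fib X Y f) (n + 1))" for n
  proof -
    have 1: "(\<lambda>z. cdiff X n (p1 z)) \<in> hm (dsum (cobj X n) (cobj Y (n - 1))) (cobj X (n + 1))"
      by (rule hm_comp[OF hm_p1 cpx_d[OF X refl]])
    have 2: "(\<lambda>z. f n (p1 z) \<ominus>\<^bsub>cobj Y n\<^esub> cdiff Y (n - 1) (p2 z))
        \<in> hm (dsum (cobj X n) (cobj Y (n - 1))) (cobj Y n)"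
      by (intro hm_add hm_neg hm_diff hm_comp[OF hm_p1 cm_hm[OF f]] hm_comp[OF hm_p2 cpx_d[OF Y]] md_dsum
          cpx_md X Y) simp
    show ?thesis using hm_pr[OF 1 2] by (simp add: fib_def)
  qed
  fix n x assume "x \<in> carrier (cobj (fib X Y f) n)"
  then show "cdiff (fib X Y f) (n + 1) (cdiff (fib X Y f) n x) = \<zero>\<^bsub>cobj (fib X Y f) (n + 1 + 1)\<^esub>"
    by (simp add: fib_sel dsum_simps s index_simps)
qed

text \<open>For a cocycle \<open>(x, y)\<close> one has \<open>f x = d y\<close>, so injectivity on
  cohomology gives \<open>x = d a\<close>. Then \<open>f a - y\<close> is a cocycle, and
  surjectivity writes it as \<open>d w + f c\<close>. The pair \<open>(a - c, w)\<close> has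
  differential \<open>(x, y)\<close>.\<close>

lemma fib_acyclic:
  assumes X: "X \<in> cpx" and Y: "Y \<in> cpx" and f: "cm X Y f" "qis X Y f"
  shows "acyclic_cpx (fib X Y f)"
  unfolding acyclic_cpx_def
proof (intro allI subsetI)
  note s = cm_simps[OF f(1) X Y] cpx_simps[OF X] cpx_simps[OF Y] md_all[OF cpx_md[OF X]] md_all[OF cpx_md[OF Y]]
  fix n z assume "z \<in> cocycles (fib X Y f) n"
  then have z: "p1 z \<in> carrier (cobj X n)" "p2 z \<in> carrier (cobj Y (n - 1))"
    and 1: "cdiff X n (p1 z) = \<zero>\<^bsub>cobj X (n + 1)\<^esub>"
    and 2: "f n (p1 z) \<ominus>\<^bsub>cobj Y n\<^esub> cdiff Y (n - 1) (p2 z) = \<zero>\<^bsub>cobj Y n\<^esub>"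
    by (auto simp: cocycles_def fib_sel dsum_simps pr_eq)
  have "f n (p1 z) = (f n (p1 z) \<ominus>\<^bsub>cobj Y n\<^esub> cdiff Y (n - 1) (p2 z)) \<oplus>\<^bsub>cobj Y n\<^esub> cdiff Y (n - 1) (p2 z)"
    using z by (simp add: s)
  then have fz: "f n (p1 z) = cdiff Y (n - 1) (p2 z)" unfolding 2 using z by (simp add: s)
  then have "p1 z \<in> coboundaries X n"
    using f(2) z 1 unfolding qis_def by (auto simp: cocycles_def coboundaries_def)
  then obtain a where a: "a \<in> carrier (cobj X (n - 1))" "p1 z = cdiff X (n - 1) a"
    by (auto simp: coboundaries_def)
  let ?y = "f (n - 1) a \<ominus>\<^bsub>cobj Y (n - 1)\<^esub> p2 z"
  have "cdiff Y (n - 1) (f (n - 1) a) = cdiff Y (n - 1) (p2 z)"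
    using fz a s(6)[of n "n - 1" a] by simp
  then have "?y \<in> cocycles Y (n - 1)"
    using a z by (intro cocyclesI) (simp_all add: s)
  then obtain c w where c: "c \<in> cocycles X (n - 1)" and w: "w \<in> carrier (cobj Y (n - 1 - 1))"
    and y: "?y = cdiff Y (n - 1 - 1) w \<oplus>\<^bsub>cobj Y (n - 1)\<^esub> f (n - 1) c"
    using f(2) unfolding qis_def coboundaries_def by blast
  have c': "c \<in> carrier (cobj X (n - 1))" "cdiff X (n - 1) c = \<zero>\<^bsub>cobj X n\<^esub>"
    using c by (auto simp: cocycles_def)
  have w': "cdiff Y (n - 2) w \<in> carrier (cobj Y (n - 1))" "w \<in> carrier (cobj Y (n - 2))" using w by (simp_all add: s)
  have "f (n - 1) a = ?y \<oplus>\<^bsub>cobj Y (n - 1)\<^esub> p2 z" using a z by (simp add: s)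
  also have "\<dots> = (cdiff Y (n - 2) w \<oplus>\<^bsub>cobj Y (n - 1)\<^esub> f (n - 1) c) \<oplus>\<^bsub>cobj Y (n - 1)\<^esub> p2 z"
    unfolding y by simp
  finally have fa: "f (n - 1) a = (cdiff Y (n - 2) w \<oplus>\<^bsub>cobj Y (n - 1)\<^esub> f (n - 1) c) \<oplus>\<^bsub>cobj Y (n - 1)\<^esub> p2 z" .
  let ?v = "pr (a \<ominus>\<^bsub>cobj X (n - 1)\<^esub> c) w"
  have "z = cdiff (fib X Y f) (n - 1) ?v"
    using a c' w' z by (simp add: fib_sel eq_pr s fa)
  moreover have "?v \<in> carrier (cobj (fib X Y f) (n - 1))"
    using a c' w' by (simp add: fib_sel dsum_simps s)
  ultimately show "z \<in> coboundaries (fib X Y f) n"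
    by (auto simp: coboundaries_def)
qed

section \<open>Shifts and cones\<close>

lemma shift_sel: "cobj (shift i X) n = cobj X (n + i)"
  "cdiff (shift i X) n x = (if even i then cdiff X (n + i) x
     else \<ominus>\<^bsub>cobj X (n + i + 1)\<^esub> cdiff X (n + i) x)"
  by (simp_all add: shift_def)

lemma shift_cpx:
  assumes X: "X \<in> cpx"
  shows "shift i X \<in> cpx"
proof (rule cpxI)
  note s = cpx_simps[OF X] md_all[OF cpx_md[OF X]]
  show "md (cobj (shift i X) n)" for n by (simp add: shift_sel cpx_md X)
  show "cdiff (shift i X) n \<in> hm (cobj (shift i X) n) (cobj (shift i X) (n + 1))" for n
  proof (cases "even i")
    case True
    then show ?thesis using cpx_d[OF X, of "n + 1 + i" "n + i"] by (simp add: shift_def)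
  next
    case False
    have e: "n + i + 1 = n + 1 + i" by simp
    show ?thesis using False hm_neg[OF cpx_d[OF X, of "n + 1 + i" "n + i"] cpx_md[OF X] cpx_md[OF X]]
      by (simp add: shift_def e)
  qed
  fix n x assume "x \<in> carrier (cobj (shift i X) n)"
  then have x: "x \<in> carrier (cobj X (n + i))" by (simp add: shift_sel)
  have e: "n + 1 + i = n + i + 1" "n + 1 + 1 + i = n + i + 1 + 1" by simp_all
  show "cdiff (shift i X) (n + 1) (cdiff (shift i X) n x) = \<zero>\<^bsub>cobj (shift i X) (n + 1 + 1)\<^esub>"
    using x unfolding shift_sel e by (auto simp: s)
qed

lemma shift_acyclic:
  assumes X: "X \<in> cpx" "acyclic_cpx X"
  shows "acyclic_cpx (shift i X)"
  unfolding acyclic_cpx_def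
proof (intro allI subsetI)
  note s = cpx_simps[OF X(1)] md_all[OF cpx_md[OF X(1)]]
  fix n x assume "x \<in> cocycles (shift i X) n"
  then have x: "x \<in> carrier (cobj X (n + i))" and 1: "(if even i then cdiff X (n + i) x
     else \<ominus>\<^bsub>cobj X (n + i + 1)\<^esub> cdiff X (n + i) x) = \<zero>\<^bsub>cobj X (n + 1 + i)\<^esub>"
    by (auto simp: cocycles_def shift_sel)
  have e: "n + 1 + i = n + i + 1" "n - 1 + i = n + i - 1" by simp_all
  have "cdiff X (n + i) x = \<zero>\<^bsub>cobj X (n + i + 1)\<^esub>"
  proof (cases "even i")
    case False
    then have "\<ominus>\<^bsub>cobj X (n + i + 1)\<^esub> (\<ominus>\<^bsub>cobj X (n + i + 1)\<^esub> cdiff X (n + i) x) = \<zero>\<^bsub>cobj X (n + i + 1)\<^esub>"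
      using 1 s by (simp add: e)
    then show ?thesis using x by (simp add: s)
  qed (use 1 in \<open>simp add: e\<close>)
  then have "x \<in> cocycles X (n + i)" using x by (simp add: cocycles_def)
  then obtain y where y: "y \<in> carrier (cobj X (n + i - 1))" "x = cdiff X (n + i - 1) y"
    using X(2) by (fastforce simp: acyclic_cpx_def coboundaries_def)
  \<comment> \<open>An odd shift changes the sign of the differential, so the preimage changes sign
    too.\<close>
  let ?y = "if even i then y else \<ominus>\<^bsub>cobj X (n + i - 1)\<^esub> y"
  have "?y \<in> carrier (cobj (shift i X) (n - 1))" "x = cdiff (shift i X) (n - 1) ?y"
    using y by (auto simp: shift_sel e s)
  then show "x \<in> coboundaries (shift i X) n" by (rule coboundariesI[OF refl])
qed

text \<open>The signs come from the odd shift of the fibre; the summand of \<open>Z\<close> sits one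
  degree above that of \<open>X\<close>.\<close>

lemma cone_diff:
  assumes Z: "Z \<in> cpx" and X: "X \<in> cpx" and s: "cm Z X s"
    and "p1 z \<in> carrier (cobj Z (n + 1))" "p2 z \<in> carrier (cobj X n)"
  shows "cdiff (shift 1 (fib Z X s)) n z = pr (\<ominus>\<^bsub>cobj Z (n + 2)\<^esub> cdiff Z (n + 1) (p1 z))
      (\<ominus>\<^bsub>cobj X (n + 1)\<^esub> (s (n + 1) (p1 z)) \<oplus>\<^bsub>cobj X (n + 1)\<^esub> cdiff X n (p2 z))"
  using assms(4,5) by (simp add: shift_sel fib_sel dsum_neg md_dsum cpx_md Z X dsum_simps index_simps
    cm_simps[OF s Z X] cpx_simps[OF Z] cpx_simps[OF X] md_all[OF cpx_md[OF Z]] md_all[OF cpx_md[OF X]])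

text \<open>With \<open>q\<close> the identity this is the canonical map into the cone. The general
  form is used to lift \<open>q\<close> through \<open>s\<close>: a null homotopy of this map gives
  such a lift.\<close>

lemma cone_incl:
  assumes P: "P \<in> cpx" and Z: "Z \<in> cpx" and X: "X \<in> cpx" and s: "cm Z X s" and q: "cm P X q"
  shows "cm P (shift 1 (fib Z X s)) (\<lambda>n x. pr \<zero>\<^bsub>cobj Z (n + 1)\<^esub> (q n x))"
proof (rule cmI)
  note S = cm_simps[OF s Z X] cm_simps[OF q P X] cpx_simps[OF Z] cpx_simps[OF X] cpx_simps[OF P]
    md_all[OF cpx_md[OF Z]] md_all[OF cpx_md[OF X]]
  show "(\<lambda>x. pr \<zero>\<^bsub>cobj Z (n + 1)\<^esub> (q n x)) \<in> hm (cobj P n) (cobj (shift 1 (fib Z X s)) n)" for n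
    using hm_pr[OF hm_zero[OF cpx_md[OF Z]] cm_hm[OF q]] by (simp add: shift_sel fib_sel)
  fix n x assume "x \<in> carrier (cobj P n)"
  then show "pr \<zero>\<^bsub>cobj Z (n + 1 + 1)\<^esub> (q (n + 1) (cdiff P n x)) =
      cdiff (shift 1 (fib Z X s)) n (pr \<zero>\<^bsub>cobj Z (n + 1)\<^esub> (q n x))"
    by (simp add: cone_diff[OF Z X s] pr_eq S index_simps)
qed

text \<open>A null homotopy \<open>H\<close> into the cone has two components. The first one is, up
  to sign, a chain map to \<open>Z\<close>; the second one is a homotopy between \<open>q\<close>
  and its composite with \<open>s\<close>. \<open>P\<close> may be any complex here.\<close>

lemma cone_null:
  assumes Pc: "P \<in> cpx" and Z: "Z \<in> cpx" and X: "X \<in> cpx" and s: "cm Z X s" and q: "cm P X q"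
    and null: "hot P (shift 1 (fib Z X s)) (\<lambda>n x. pr \<zero>\<^bsub>cobj Z (n + 1)\<^esub> (q n x))
      (chain_zero (shift 1 (fib Z X s)))"
  shows "\<exists>u. cm P Z u \<and> hot P X q (s ** u)"
proof -
  let ?N = "shift 1 (fib Z X s)"
  let ?g = "\<lambda>n x. pr \<zero>\<^bsub>cobj Z (n + 1)\<^esub> (q n x)"
  note S = cm_simps[OF s Z X] cm_simps[OF q Pc X] cpx_simps[OF Z] cpx_simps[OF X] cpx_simps[OF Pc]
    md_all[OF cpx_md[OF Z]] md_all[OF cpx_md[OF X]]
  note dN = cone_diff[OF Z X s]
  obtain H where t: "htpy P ?N ?g (chain_zero ?N) H"
    using null by (rule hotE)
  note H = htpyD(1)[OF t] and e = htpyD(2)[OF t]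
  have Nn: "cobj ?N (n - 1) = dsum (cobj Z n) (cobj X (n - 1))"
    "cobj ?N n = dsum (cobj Z (n + 1)) (cobj X n)" for n
    by (simp_all add: shift_sel fib_sel)
  have u: "(\<lambda>x. p1 (H n x)) \<in> hm (cobj P n) (cobj Z n)"
    and k: "(\<lambda>x. p2 (H n x)) \<in> hm (cobj P n) (cobj X (n - 1))" for n
    using hm_comp[OF H hm_p1[of "cobj Z n" "cobj X (n - 1)", folded Nn]]
      hm_comp[OF H hm_p2[of "cobj Z n" "cobj X (n - 1)", folded Nn]] by auto
  note us = hm_simps[OF u cpx_md[OF Pc] cpx_md[OF Z]] and ks = deg_simps[OF k Pc X]
  \<comment> \<open>The homotopy identity for \<open>H\<close>, split into its
    \<open>Z\<close>-component and its \<open>X\<close>-component.\<close>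
  have e1: "\<ominus>\<^bsub>cobj Z (n + 1)\<^esub> cdiff Z n (p1 (H n x)) \<oplus>\<^bsub>cobj Z (n + 1)\<^esub> p1 (H (n + 1) (cdiff P n x)) = \<zero>\<^bsub>cobj Z (n + 1)\<^esub>"
    and e2: "q n x = (\<ominus>\<^bsub>cobj X n\<^esub> s n (p1 (H n x)) \<oplus>\<^bsub>cobj X n\<^esub> cdiff X (n - 1) (p2 (H n x))) \<oplus>\<^bsub>cobj X n\<^esub> p2 (H (n + 1) (cdiff P n x))"
    if x: "x \<in> carrier (cobj P n)" for n x
  proof -
    have "cdiff ?N (n - 1) (H n x) = pr (\<ominus>\<^bsub>cobj Z (n + 1)\<^esub> cdiff Z n (p1 (H n x)))
      (\<ominus>\<^bsub>cobj X n\<^esub> (s n (p1 (H n x))) \<oplus>\<^bsub>cobj X n\<^esub> cdiff X (n - 1) (p2 (H n x)))"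
      using dN[of "H n x" "n - 1"] us(1)[OF x] ks(1)[OF refl x] by (simp add: index_simps)
    then have "pr \<zero>\<^bsub>cobj Z (n + 1)\<^esub> (q n x) = pr \<zero>\<^bsub>cobj Z (n + 1)\<^esub> \<zero>\<^bsub>cobj X n\<^esub> \<oplus>\<^bsub>cobj ?N n\<^esub>
        (pr (\<ominus>\<^bsub>cobj Z (n + 1)\<^esub> cdiff Z n (p1 (H n x)))
      (\<ominus>\<^bsub>cobj X n\<^esub> (s n (p1 (H n x))) \<oplus>\<^bsub>cobj X n\<^esub> cdiff X (n - 1) (p2 (H n x))) \<oplus>\<^bsub>cobj ?N n\<^esub> H (n + 1) (cdiff P n x))"
      using e[OF x] by (simp add: chain_zero_def Nn dsum_simps)
    then show "\<ominus>\<^bsub>cobj Z (n + 1)\<^esub> cdiff Z n (p1 (H n x)) \<oplus>\<^bsub>cobj Z (n + 1)\<^esub> p1 (H (n + 1) (cdiff P n x)) = \<zero>\<^bsub>cobj Z (n + 1)\<^esub>"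
      and "q n x = (\<ominus>\<^bsub>cobj X n\<^esub> s n (p1 (H n x)) \<oplus>\<^bsub>cobj X n\<^esub> cdiff X (n - 1) (p2 (H n x))) \<oplus>\<^bsub>cobj X n\<^esub> p2 (H (n + 1) (cdiff P n x))"
      using x by (simp_all add: Nn dsum_simps pr_eq us ks S)
  qed
  let ?u = "\<lambda>n x. p1 (H n x)"
  have ucm: "cm P Z ?u"
  proof (rule cmI[OF u])
    fix n x assume x: "x \<in> carrier (cobj P n)"
    have "p1 (H (n + 1) (cdiff P n x)) = cdiff Z n (p1 (H n x)) \<oplus>\<^bsub>cobj Z (n + 1)\<^esub>
        (\<ominus>\<^bsub>cobj Z (n + 1)\<^esub> cdiff Z n (p1 (H n x)) \<oplus>\<^bsub>cobj Z (n + 1)\<^esub> p1 (H (n + 1) (cdiff P n x)))"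
      using x by (simp add: us S)
    then show "p1 (H (n + 1) (cdiff P n x)) = cdiff Z n (p1 (H n x))"
      unfolding e1[OF x] using x by (simp add: us S)
  qed
  \<comment> \<open>\<open>e2\<close> has \<open>s\<close> applied to the first component with a
    minus sign, so the lift is the negative of \<open>?u\<close>.\<close>
  have "hot P X q (s ** (chain_neg Z ?u))"
    by (rule hotI[OF k]) (simp add: e2 chain_comp_def chain_neg_def us ks S)
  then show ?thesis using cm_neg[OF ucm Pc Z] by blast
qed

text \<open>The cone of a quasi-isomorphism is acyclic, so \<open>null_of_acyclic\<close> kills the
  map from \<open>P\<close> into it, and \<open>cone_null\<close> extracts the lift.\<close>

lemma kproj_lift:
  assumes P: "bounded_above_projective P" and Z: "Z \<in> cpx" and X: "X \<in> cpx"
    and s: "cm Z X s" "qis Z X s" and q: "cm P X q"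
  shows "\<exists>u. cm P Z u \<and> hot P X q (s ** u)"
proof -
  have Pc: "P \<in> cpx" using P by (simp add: bounded_above_projective_def)
  have N: "shift 1 (fib Z X s) \<in> cpx" "acyclic_cpx (shift 1 (fib Z X s))"
    using fib_cpx[OF Z X s(1)] fib_acyclic[OF Z X s] shift_cpx shift_acyclic by blast+
  show ?thesis
    by (rule cone_null[OF Pc Z X s(1) q null_of_acyclic[OF P N cone_incl[OF Pc Z X s(1) q]]])
qed

text \<open>A homotopy \<open>h\<close> between the composites makes \<open>(u - v, h)\<close> a
  chain map from \<open>P\<close> to the fibre of \<open>s\<close>. The fibre is acyclic, and the
  first component of a null homotopy of this map is a homotopy from \<open>u\<close> to
  \<open>v\<close>.\<close>

lemma kproj_uniq:
  assumes P: "bounded_above_projective P" and Z: "Z \<in> cpx" and X: "X \<in> cpx"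
    and s: "cm Z X s" "qis Z X s" and u: "cm P Z u" and v: "cm P Z v"
    and uv: "hot P X (s ** u) (s ** v)"
  shows "hot P Z u v"
proof -
  have Pc: "P \<in> cpx" using P by (simp add: bounded_above_projective_def)
  let ?N = "fib Z X s"
  note S = cm_simps[OF s(1) Z X] cm_simps[OF u Pc Z] cm_simps[OF v Pc Z] cpx_simps[OF Z] cpx_simps[OF X]
    cpx_simps[OF Pc] md_all[OF cpx_md[OF Z]] md_all[OF cpx_md[OF X]]
  obtain h where t: "htpy P X (s ** u) (s ** v) h"
    using uv by (rule hotE)
  note h = htpyD(1)[OF t] and e = htpyD(2)[OF t, unfolded chain_comp_def]
  note hs = deg_simps[OF h Pc X]
  let ?g = "\<lambda>n x. pr (u n x \<ominus>\<^bsub>cobj Z n\<^esub> v n x) (h n x)"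
  have "cm P ?N ?g"
  proof (rule cmI)
    show "?g n \<in> hm (cobj P n) (cobj ?N n)" for n
      unfolding fib_sel by (intro hm_pr hm_diff cm_hm u v h cpx_md Z Pc)
    fix n x assume x: "x \<in> carrier (cobj P n)"
    then show "?g (n + 1) (cdiff P n x) = cdiff ?N n (?g n x)"
      by (simp add: fib_sel pr_eq S hs e)
  qed
  then obtain H where t: "htpy P ?N ?g (chain_zero ?N) H"
    using hotE[OF null_of_acyclic[OF P fib_cpx[OF Z X s(1)] fib_acyclic[OF Z X s]]] by blast
  note H = htpyD(1)[OF t] and eH = htpyD(2)[OF t]
  have k: "(\<lambda>x. p1 (H n x)) \<in> hm (cobj P n) (cobj Z (n - 1))" for n
    using hm_comp[OF H hm_p1[of "cobj Z (n - 1)" "cobj X (n - 1 - 1)", folded fib_sel(1)[of Z X s]]] .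
  note ks = deg_simps[OF k Pc Z]
  show ?thesis
  proof (rule hotI[OF k])
    fix n x assume x: "x \<in> carrier (cobj P n)"
    have "u n x \<ominus>\<^bsub>cobj Z n\<^esub> v n x =
        cdiff Z (n - 1) (p1 (H n x)) \<oplus>\<^bsub>cobj Z n\<^esub> p1 (H (n + 1) (cdiff P n x))"
      using eH[OF x] x by (simp add: fib_sel dsum_simps pr_eq chain_zero_def S ks)
    moreover have "u n x = v n x \<oplus>\<^bsub>cobj Z n\<^esub> (u n x \<ominus>\<^bsub>cobj Z n\<^esub> v n x)"
      using x by (simp add: S)
    ultimately show "u n x = v n x \<oplus>\<^bsub>cobj Z n\<^esub> (cdiff Z (n - 1) (p1 (H n x)) \<oplus>\<^bsub>cobj Z n\<^esub> p1 (H (n + 1) (cdiff P n x)))"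
      by simp
  qed
qed

section \<open>Calculus of roofs over strictly perfect resolutions\<close>

definition coh :: "'u cpx \<Rightarrow> int \<Rightarrow> 'u \<Rightarrow> 'u \<Rightarrow> bool" where
  "coh Y n x y \<longleftrightarrow> (\<exists>b\<in>coboundaries Y n. x = b \<oplus>\<^bsub>cobj Y n\<^esub> y)"

lemma coboundaries_carrier: "Y \<in> cpx \<Longrightarrow> b \<in> coboundaries Y n \<Longrightarrow> b \<in> carrier (cobj Y n)"
  using submod_coboundaries[of Y n] by (auto simp: submod_def)

lemma cocycles_carrier: "b \<in> cocycles Y n \<Longrightarrow> b \<in> carrier (cobj Y n)"
  by (simp add: cocycles_def)

lemma coboundaries_closed:
  assumes "Y \<in> cpx"
  shows "\<lbrakk>a \<in> coboundaries Y n; b \<in> coboundaries Y n\<rbrakk> \<Longrightarrow> a \<oplus>\<^bsub>cobj Y n\<^esub> b \<in> coboundaries Y n"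
    and "a \<in> coboundaries Y n \<Longrightarrow> \<ominus>\<^bsub>cobj Y n\<^esub> a \<in> coboundaries Y n"
    and "\<zero>\<^bsub>cobj Y n\<^esub> \<in> coboundaries Y n"
proof -
  show "a \<in> coboundaries Y n \<Longrightarrow> \<ominus>\<^bsub>cobj Y n\<^esub> a \<in> coboundaries Y n"
    unfolding coboundaries_def
    using cpx_simps(5)[OF assms, of _ "n - 1"] md_simps(3)[OF cpx_md[OF assms, of "n - 1"]]
    by (force simp: image_iff)
qed (use submod_coboundaries[OF assms, of n] in \<open>auto simp: submod_def\<close>)

lemma coh_refl: "Y \<in> cpx \<Longrightarrow> x \<in> carrier (cobj Y n) \<Longrightarrow> coh Y n x x"
  unfolding coh_def by (rule bexI[OF _ coboundaries_closed(3)]) (simp_all add: md_simps[OF cpx_md])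

lemma coh_trans:
  assumes "coh Y n x y" "coh Y n y z" "Y \<in> cpx" "z \<in> carrier (cobj Y n)"
  shows "coh Y n x z"
proof -
  obtain b where b: "b \<in> coboundaries Y n" "x = b \<oplus>\<^bsub>cobj Y n\<^esub> y" using assms(1) by (auto simp: coh_def)
  obtain c where c: "c \<in> coboundaries Y n" "y = c \<oplus>\<^bsub>cobj Y n\<^esub> z" using assms(2) by (auto simp: coh_def)
  show ?thesis
    unfolding coh_def
    by (rule bexI[OF _ coboundaries_closed(1)[OF assms(3) b(1) c(1)]])
      (simp add: b(2) c(2) coboundaries_carrier[OF assms(3) b(1)] coboundaries_carrier[OF assms(3) c(1)]
        assms(4) md_all[OF cpx_md[OF assms(3)]])
qed

lemma coh_boundary: "\<lbrakk>coh Y n x y; y \<in> coboundaries Y n; Y \<in> cpx\<rbrakk> \<Longrightarrow> x \<in> coboundaries Y n"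
  by (auto simp: coh_def coboundaries_closed)

lemma coh_map:
  assumes "coh X n x y" "y \<in> carrier (cobj X n)" "cm X Y f" "X \<in> cpx" "Y \<in> cpx"
  shows "coh Y n (f n x) (f n y)"
proof -
  obtain b where b: "b \<in> coboundaries X n" "x = b \<oplus>\<^bsub>cobj X n\<^esub> y" using assms(1) by (auto simp: coh_def)
  show ?thesis
    unfolding coh_def
    by (rule bexI[OF _ cm_coboundaries[OF assms(3,4,5) b(1)]])
      (simp add: b(2) coboundaries_carrier[OF assms(4) b(1)] assms(2) cm_simps[OF assms(3,4,5)])
qed

lemma hot_coh:
  assumes "hot X Y f g" "cm X Y g" "X \<in> cpx" "Y \<in> cpx" "x \<in> cocycles X n"
  shows "coh Y n (f n x) (g n x)"
proof -
  obtain h where t: "htpy X Y f g h"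
    using assms(1) by (rule hotE)
  note h = htpyD(1)[OF t] and e = htpyD(2)[OF t]
  note hs = deg_simps[OF h assms(3,4)] and Ys = cpx_simps[OF assms(4)] md_all[OF cpx_md[OF assms(4)]]
  have x: "x \<in> carrier (cobj X n)" "cdiff X n x = \<zero>\<^bsub>cobj X (n + 1)\<^esub>"
    using assms(5) by (auto simp: cocycles_def)
  have "f n x = cdiff Y (n - 1) (h n x) \<oplus>\<^bsub>cobj Y n\<^esub> g n x"
    using e[OF x(1)] x by (simp add: hs Ys cm_simps[OF assms(2-4)])
  moreover have "cdiff Y (n - 1) (h n x) \<in> coboundaries Y n"
    using hs(1)[OF refl x(1)] by (simp add: coboundaries_def)
  ultimately show ?thesis by (auto simp: coh_def)
qed

lemma qisD1: "\<lbrakk>qis X Y f; x \<in> cocycles X n; f n x \<in> coboundaries Y n\<rbrakk> \<Longrightarrow> x \<in> coboundaries X n"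
  by (simp add: qis_def)

lemma qisD2: "\<lbrakk>qis X Y f; y \<in> cocycles Y n\<rbrakk> \<Longrightarrow> \<exists>x\<in>cocycles X n. coh Y n y (f n x)"
  by (simp add: qis_def coh_def)

lemma qisI:
  assumes "\<And>n x. \<lbrakk>x \<in> cocycles X n; f n x \<in> coboundaries Y n\<rbrakk> \<Longrightarrow> x \<in> coboundaries X n"
    and "\<And>n y. y \<in> cocycles Y n \<Longrightarrow> \<exists>x\<in>cocycles X n. coh Y n y (f n x)"
  shows "qis X Y f"
  using assms by (simp add: qis_def coh_def)

lemma qis_id: "X \<in> cpx \<Longrightarrow> qis X X chain_id"
  by (rule qisI) (auto simp: chain_id_def intro: coh_refl cocycles_carrier)

lemma qis_hot:
  assumes "hot X Y f g" "qis X Y f" "X \<in> cpx" "Y \<in> cpx" "cm X Y g"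
  shows "qis X Y g"
proof (rule qisI)
  note hc = hot_coh[OF assms(1,5,3,4)]
  show "x \<in> coboundaries X n" if "x \<in> cocycles X n" "g n x \<in> coboundaries Y n" for n x
    using qisD1[OF assms(2) that(1)] coh_boundary[OF hc[OF that(1)] that(2) assms(4)] .
  fix n y assume "y \<in> cocycles Y n"
  then obtain x where x: "x \<in> cocycles X n" "coh Y n y (f n x)" using qisD2[OF assms(2)] by blast
  then show "\<exists>x\<in>cocycles X n. coh Y n y (g n x)"
    by (intro bexI[of _ x] coh_trans[OF x(2) hc[OF x(1)] assms(4)] cm_simps(1)[OF assms(5,3,4)] cocycles_carrier)
qed

lemma qis_comp:
  assumes "qis X Y f" "qis Y Z g" "cm X Y f" "cm Y Z g" "X \<in> cpx" "Y \<in> cpx" "Z \<in> cpx"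
  shows "qis X Z (g ** f)"
proof (rule qisI)
  show "x \<in> coboundaries X n" if "x \<in> cocycles X n" "(g ** f) n x \<in> coboundaries Z n" for n x
    using qisD1[OF assms(1) that(1)] qisD1[OF assms(2) cm_cocycles[OF assms(3,5,6) that(1)]] that(2)
    by (simp add: chain_comp_def)
  fix n z assume "z \<in> cocycles Z n"
  then obtain y where y: "y \<in> cocycles Y n" "coh Z n z (g n y)" using qisD2[OF assms(2)] by blast
  then obtain x where x: "x \<in> cocycles X n" "coh Y n y (f n x)" using qisD2[OF assms(1)] by blast
  have c: "f n x \<in> carrier (cobj Y n)" "g n (f n x) \<in> carrier (cobj Z n)"
    using cm_simps(1)[OF assms(3,5,6) cocycles_carrier[OF x(1)]] cm_simps(1)[OF assms(4,6,7)] by auto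
  show "\<exists>x\<in>cocycles X n. coh Z n z ((g ** f) n x)"
    using coh_trans[OF y(2) coh_map[OF x(2) c(1) assms(4,6,7)] assms(7) c(2)] x(1)
    by (auto simp: chain_comp_def)
qed

lemma qis_reflect:
  assumes "qis X Y f" "cm X Y f" "X \<in> cpx" "Y \<in> cpx" "x \<in> cocycles X n" "y \<in> cocycles X n"
    and "coh Y n (f n x) (f n y)"
  shows "coh X n x y"
proof -
  note s = cpx_simps[OF assms(3)] md_all[OF cpx_md[OF assms(3)]] cm_simps[OF assms(2-4)]
    md_all[OF cpx_md[OF assms(4)]]
  have c: "x \<in> carrier (cobj X n)" "y \<in> carrier (cobj X n)" using assms(5,6) by (simp_all add: cocycles_def)
  obtain b where b: "b \<in> coboundaries Y n" "f n x = b \<oplus>\<^bsub>cobj Y n\<^esub> f n y" using assms(7) by (auto simp: coh_def)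
  have "f n (x \<ominus>\<^bsub>cobj X n\<^esub> y) = b"
    using c coboundaries_carrier[OF assms(4) b(1)] by (simp add: s b(2))
  moreover have "x \<ominus>\<^bsub>cobj X n\<^esub> y \<in> cocycles X n"
    using assms(5,6) by (simp add: cocycles_def s)
  ultimately have "x \<ominus>\<^bsub>cobj X n\<^esub> y \<in> coboundaries X n" using qisD1[OF assms(1)] b(1) by simp
  then show ?thesis unfolding coh_def by (rule bexI[rotated]) (simp add: s c)
qed

text \<open>One case of two-out-of-three. It shows that a lift of a resolution through a
  quasi-isomorphism is again a quasi-isomorphism.\<close>

lemma qis_cancel:
  assumes "qis X Z (g ** f)" "qis Y Z g" "cm X Y f" "cm Y Z g" "X \<in> cpx" "Y \<in> cpx" "Z \<in> cpx"
  shows "qis X Y f"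
proof (rule qisI)
  show "x \<in> coboundaries X n" if "x \<in> cocycles X n" "f n x \<in> coboundaries Y n" for n x
    using qisD1[OF assms(1) that(1)] cm_coboundaries[OF assms(4,6,7) that(2)] by (simp add: chain_comp_def)
  fix n y assume y: "y \<in> cocycles Y n"
  obtain x where x: "x \<in> cocycles X n" "coh Z n (g n y) (g n (f n x))"
    using qisD2[OF assms(1) cm_cocycles[OF assms(4,6,7) y]] by (auto simp: chain_comp_def)
  then show "\<exists>x\<in>cocycles X n. coh Y n y (f n x)"
    using qis_reflect[OF assms(2,4,6,7) y cm_cocycles[OF assms(3,5,6) x(1)]] by blast
qed

lemma qi_iff: "\<lbrakk>X \<in> cpx; Y \<in> cpx\<rbrakk> \<Longrightarrow> quasi_iso R X Y f \<longleftrightarrow> cm X Y f \<and> qis X Y f"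
  using quasi_iso_iff by (auto simp: quasi_iso_def)

text \<open>Homotopy bundled with its side conditions, so that symmetry and transitivity hold
  without premises and calculations can be chained.\<close>

definition hq :: "'u cpx \<Rightarrow> 'u cpx \<Rightarrow> 'u cmap \<Rightarrow> 'u cmap \<Rightarrow> bool" where
  "hq X Y f g \<longleftrightarrow> X \<in> cpx \<and> Y \<in> cpx \<and> cm X Y f \<and> cm X Y g \<and> hot X Y f g"

lemma hqD: assumes "hq X Y f g"
  shows "X \<in> cpx" "Y \<in> cpx" "cm X Y f" "cm X Y g" "hot X Y f g"
  using assms by (auto simp: hq_def)

lemma hq_refl: "\<lbrakk>X \<in> cpx; Y \<in> cpx; cm X Y f\<rbrakk> \<Longrightarrow> hq X Y f f"
  by (simp add: hq_def hot_refl)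

lemma hq_sym: "hq X Y f g \<Longrightarrow> hq X Y g f"
  by (auto simp: hq_def intro: hot_sym)

lemma hq_trans [trans]: "\<lbrakk>hq X Y f g; hq X Y g h\<rbrakk> \<Longrightarrow> hq X Y f h"
  by (auto simp: hq_def intro: hot_trans)

lemma hq_pre: "\<lbrakk>hq X Y f g; cm W X u; W \<in> cpx\<rbrakk> \<Longrightarrow> hq W Y (f ** u) (g ** u)"
  by (auto simp: hq_def intro: hot_pre cm_comp)

lemma hq_post: "\<lbrakk>hq X Y f g; cm Y Z s; Z \<in> cpx\<rbrakk> \<Longrightarrow> hq X Z (s ** f) (s ** g)"
  by (auto simp: hq_def intro: hot_post cm_comp)

lemma hq_add: "\<lbrakk>hq X Y f g; hq X Y f' g'\<rbrakk> \<Longrightarrow> hq X Y (chain_add Y f f') (chain_add Y g g')"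
  by (auto simp: hq_def intro: hot_add cm_add)

lemma hq_eq: "\<lbrakk>X \<in> cpx; Y \<in> cpx; cm X Y f; cm X Y g; \<And>n x. x \<in> carrier (cobj X n) \<Longrightarrow> f n x = g n x\<rbrakk> \<Longrightarrow> hq X Y f g"
  by (auto simp: hq_def intro: hot_eq)

lemma chain_comp_assoc: "(f ** g) ** h = f ** g ** h"
  by (simp add: chain_comp_def)

lemma chain_comp_id [simp]: "f ** chain_id = f" "chain_id ** f = f"
  by (simp_all add: chain_comp_def chain_id_def)

definition strictly_perfect :: "'u cpx \<Rightarrow> bool" where
  "strictly_perfect P \<longleftrightarrow> P \<in> cpx \<and> (\<forall>n. projective_rmod R (cobj P n) \<and> fg_rmod R (cobj P n)) \<and>
     (\<exists>a b. \<forall>n. n \<notin> {a..b} \<longrightarrow> carrier (cobj P n) = {\<zero>\<^bsub>cobj P n\<^esub>})"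

lemma sp_bap: "strictly_perfect P \<Longrightarrow> bounded_above_projective P"
proof -
  assume sp: "strictly_perfect P"
  then obtain a b where "\<And>n. n \<notin> {a..b} \<Longrightarrow> carrier (cobj P n) = {\<zero>\<^bsub>cobj P n\<^esub>}"
    unfolding strictly_perfect_def by blast
  then have "\<forall>n>b. carrier (cobj P n) = {\<zero>\<^bsub>cobj P n\<^esub>}" by auto
  then show ?thesis using sp unfolding strictly_perfect_def bounded_above_projective_def by blast
qed

text \<open>The working form of perfectness: by \<open>res_perfect\<close> and
  \<open>perfect_res\<close> exactly the perfect complexes admit such data, but the comparison is
  now an actual chain map instead of a class of roofs.\<close>

definition res :: "'u cpx \<Rightarrow> 'u cmap \<Rightarrow> 'u cpx \<Rightarrow> bool" where
  "res P p X \<longleftrightarrow> strictly_perfect P \<and> X \<in> cpx \<and> cm P X p \<and> qis P X p"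

lemma resD: assumes "res P p X"
  shows "bounded_above_projective P" "P \<in> cpx" "X \<in> cpx" "cm P X p" "qis P X p"
  using assms sp_bap by (auto simp: res_def strictly_perfect_def)

lemma res_id: "strictly_perfect P \<Longrightarrow> res P chain_id P"
  by (simp add: res_def cm_id qis_id strictly_perfect_def)

lemma res_lift:
  assumes "res P p X" "Z \<in> cpx" "cm Z X s" "qis Z X s"
  obtains u where "cm P Z u" "hq P X (s ** u) p" "qis P Z u"
proof -
  note r = resD[OF assms(1)]
  obtain u where u: "cm P Z u" "hot P X p (s ** u)"
    using kproj_lift[OF r(1) assms(2) r(3) assms(3,4) r(4)] by blast
  have h: "hq P X p (s ** u)" using u r assms by (auto simp: hq_def intro: cm_comp)
  have "qis P Z u"
    by (rule qis_cancel[OF qis_hot[OF u(2) r(5,2,3) hqD(4)[OF h]] assms(4) u(1) assms(3) r(2) assms(2) r(3)])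
  then show thesis using that u(1) hq_sym[OF h] by blast
qed

lemma res_uniq:
  assumes "res P p X" "Z \<in> cpx" "cm Z X s" "qis Z X s" "cm P Z u" "cm P Z v"
    "hq P X (s ** u) (s ** v)"
  shows "hq P Z u v"
  using kproj_uniq[OF resD(1)[OF assms(1)] assms(2) resD(3)[OF assms(1)] assms(3-6) hqD(5)[OF assms(7)]]
    assms resD[OF assms(1)] by (simp add: hq_def)

lemma roofs_iff: "\<lbrakk>X \<in> cpx; Y \<in> cpx\<rbrakk> \<Longrightarrow> Roof Z s f \<in> roofs R X Y \<longleftrightarrow>
    Z \<in> cpx \<and> cm Z X s \<and> qis Z X s \<and> cm Z Y f"
  by (auto simp: roofs_def qi_iff)

text \<open>Both roofs are pulled back to \<open>P\<close> along lifts of \<open>p\<close> through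
  their left legs; only the homotopy class of the resulting map \<open>P -> Y\<close> remains. Hence
  \<open>roof_rel\<close> is transitive when \<open>X\<close> has a resolution.\<close>

lemma roof_rel_iff:
  assumes r: "res P p X" and Y: "Y \<in> cpx"
    and \<rho>: "Roof Z s f \<in> roofs R X Y" and \<sigma>: "Roof Z' s' f' \<in> roofs R X Y"
    and u: "cm P Z u" "hq P X (s ** u) p" and v: "cm P Z' v" "hq P X (s' ** v) p"
  shows "(Roof Z s f, Roof Z' s' f') \<in> roof_rel R X Y \<longleftrightarrow> hq P Y (f ** u) (f' ** v)"
proof
  note rr = resD[OF r]
  have Z: "Z \<in> cpx" "cm Z X s" "qis Z X s" "cm Z Y f" and Z': "Z' \<in> cpx" "cm Z' X s'" "qis Z' X s'" "cm Z' Y f'"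
    using \<rho> \<sigma> roofs_iff[OF rr(3) Y] by auto
  {
    assume "(Roof Z s f, Roof Z' s' f') \<in> roof_rel R X Y"
    then obtain W a b where W: "W \<in> cpx" "cm W Z a" "cm W Z' b" "quasi_iso R W X (s ** a)"
      "hot W X (s ** a) (s' ** b)" "hot W Y (f ** a) (f' ** b)"
      by (auto simp: roof_rel_def)
    have c: "cm W X (s ** a)" "cm W X (s' ** b)" "cm W Y (f ** a)" "cm W Y (f' ** b)"
      using W Z Z' by (auto intro: cm_comp)
    have 1: "hq W X (s ** a) (s' ** b)" and 2: "hq W Y (f ** a) (f' ** b)"
      using W c rr Y by (auto simp: hq_def)
    have q: "qis W X (s ** a)" using W(4) qi_iff[OF W(1) rr(3)] by simp
    \<comment> \<open>Lift \<open>p\<close> to the common refinement \<open>W\<close>. Then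
      \<open>a ** w\<close> and \<open>u\<close> both lift \<open>p\<close> through
      \<open>s\<close>, and \<open>b ** w\<close> and \<open>v\<close> both lift it through
      \<open>s'\<close>, so uniqueness of lifts compares the right legs.\<close>
    obtain w where w: "cm P W w" "hq P X ((s ** a) ** w) p"
      using res_lift[OF r W(1) c(1) q] by blast
    have 3: "hq P Z (a ** w) u"
      by (rule res_uniq[OF r Z(1,2,3) cm_comp[OF w(1) W(2) rr(2) W(1)] u(1)])
        (use hq_trans[OF w(2) hq_sym[OF u(2)]] in \<open>simp add: chain_comp_assoc\<close>)
    have "hq P X (s' ** b ** w) p"
      using hq_trans[OF hq_sym[OF hq_pre[OF 1 w(1) rr(2)]] w(2)] by (simp add: chain_comp_assoc)
    then have 4: "hq P Z' (b ** w) v"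
      by (intro res_uniq[OF r Z'(1,2,3) cm_comp[OF w(1) W(3) rr(2) W(1)] v(1)])
        (rule hq_trans[OF _ hq_sym[OF v(2)]])
    have "hq P Y (f ** u) (f ** a ** w)"
      by (rule hq_sym[OF hq_post[OF 3 Z(4) Y]])
    also have "hq P Y (f ** a ** w) (f' ** b ** w)"
      using hq_pre[OF 2 w(1) rr(2)] by (simp add: chain_comp_assoc)
    also have "hq P Y (f' ** b ** w) (f' ** v)"
      by (rule hq_post[OF 4 Z'(4) Y])
    finally show "hq P Y (f ** u) (f' ** v)" .
  }
  assume h: "hq P Y (f ** u) (f' ** v)"
  \<comment> \<open>\<open>P\<close> itself serves as the common refinement, with legs
    \<open>u\<close> and \<open>v\<close>.\<close>
  have "quasi_iso R P X (s ** u)"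
    using qis_hot[OF hqD(5)[OF hq_sym[OF u(2)]] rr(5,2,3)] hqD(3)[OF u(2)] qi_iff[OF rr(2,3)] by blast
  moreover have "hq P X (s ** u) (s' ** v)" by (rule hq_trans[OF u(2) hq_sym[OF v(2)]])
  ultimately show "(Roof Z s f, Roof Z' s' f') \<in> roof_rel R X Y"
    unfolding roof_rel_def using \<rho> \<sigma> rr(2) u(1) v(1) hqD(5)[OF h] by (auto dest: hqD(5))
qed

section \<open>Normal forms of morphisms out of a resolved complex\<close>

definition cls :: "'u cpx \<Rightarrow> 'u cmap \<Rightarrow> 'u cpx \<Rightarrow> 'u cpx \<Rightarrow> 'u cmap \<Rightarrow> 'u dmor" where
  "cls P p X Y g = roof_class R X Y (Roof P p g)"

context
  fixes P p X Y
  assumes r: "res P p X" and Y: "Y \<in> cpx"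
begin

lemma res_roof: "cm P Y g \<Longrightarrow> Roof P p g \<in> roofs R X Y"
  using resD[OF r] Y by (simp add: roofs_iff)

lemma res_hq: "hq P X (p ** chain_id) p"
  using resD[OF r] by (simp add: hq_refl)

lemma roof_lift:
  assumes "Roof Z s f \<in> roofs R X Y"
  obtains u where "cm P Z u" "hq P X (s ** u) p" "qis P Z u"
proof -
  have "Z \<in> cpx \<and> cm Z X s \<and> qis Z X s" using assms roofs_iff[OF resD(3)[OF r] Y] by simp
  then show thesis using res_lift[OF r] that by blast
qed

lemma mem_cls_iff:
  assumes "cm P Y g" "Roof Z s f \<in> roofs R X Y" "cm P Z u" "hq P X (s ** u) p"
  shows "Roof Z s f \<in> cls P p X Y g \<longleftrightarrow> hq P Y g (f ** u)"
  using roof_rel_iff[OF r Y res_roof[OF assms(1)] assms(2) cm_id res_hq assms(3,4)]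
  by (simp add: cls_def roof_class_def)

lemma roof_class_roofs: "\<sigma> \<in> roof_class R X Y \<rho> \<Longrightarrow> \<sigma> \<in> roofs R X Y"
  by (simp add: roof_class_def roof_rel_def)

text \<open>Every roof is brought to the left leg \<open>p\<close> by lifting \<open>p\<close>
  through its own left leg. Both classes consist of roofs, so comparing membership of roofs is
  enough.\<close>

lemma roof_class_eq:
  assumes "Roof Z s f \<in> roofs R X Y" "cm P Z u" "hq P X (s ** u) p"
  shows "roof_class R X Y (Roof Z s f) = cls P p X Y (f ** u)"
proof -
  have f: "cm P Y (f ** u)"
    using assms roofs_iff[OF resD(3)[OF r] Y] resD(2)[OF r] by (auto intro: cm_comp)
  have "\<sigma> \<in> roof_class R X Y (Roof Z s f) \<longleftrightarrow> \<sigma> \<in> cls P p X Y (f ** u)" if \<sigma>: "\<sigma> \<in> roofs R X Y" for \<sigma>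
  proof (cases \<sigma>)
    case (Roof Z' s' f')
    obtain v where v: "cm P Z' v" "hq P X (s' ** v) p"
      using roof_lift[OF \<sigma>[unfolded Roof]] by blast
    show ?thesis
      using roof_rel_iff[OF r Y assms(1) \<sigma>[unfolded Roof] assms(2,3) v]
        mem_cls_iff[OF f \<sigma>[unfolded Roof] v]
      by (simp add: Roof roof_class_def)
  qed
  then show ?thesis using roof_class_roofs unfolding cls_def by blast
qed

lemma cls_self: "cm P Y g \<Longrightarrow> Roof P p g \<in> cls P p X Y g"
  using mem_cls_iff[OF _ res_roof cm_id res_hq] resD(2)[OF r] Y by (simp add: hq_refl)

lemma cls_eq_iff:
  assumes "cm P Y g" "cm P Y g'"
  shows "cls P p X Y g = cls P p X Y g' \<longleftrightarrow> hq P Y g g'"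
proof
  assume "cls P p X Y g = cls P p X Y g'"
  then have "Roof P p g' \<in> cls P p X Y g" using cls_self[OF assms(2)] by simp
  then show "hq P Y g g'" using mem_cls_iff[OF assms(1) res_roof[OF assms(2)] cm_id res_hq] by simp
next
  assume h: "hq P Y g g'"
  have "\<sigma> \<in> cls P p X Y g \<longleftrightarrow> \<sigma> \<in> cls P p X Y g'" if \<sigma>: "\<sigma> \<in> roofs R X Y" for \<sigma>
  proof (cases \<sigma>)
    case (Roof Z' s' f')
    obtain v where v: "cm P Z' v" "hq P X (s' ** v) p"
      using roof_lift[OF \<sigma>[unfolded Roof]] by blast
    show ?thesis
      using mem_cls_iff[OF assms(1) \<sigma>[unfolded Roof] v] mem_cls_iff[OF assms(2) \<sigma>[unfolded Roof] v]
        h hq_trans hq_sym unfolding Roof by blast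
  qed
  then show "cls P p X Y g = cls P p X Y g'" using roof_class_roofs unfolding cls_def by blast
qed

lemma carrier_dhom: "carrier (dhom R X Y) = cls P p X Y ` {g. cm P Y g}"
proof
  show "carrier (dhom R X Y) \<subseteq> cls P p X Y ` {g. cm P Y g}"
  proof
    fix \<alpha> assume "\<alpha> \<in> carrier (dhom R X Y)"
    then obtain \<rho> where \<rho>: "\<rho> \<in> roofs R X Y" "\<alpha> = roof_class R X Y \<rho>"
      by (auto simp: dhom_def quotient_def roof_class_def)
    obtain Z s f where Z: "\<rho> = Roof Z s f" by (cases \<rho>)
    obtain u where u: "cm P Z u" "hq P X (s ** u) p" using roof_lift \<rho>(1) Z by blast
    have "cm P Y (f ** u)"
      using \<rho>(1) Z u roofs_iff[OF resD(3)[OF r] Y] resD(2)[OF r] by (auto intro: cm_comp)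
    then show "\<alpha> \<in> cls P p X Y ` {g. cm P Y g}"
      using roof_class_eq[OF _ u, of f] \<rho> Z by blast
  qed
  show "cls P p X Y ` {g. cm P Y g} \<subseteq> carrier (dhom R X Y)"
    using res_roof by (auto simp: dhom_def quotient_def cls_def roof_class_def)
qed

lemma one_dhom: "\<one>\<^bsub>dhom R X Y\<^esub> = cls P p X Y (chain_zero Y)"
proof -
  have "(chain_zero Y) ** p = chain_zero Y" by (simp add: chain_comp_def chain_zero_def)
  moreover have "Roof X chain_id (chain_zero Y) \<in> roofs R X Y"
    using resD[OF r] Y by (simp add: roofs_iff cm_id qis_id cm_zero)
  ultimately show ?thesis
    using roof_class_eq[of X chain_id "chain_zero Y" p] resD[OF r] by (simp add: dhom_def hq_refl)
qed

text \<open>All members of the union that defines the sum are shown to be the same class, and the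
  union is shown to be over a nonempty family.\<close>

lemma mult_dhom:
  assumes g: "cm P Y g" and g': "cm P Y g'"
  shows "cls P p X Y g \<otimes>\<^bsub>dhom R X Y\<^esub> cls P p X Y g' = cls P p X Y (chain_add Y g g')"
proof -
  let ?A = "{roof_class R X Y (Roof Z s (chain_add Y f f')) |Z s f f'.
     Roof Z s f \<in> cls P p X Y g \<and> Roof Z s f' \<in> cls P p X Y g'}"
  have "A = cls P p X Y (chain_add Y g g')" if "A \<in> ?A" for A
  proof -
    from that obtain Z s f f' where A: "A = roof_class R X Y (Roof Z s (chain_add Y f f'))"
      and f: "Roof Z s f \<in> cls P p X Y g" and f': "Roof Z s f' \<in> cls P p X Y g'" by blast
    have fr: "Roof Z s f \<in> roofs R X Y" "Roof Z s f' \<in> roofs R X Y"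
      using f f' roof_class_roofs by (auto simp: cls_def)
    then have fs: "Z \<in> cpx" "cm Z X s" "qis Z X s" "cm Z Y f" "cm Z Y f'"
      using roofs_iff[OF resD(3)[OF r] Y] by auto
    have "Roof Z s (chain_add Y f f') \<in> roofs R X Y"
      using fs Y resD[OF r] by (simp add: roofs_iff cm_add)
    moreover obtain u where u: "cm P Z u" "hq P X (s ** u) p" using roof_lift fr(1) by blast
    ultimately have "A = cls P p X Y ((chain_add Y f f') ** u)"
      using roof_class_eq A by simp
    also have "(chain_add Y f f') ** u = chain_add Y (f ** u) (f' ** u)"
      by (simp add: chain_comp_def chain_add_def)
    also have "cls P p X Y \<dots> = cls P p X Y (chain_add Y g g')"
    proof -
      have "hq P Y g (f ** u)" "hq P Y g' (f' ** u)"
        using f f' mem_cls_iff[OF g fr(1) u] mem_cls_iff[OF g' fr(2) u] by auto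
      then have "hq P Y (chain_add Y g g') (chain_add Y (f ** u) (f' ** u))" by (rule hq_add)
      then show ?thesis using cls_eq_iff hqD hq_sym by blast
    qed
    finally show ?thesis .
  qed
  \<comment> \<open>Nonempty: \<open>p\<close> is a common left leg of the two summands.\<close>
  moreover have "cls P p X Y (chain_add Y g g') \<in> ?A"
    using cls_self[OF g] cls_self[OF g'] by (auto simp: cls_def)
  ultimately have "\<Union>?A = cls P p X Y (chain_add Y g g')" by blast
  then show ?thesis by (simp add: dhom_def dadd_def)
qed

end

text \<open>The identity roof has left leg \<open>chain_id\<close>, through which \<open>p\<close>
  lifts as itself.\<close>

lemma id_dhom: "res P p X \<Longrightarrow> roof_class R X X (Roof X chain_id chain_id) = cls P p X X p"
  using roof_class_eq[of P p X X X chain_id chain_id p] resD[of P p X]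
  by (simp add: hq_refl roofs_iff cm_id qis_id)

text \<open>The substitute for the Ore condition: whatever square completes two representatives,
  pulling it back to \<open>P\<close> gives the composite of \<open>\<phi>\<close> and
  \<open>\<gamma>\<close>. By \<open>cls_surj\<close> every morphism between perfect complexes has
  the form required of the first factor.\<close>

lemma dcomp_cls:
  assumes r: "res P p X" and q: "res Q q Y" and Z: "Z \<in> cpx" and \<phi>: "cm P Q \<phi>" and \<gamma>: "cm Q Z \<gamma>"
  shows "dcomp R X Y Z (cls Q q Y Z \<gamma>) (cls P p X Y (q ** \<phi>)) = cls P p X Z (\<gamma> ** \<phi>)"
proof -
  note rr = resD[OF r] and qq = resD[OF q]
  have q\<phi>: "cm P Y (q ** \<phi>)" and \<gamma>\<phi>: "cm P Z (\<gamma> ** \<phi>)"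
    using \<phi> \<gamma> rr qq by (auto intro: cm_comp)
  let ?A = "{roof_class R X Z (Roof W (s ** u) (g ** v)) |W A B s f t g u v.
     Roof A s f \<in> cls P p X Y (q ** \<phi>) \<and> Roof B t g \<in> cls Q q Y Z \<gamma> \<and> W \<in> complexes R \<and>
     quasi_iso R W A u \<and> chain_map R W B v \<and> homotopic R W Y (f ** u) (t ** v)}"
  have "C = cls P p X Z (\<gamma> ** \<phi>)" if "C \<in> ?A" for C
  proof -
    from that obtain W A B s f t g u v where C: "C = roof_class R X Z (Roof W (s ** u) (g ** v))"
      and f: "Roof A s f \<in> cls P p X Y (q ** \<phi>)" and g: "Roof B t g \<in> cls Q q Y Z \<gamma>"
      and W: "W \<in> cpx" and u: "quasi_iso R W A u" and v: "cm W B v"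
      and fu: "hot W Y (f ** u) (t ** v)" by blast
    have fr: "Roof A s f \<in> roofs R X Y" and gr: "Roof B t g \<in> roofs R Y Z"
      using f g roof_class_roofs[OF r qq(3)] roof_class_roofs[OF q Z] by (auto simp: cls_def)
    have A: "A \<in> cpx" "cm A X s" "qis A X s" "cm A Y f" and B: "B \<in> cpx" "cm B Y t" "qis B Y t" "cm B Z g"
      using fr gr roofs_iff[OF rr(3) qq(3)] roofs_iff[OF qq(3) Z] by auto
    have u: "cm W A u" "qis W A u" using u qi_iff[OF W A(1)] by auto
    have su: "cm W X (s ** u)" "qis W X (s ** u)"
      using cm_comp[OF u(1) A(2) W A(1)] qis_comp[OF u(2) A(3) u(1) A(2) W A(1) rr(3)] by auto
    have fu: "hq W Y (f ** u) (t ** v)"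
      using fu W qq(3) cm_comp[OF u(1) A(4) W A(1)] cm_comp[OF v B(2) W B(1)] by (simp add: hq_def)
    obtain l where l: "cm P W l" "hq P X ((s ** u) ** l) p"
      using res_lift[OF r W su] by blast
    have "Roof W (s ** u) (g ** v) \<in> roofs R X Z"
      using W su cm_comp[OF v B(4) W B(1)] rr(3) Z by (simp add: roofs_iff)
    then have C': "C = cls P p X Z ((g ** v) ** l)"
      using roof_class_eq[OF r Z _ l] C by simp
    have ul: "cm P A (u ** l)" using cm_comp[OF l(1) u(1) rr(2) W] .
    have 1: "hq P Y (q ** \<phi>) (f ** u ** l)"
      using mem_cls_iff[OF r qq(3) q\<phi> fr ul] l(2) f by (simp add: chain_comp_assoc)
    obtain b where b: "cm Q B b" "hq Q Y (t ** b) q" using res_lift[OF q B(1-3)] by blast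
    have 2: "hq Q Z \<gamma> (g ** b)" using mem_cls_iff[OF q Z \<gamma> gr b] g by simp
    have b\<phi>: "cm P B (b ** \<phi>)" using cm_comp[OF \<phi> b(1) rr(2) qq(2)] .
    have vl: "cm P B (v ** l)" using cm_comp[OF l(1) v rr(2) W] .
    have "hq P Y (t ** v ** l) (f ** u ** l)"
      using hq_sym[OF hq_pre[OF fu l(1) rr(2)]] by (simp add: chain_comp_assoc)
    also have "hq P Y (f ** u ** l) (q ** \<phi>)" by (rule hq_sym[OF 1])
    also have "hq P Y (q ** \<phi>) (t ** b ** \<phi>)"
      using hq_sym[OF hq_pre[OF b(2) \<phi> rr(2)]] by (simp add: chain_comp_assoc)
    finally have 3: "hq P Y (t ** v ** l) (t ** b ** \<phi>)" .
    \<comment> \<open>Both maps into \<open>B\<close> become homotopic after the quasi-isomorphism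
      \<open>t\<close>, so uniqueness of lifts makes them homotopic already.\<close>
    have 4: "hq P B (v ** l) (b ** \<phi>)"
      using kproj_uniq[OF rr(1) B(1) qq(3) B(2,3) vl b\<phi> hqD(5)[OF 3]] rr(2) B(1) vl b\<phi> by (simp add: hq_def)
    have "hq P Z ((g ** v) ** l) (g ** b ** \<phi>)"
      using hq_post[OF 4 B(4) Z] by (simp add: chain_comp_assoc)
    also have "hq P Z (g ** b ** \<phi>) (\<gamma> ** \<phi>)"
      using hq_sym[OF hq_pre[OF 2 \<phi> rr(2)]] by (simp add: chain_comp_assoc)
    finally have "hq P Z ((g ** v) ** l) (\<gamma> ** \<phi>)" .
    then show ?thesis using C' cls_eq_iff[OF r Z] hqD by blast
  qed
  \<comment> \<open>A completing square exists: take \<open>W\<close> to be \<open>P\<close> with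
    the identity and \<open>\<phi>\<close> as legs.\<close>
  moreover have "cls P p X Z (\<gamma> ** \<phi>) \<in> ?A"
  proof -
    have "cls P p X Z (\<gamma> ** \<phi>) = roof_class R X Z (Roof P (p ** chain_id) (\<gamma> ** \<phi>))"
      by (simp add: cls_def)
    moreover have "quasi_iso R P P chain_id" using rr(2) by (simp add: qi_iff cm_id qis_id)
    moreover have "hot P Y ((q ** \<phi>) ** chain_id) (q ** \<phi>)"
      using hot_refl[OF rr(2) qq(3) q\<phi>] by simp
    ultimately show ?thesis
      using cls_self[OF r qq(3) q\<phi>] cls_self[OF q Z \<gamma>] rr(2) \<phi> by blast
  qed
  ultimately have "\<Union>?A = cls P p X Z (\<gamma> ** \<phi>)" by blast
  then show ?thesis by (simp add: dcomp_def)
qed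

lemma derived_sel: "obj (derived_cat R) = cpx" "homg (derived_cat R) = dhom R"
  "idm (derived_cat R) X = roof_class R X X (Roof X chain_id chain_id)" "cmp (derived_cat R) = dcomp R"
  by (simp_all add: derived_cat_def)

lemma res_perfect:
  assumes "res P p X"
  shows "X \<in> perfect_complexes R"
proof -
  note rr = resD[OF assms]
  have sp: "strictly_perfect P" using assms by (simp add: res_def)
  note i = res_id[OF sp]
  have "isomorphic_in (derived_cat R) X P"
    unfolding isomorphic_in_def derived_sel
  proof (intro bexI conjI)
    show "cls P p X P chain_id \<in> carrier (dhom R X P)"
      using carrier_dhom[OF assms rr(2)] cm_id by blast
    show "cls P chain_id P X p \<in> carrier (dhom R P X)"
      using carrier_dhom[OF i rr(3)] rr(4) by blast
    show "dcomp R X P X (cls P chain_id P X p) (cls P p X P chain_id) = roof_class R X X (Roof X chain_id chain_id)"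
      using dcomp_cls[OF assms i rr(3) cm_id rr(4)] id_dhom[OF assms] by simp
    show "dcomp R P X P (cls P p X P chain_id) (cls P chain_id P X p) = roof_class R P P (Roof P chain_id chain_id)"
      using dcomp_cls[OF i assms rr(2) cm_id cm_id] id_dhom[OF i] by simp
  qed
  then show ?thesis using sp rr(3) by (auto simp: perfect_complexes_def strictly_perfect_def)
qed

text \<open>An inverse \<open>\<beta>\<close> of the given isomorphism starts at \<open>P\<close>,
  so it is represented by a chain map \<open>b\<close>. That \<open>b\<close> is injective on
  cohomology follows from the composite on \<open>P\<close> being the identity, surjectivity from
  the composite on \<open>X\<close>. Neither composite is accessible to \<open>dcomp_cls\<close>,
  since \<open>X\<close> has no resolution yet.\<close>

lemma perfect_res:
  assumes "X \<in> perfect_complexes R"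
  shows "\<exists>P p. res P p X"
proof -
  have X: "X \<in> cpx" using assms by (simp add: perfect_complexes_def)
  obtain P where sp: "strictly_perfect P" and iso: "isomorphic_in (derived_cat R) X P"
    using assms by (auto simp: perfect_complexes_def strictly_perfect_def)
  note i = res_id[OF sp]
  have P: "P \<in> cpx" using resD[OF i] by simp
  obtain \<alpha> \<beta> where \<alpha>: "\<alpha> \<in> carrier (dhom R X P)" and \<beta>: "\<beta> \<in> carrier (dhom R P X)"
    and \<beta>\<alpha>: "dcomp R X P X \<beta> \<alpha> = roof_class R X X (Roof X chain_id chain_id)"
    and \<alpha>\<beta>: "dcomp R P X P \<alpha> \<beta> = roof_class R P P (Roof P chain_id chain_id)"
    using iso by (auto simp: isomorphic_in_def derived_sel)
  obtain b where b: "cm P X b" "\<beta> = cls P chain_id P X b" using \<beta> carrier_dhom[OF i X] by auto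
  have \<alpha>r: "\<And>\<sigma>. \<sigma> \<in> \<alpha> \<Longrightarrow> \<sigma> \<in> roofs R X P"
    using \<alpha> by (auto simp: dhom_def quotient_def roof_rel_def)
  have \<beta>r: "\<And>\<sigma>. \<sigma> \<in> \<beta> \<Longrightarrow> \<sigma> \<in> roofs R P X"
    using \<beta> by (auto simp: dhom_def quotient_def roof_rel_def)
  have inj: "c \<in> coboundaries P n" if c: "c \<in> cocycles P n" "b n c \<in> coboundaries X n" for c n
  proof -
    have ir: "Roof P chain_id chain_id \<in> roofs R P P" using P by (simp add: roofs_iff cm_id qis_id)
    \<comment> \<open>The composite is a union of classes; membership of the identity roof produces
      a concrete completing square.\<close>
    have "Roof P chain_id chain_id \<in> dcomp R P X P \<alpha> \<beta>"
      unfolding \<alpha>\<beta> using cls_self[OF i P cm_id] by (simp add: cls_def)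
    then obtain W A B s f t g u v where f: "Roof A s f \<in> \<beta>" and g: "Roof B t g \<in> \<alpha>" and W: "W \<in> cpx"
      and u: "quasi_iso R W A u" and v: "cm W B v" and fu: "hot W X (f ** u) (t ** v)"
      and rl: "(Roof W (s ** u) (g ** v), Roof P chain_id chain_id) \<in> roof_rel R P P"
      unfolding dcomp_def roof_class_def by blast
    have A: "A \<in> cpx" "cm A P s" "qis A P s" "cm A X f" and B: "B \<in> cpx" "cm B X t" "qis B X t" "cm B P g"
      using \<beta>r[OF f] \<alpha>r[OF g] roofs_iff[OF P X] roofs_iff[OF X P] by auto
    have u: "cm W A u" "qis W A u" using u qi_iff[OF W A(1)] by auto
    have wr: "Roof W (s ** u) (g ** v) \<in> roofs R P P" using rl by (simp add: roof_rel_def)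
    then have su: "cm W P (s ** u)" "qis W P (s ** u)" using roofs_iff[OF P P] by auto
    obtain l where l: "cm P W l" "hq P P ((s ** u) ** l) chain_id"
      using res_lift[OF i W su] by blast
    have 1: "hq P P ((g ** v) ** l) chain_id"
      using roof_rel_iff[OF i P wr ir l cm_id] rl P by (simp add: hq_refl cm_id)
    have ul: "cm P A (u ** l)" using cm_comp[OF l(1) u(1) P W] .
    have 2: "hq P X b (f ** u ** l)"
      using mem_cls_iff[OF i X b(1) \<beta>r[OF f] ul] l(2) f b(2) by (simp add: chain_comp_assoc)
    have fu: "hq W X (f ** u) (t ** v)"
      using fu W X cm_comp[OF u(1) A(4) W A(1)] cm_comp[OF v B(2) W B(1)] by (simp add: hq_def)
    have vl: "cm P B (v ** l)" using cm_comp[OF l(1) v P W] .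
    \<comment> \<open>If \<open>b c\<close> is a coboundary then so is the image of \<open>c\<close>
      under \<open>t ** v ** l\<close>, and as \<open>t\<close> is a quasi-isomorphism, so is its
      image in \<open>B\<close>. Applying \<open>g\<close> leads back to \<open>c\<close> modulo
      coboundaries, by fact \<open>1\<close>.\<close>
    have 3: "hq P X (t ** v ** l) b"
      using hq_trans[OF hq_sym[OF hq_pre[OF fu l(1) P]]] hq_sym[OF 2] by (simp add: chain_comp_assoc)
    have "coh X n (t n ((v ** l) n c)) (b n c)"
      using hot_coh[OF hqD(5,4,1,2)[OF 3] c(1)] by (simp add: chain_comp_def)
    then have "t n ((v ** l) n c) \<in> coboundaries X n" using coh_boundary c(2) X by blast
    then have "(v ** l) n c \<in> coboundaries B n" using qisD1[OF B(3) cm_cocycles[OF vl P B(1) c(1)]] by blast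
    then have "g n ((v ** l) n c) \<in> coboundaries P n" using cm_coboundaries[OF B(4,1) P] by blast
    moreover have "coh P n (chain_id n c) (g n ((v ** l) n c))"
      using hot_coh[OF hqD(5,4,1,2)[OF hq_sym[OF 1]] c(1)] by (simp add: chain_comp_def)
    ultimately show ?thesis using coh_boundary P by (auto simp: chain_id_def)
  qed
  have surj: "\<exists>c\<in>cocycles P n. coh X n x (b n c)" if x: "x \<in> cocycles X n" for x n
  proof -
    \<comment> \<open>The source is now \<open>X\<close>, where \<open>roof_rel_iff\<close> cannot
      be applied, so \<open>roof_rel\<close> is unfolded into a refinement
      \<open>W'\<close>.\<close>
    have "Roof X chain_id chain_id \<in> roof_class R X X (Roof X chain_id chain_id)"
      unfolding roof_class_def roof_rel_def using X
      by (auto simp: roofs_iff qi_iff cm_id qis_id intro!: bexI[of _ X] exI[of _ chain_id] hot_refl)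
    then have "Roof X chain_id chain_id \<in> dcomp R X P X \<beta> \<alpha>" unfolding \<beta>\<alpha> .
    then obtain W A B s f t g u v where f: "Roof A s f \<in> \<alpha>" and g: "Roof B t g \<in> \<beta>" and W: "W \<in> cpx"
      and u: "quasi_iso R W A u" and v: "cm W B v" and fu: "hot W P (f ** u) (t ** v)"
      and rl: "(Roof W (s ** u) (g ** v), Roof X chain_id chain_id) \<in> roof_rel R X X"
      unfolding dcomp_def roof_class_def by blast
    have A: "A \<in> cpx" "cm A X s" and B: "B \<in> cpx" "cm B P t" "qis B P t" "cm B X g"
      using \<alpha>r[OF f] \<beta>r[OF g] roofs_iff[OF P X] roofs_iff[OF X P] by auto
    have u: "cm W A u" using u by (simp add: quasi_iso_def)
    obtain W' u' v' where W': "W' \<in> cpx" "cm W' W u'" "cm W' X v'"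
      "quasi_iso R W' X ((s ** u) ** u')"
      "hot W' X ((s ** u) ** u') v'" "hot W' X ((g ** v) ** u') v'"
      using rl by (auto simp: roof_rel_def)
    have cs: "cm W' X ((s ** u) ** u')" "cm W' X ((g ** v) ** u')"
      using cm_comp[OF W'(2) cm_comp[OF u A(2) W A(1)] W'(1) W] cm_comp[OF W'(2) cm_comp[OF v B(4) W B(1)] W'(1) W] .
    have h: "hq W' X ((s ** u) ** u') ((g ** v) ** u')"
      by (rule hq_trans[of _ _ _ v'], use W' cs X in \<open>simp_all add: hq_def hot_sym\<close>)
    \<comment> \<open>\<open>x\<close> is represented by a cocycle of \<open>W'\<close>, which is
      sent to a cocycle of \<open>B\<close>. The lift \<open>l\<close> of the identity through
      \<open>t\<close> is a quasi-isomorphism, so that cocycle comes from some \<open>c\<close> in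
      \<open>P\<close>; applying \<open>g\<close> shows that \<open>b c\<close> represents
      \<open>x\<close>.\<close>
    obtain w where w: "w \<in> cocycles W' n" "coh X n x (((s ** u) ** u') n w)"
      using qisD2[OF _ x] W'(4) qi_iff[OF W'(1) X] by blast
    have gc: "((g ** v) ** u') n w \<in> carrier (cobj X n)"
      using cm_simps(1)[OF cs(2) W'(1) X] cocycles_carrier[OF w(1)] by blast
    have 1: "coh X n x (g n (v n (u' n w)))"
      using coh_trans[OF w(2) hot_coh[OF hqD(5,4,1,2)[OF h] w(1)] X gc] by (simp add: chain_comp_def)
    have y: "v n (u' n w) \<in> cocycles B n" using cm_cocycles[OF v W B(1) cm_cocycles[OF W'(2,1) W w(1)]] .
    obtain l where l: "cm P B l" "hq P P (t ** l) chain_id" "qis P B l"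
      using res_lift[OF i B(1,2,3)] by blast
    have 2: "hq P X b (g ** l)" using mem_cls_iff[OF i X b(1) \<beta>r[OF g] l(1,2)] g b(2) by simp
    obtain c where c: "c \<in> cocycles P n" "coh B n (v n (u' n w)) (l n c)" using qisD2[OF l(3) y] by blast
    have lc: "l n c \<in> carrier (cobj B n)" "g n (l n c) \<in> carrier (cobj X n)" "b n c \<in> carrier (cobj X n)"
      using cm_simps(1)[OF l(1) P B(1)] cocycles_carrier[OF c(1)] cm_simps(1)[OF B(4,1) X]
        cm_simps(1)[OF b(1) P X] by blast+
    have 3: "coh X n (g n (l n c)) (b n c)"
      using hot_coh[OF hqD(5,4,1,2)[OF hq_sym[OF 2]] c(1)] by (simp add: chain_comp_def)
    have "coh X n x (b n c)"
      using coh_trans[OF coh_trans[OF 1 coh_map[OF c(2) lc(1) B(4,1) X] X lc(2)] 3 X lc(3)] .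
    then show ?thesis using c(1) by blast
  qed
  have "qis P X b" by (rule qisI[OF inj surj])
  then show ?thesis using sp X b(1) by (auto simp: res_def)
qed

section \<open>The category of perfect complexes\<close>

lemma sp_cpx: "strictly_perfect P \<Longrightarrow> P \<in> cpx"
  by (simp add: strictly_perfect_def)

lemma sp_fib:
  assumes P: "strictly_perfect P" and Q: "strictly_perfect Q" and f: "cm P Q f"
  shows "strictly_perfect (fib P Q f)"
proof -
  obtain a b where ab: "\<And>n. n \<notin> {a..b} \<Longrightarrow> carrier (cobj P n) = {\<zero>\<^bsub>cobj P n\<^esub>}"
    using P unfolding strictly_perfect_def by blast
  obtain c d where cd: "\<And>n. n \<notin> {c..d} \<Longrightarrow> carrier (cobj Q n) = {\<zero>\<^bsub>cobj Q n\<^esub>}"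
    using Q unfolding strictly_perfect_def by blast
  \<comment> \<open>The bounds of \<open>Q\<close> move up by one, because degree \<open>n\<close>
    of the fibre contains degree \<open>n - 1\<close> of \<open>Q\<close>.\<close>
  have "carrier (cobj (fib P Q f) n) = {\<zero>\<^bsub>cobj (fib P Q f) n\<^esub>}"
    if "n \<notin> {min a (c + 1)..max b (d + 1)}" for n
  proof -
    have "n \<notin> {a..b}" "n - 1 \<notin> {c..d}" using that by auto
    then show ?thesis using ab cd by (auto simp: fib_sel dsum_simps eq_pr set_eq_iff)
  qed
  then show ?thesis
    unfolding strictly_perfect_def using fib_cpx[OF sp_cpx[OF P] sp_cpx[OF Q] f] P Q
    by (auto simp: strictly_perfect_def fib_sel proj_dsum fg_dsum proj_md)
qed

lemma sp_shift:
  assumes "strictly_perfect P"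
  shows "strictly_perfect (shift i P)"
proof -
  obtain a b where ab: "\<And>n. n \<notin> {a..b} \<Longrightarrow> carrier (cobj P n) = {\<zero>\<^bsub>cobj P n\<^esub>}"
    using assms unfolding strictly_perfect_def by blast
  have "carrier (cobj (shift i P) n) = {\<zero>\<^bsub>cobj (shift i P) n\<^esub>}" if "n \<notin> {a - i..b - i}" for n
    using ab[of "n + i"] that by (auto simp: shift_sel)
  then show ?thesis
    unfolding strictly_perfect_def using shift_cpx[OF sp_cpx[OF assms]] assms
    by (auto simp: strictly_perfect_def shift_sel)
qed

lemma sp_stalk: "strictly_perfect (stalk_ring R)"
proof -
  interpret ring R by (rule R)
  have "stalk_ring R \<in> cpx"
    by (rule cpxI) (auto simp: stalk_ring_def md_regular md_zero intro!: hmI)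
  moreover have "carrier (cobj (stalk_ring R) n) = {\<zero>\<^bsub>cobj (stalk_ring R) n\<^esub>}" if "n \<notin> {0..0}" for n
    using that by (simp add: stalk_ring_def)
  ultimately show ?thesis
    unfolding strictly_perfect_def
    by (auto simp: stalk_ring_def proj_regular proj_zero fg_regular fg_zero)
qed

lemma sp_perfect: "strictly_perfect P \<Longrightarrow> P \<in> perfect_complexes R"
  by (rule res_perfect[OF res_id])

lemma compact_sel: "obj (compact_cat R) = perfect_complexes R" "homg (compact_cat R) = dhom R"
  "idm (compact_cat R) X = roof_class R X X (Roof X chain_id chain_id)" "cmp (compact_cat R) = dcomp R"
  by (simp_all add: compact_cat_def full_subcat_def derived_cat_def)

text \<open>A representative \<open>P -> Y\<close> lifts through \<open>q\<close>, so morphisms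
  between perfect complexes are given by chain maps between their resolutions.\<close>

lemma cls_surj:
  assumes r: "res P p X" and q: "res Q q Y" and "\<alpha> \<in> carrier (dhom R X Y)"
  obtains \<phi> where "cm P Q \<phi>" "\<alpha> = cls P p X Y (q ** \<phi>)"
proof -
  note rr = resD[OF r] and qq = resD[OF q]
  obtain g where g: "cm P Y g" "\<alpha> = cls P p X Y g" using assms carrier_dhom[OF r qq(3)] by auto
  obtain u where u: "cm P Q u" "hot P Y g (q ** u)"
    using kproj_lift[OF rr(1) qq(2,3,4,5) g(1)] by blast
  have c: "cm P Y (q ** u)" using cm_comp[OF u(1) qq(4) rr(2) qq(2)] .
  then have "hq P Y g (q ** u)" using g u rr qq by (simp add: hq_def)
  then show thesis using that[OF u(1)] cls_eq_iff[OF r qq(3) g(1) c] g(2) by simp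
qed

lemma dhom_closed:
  assumes r: "res P p X" and q: "res Q q Y" and "cm P Q \<phi>"
  shows "cls P p X Y (q ** \<phi>) \<in> carrier (dhom R X Y)"
  using carrier_dhom[OF r resD(3)[OF q]] cm_comp[OF assms(3) resD(4)[OF q] resD(2)[OF r] resD(2)[OF q]] by blast

lemma dhom_group:
  assumes r: "res P p X" and Y: "Y \<in> cpx"
  shows "comm_group (dhom R X Y)"
proof -
  note P = resD(2)[OF r]
  note m = mult_dhom[OF r Y] and c = carrier_dhom[OF r Y] and o = one_dhom[OF r Y] and e = cls_eq_iff[OF r Y]
  have eq: "cls P p X Y f = cls P p X Y g"
    if "cm P Y f" "cm P Y g" "\<And>n x. x \<in> carrier (cobj P n) \<Longrightarrow> f n x = g n x" for f g
    using e[OF that(1,2)] hq_eq[OF P Y that] by simp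
  note ac = md_all[OF cpx_md[OF Y]] and cl = cm_simps(1)[OF _ P Y]
  show ?thesis
  proof (rule comm_groupI)
    fix x y assume "x \<in> carrier (dhom R X Y)" "y \<in> carrier (dhom R X Y)"
    then obtain f g where f: "cm P Y f" "x = cls P p X Y f" and g: "cm P Y g" "y = cls P p X Y g"
      unfolding c by blast
    show "x \<otimes>\<^bsub>dhom R X Y\<^esub> y \<in> carrier (dhom R X Y)"
      using m[OF f(1) g(1)] cm_add[OF f(1) g(1) P Y] f g c by blast
    show "x \<otimes>\<^bsub>dhom R X Y\<^esub> y = y \<otimes>\<^bsub>dhom R X Y\<^esub> x"
      using eq[OF cm_add[OF f(1) g(1) P Y] cm_add[OF g(1) f(1) P Y]] cl[OF f(1)] cl[OF g(1)]
      by (simp add: f(2) g(2) m[OF f(1) g(1)] m[OF g(1) f(1)] chain_add_def ac)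
    fix z assume "z \<in> carrier (dhom R X Y)"
    then obtain h where h: "cm P Y h" "z = cls P p X Y h" unfolding c by blast
    note fg = cm_add[OF f(1) g(1) P Y] and gh = cm_add[OF g(1) h(1) P Y]
    show "x \<otimes>\<^bsub>dhom R X Y\<^esub> y \<otimes>\<^bsub>dhom R X Y\<^esub> z = x \<otimes>\<^bsub>dhom R X Y\<^esub> (y \<otimes>\<^bsub>dhom R X Y\<^esub> z)"
      unfolding f(2) g(2) h(2) m[OF f(1) g(1)] m[OF g(1) h(1)] m[OF fg h(1)] m[OF f(1) gh]
      by (rule eq[OF cm_add[OF fg h(1) P Y] cm_add[OF f(1) gh P Y]])
        (simp add: chain_add_def ac cl[OF f(1)] cl[OF g(1)] cl[OF h(1)])
  next
    show "\<one>\<^bsub>dhom R X Y\<^esub> \<in> carrier (dhom R X Y)" using c o cm_zero[OF P Y] by blast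
  next
    fix x assume "x \<in> carrier (dhom R X Y)"
    then obtain f where f: "cm P Y f" "x = cls P p X Y f" unfolding c by blast
    note z = cm_zero[OF P Y] and n = cm_neg[OF f(1) P Y]
    show "\<one>\<^bsub>dhom R X Y\<^esub> \<otimes>\<^bsub>dhom R X Y\<^esub> x = x"
      unfolding f(2) o m[OF z f(1)]
      by (rule eq[OF cm_add[OF z f(1) P Y] f(1)]) (simp add: chain_add_def chain_zero_def ac cl[OF f(1)])
    have "cls P p X Y (chain_neg Y f) \<otimes>\<^bsub>dhom R X Y\<^esub> x = \<one>\<^bsub>dhom R X Y\<^esub>"
      unfolding f(2) o m[OF n f(1)]
      by (rule eq[OF cm_add[OF n f(1) P Y] z])
        (simp add: chain_add_def chain_neg_def chain_zero_def ac cl[OF f(1)])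
    then show "\<exists>y\<in>carrier (dhom R X Y). y \<otimes>\<^bsub>dhom R X Y\<^esub> x = \<one>\<^bsub>dhom R X Y\<^esub>" using c n by blast
  qed
qed

text \<open>Once resolutions are chosen, composition and addition become those of chain maps, where
  the laws hold on carriers.\<close>

lemma preadditive_compact: "preadditive (compact_cat R)"
proof (rule preadditive.intro; unfold compact_sel)
  fix X Y assume X: "X \<in> perfect_complexes R" and Y: "Y \<in> perfect_complexes R"
  obtain P p where r: "res P p X" using perfect_res[OF X] by blast
  obtain Q q where q: "res Q q Y" using perfect_res[OF Y] by blast
  note rr = resD[OF r] and qq = resD[OF q]
  show "comm_group (dhom R X Y)" using dhom_group[OF r qq(3)] .
  { fix f assume f: "f \<in> carrier (dhom R X Y)"
    obtain \<phi> where \<phi>: "cm P Q \<phi>" "f = cls P p X Y (q ** \<phi>)" using cls_surj[OF r q f] .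
    show "dcomp R X Y Y (roof_class R Y Y (Roof Y chain_id chain_id)) f = f"
      using dcomp_cls[OF r q qq(3) \<phi>(1) qq(4)] id_dhom[OF q] \<phi>(2) by simp
    show "dcomp R X X Y f (roof_class R X X (Roof X chain_id chain_id)) = f"
      using dcomp_cls[OF r r qq(3) cm_id cm_comp[OF \<phi>(1) qq(4) rr(2) qq(2)]] id_dhom[OF r] \<phi>(2) by simp }
  fix Z assume Z: "Z \<in> perfect_complexes R"
  obtain S s where s: "res S s Z" using perfect_res[OF Z] by blast
  note ss = resD[OF s]
  { fix f g assume f: "f \<in> carrier (dhom R X Y)" and g: "g \<in> carrier (dhom R Y Z)"
    obtain \<phi> where \<phi>: "cm P Q \<phi>" "f = cls P p X Y (q ** \<phi>)" using cls_surj[OF r q f] .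
    obtain \<psi> where \<psi>: "cm Q S \<psi>" "g = cls Q q Y Z (s ** \<psi>)" using cls_surj[OF q s g] .
    have s\<psi>: "cm Q Z (s ** \<psi>)" using cm_comp[OF \<psi>(1) ss(4) qq(2) ss(2)] .
    have \<psi>\<phi>: "cm P S (\<psi> ** \<phi>)" using cm_comp[OF \<phi>(1) \<psi>(1) rr(2) qq(2)] .
    have gf: "dcomp R X Y Z g f = cls P p X Z (s ** \<psi> ** \<phi>)"
      using dcomp_cls[OF r q ss(3) \<phi>(1) s\<psi>] \<phi> \<psi> by (simp add: chain_comp_assoc)
    show "dcomp R X Y Z g f \<in> carrier (dhom R X Z)" unfolding gf by (rule dhom_closed[OF r s \<psi>\<phi>])
    { fix W h assume W: "W \<in> perfect_complexes R" and h: "h \<in> carrier (dhom R Z W)"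
      have Wc: "W \<in> cpx" using W by (simp add: perfect_complexes_def)
      obtain \<gamma> where \<gamma>: "cm S W \<gamma>" "h = cls S s Z W \<gamma>" using h carrier_dhom[OF s Wc] by auto
      show "dcomp R X Z W h (dcomp R X Y Z g f) = dcomp R X Y W (dcomp R Y Z W h g) f"
        using dcomp_cls[OF r s Wc \<psi>\<phi> \<gamma>(1)] dcomp_cls[OF q s Wc \<psi>(1) \<gamma>(1)]
          dcomp_cls[OF r q Wc \<phi>(1) cm_comp[OF \<psi>(1) \<gamma>(1) qq(2) ss(2)]] gf \<gamma> \<psi> \<phi>
        by (simp add: chain_comp_assoc) }
    { fix h assume h: "h \<in> carrier (dhom R Y Z)"
      obtain \<gamma> where \<gamma>: "cm Q Z \<gamma>" "h = cls Q q Y Z \<gamma>" using h carrier_dhom[OF q ss(3)] by auto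
      have a: "(chain_add Z (s ** \<psi>) \<gamma>) ** \<phi> =
          chain_add Z ((s ** \<psi>) ** \<phi>) (\<gamma> ** \<phi>)"
        by (simp add: chain_comp_def chain_add_def)
      show "dcomp R X Y Z (g \<otimes>\<^bsub>dhom R Y Z\<^esub> h) f = dcomp R X Y Z g f \<otimes>\<^bsub>dhom R X Z\<^esub> dcomp R X Y Z h f"
        using dcomp_cls[OF r q ss(3) \<phi>(1) cm_add[OF s\<psi> \<gamma>(1) qq(2) ss(3)]]
          dcomp_cls[OF r q ss(3) \<phi>(1) s\<psi>] dcomp_cls[OF r q ss(3) \<phi>(1) \<gamma>(1)]
          mult_dhom[OF q ss(3) s\<psi> \<gamma>(1)]
          mult_dhom[OF r ss(3) cm_comp[OF \<phi>(1) s\<psi> rr(2) qq(2)] cm_comp[OF \<phi>(1) \<gamma>(1) rr(2) qq(2)]]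
          \<phi>(2) \<psi>(2) \<gamma>(2) a by simp }
    { fix f' assume f': "f' \<in> carrier (dhom R X Y)"
      obtain \<phi>' where \<phi>': "cm P Q \<phi>'" "f' = cls P p X Y (q ** \<phi>')" using cls_surj[OF r q f'] .
      let ?\<gamma> = "s ** \<psi>"
      have c: "cm P Y (q ** \<phi>)" "cm P Y (q ** \<phi>')" "cm P Q (chain_add Q \<phi> \<phi>')"
        "cm P Z (?\<gamma> ** \<phi>)" "cm P Z (?\<gamma> ** \<phi>')"
        using cm_comp[OF _ qq(4) rr(2) qq(2)] cm_comp[OF _ s\<psi> rr(2) qq(2)] \<phi>(1) \<phi>'(1)
          cm_add[OF \<phi>(1) \<phi>'(1) rr(2) qq(2)] by blast+
      \<comment> \<open>Distributing over a sum of maps that are applied first uses additivity of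
        \<open>q\<close> and \<open>?\<gamma>\<close>. This holds on carriers only, hence
        \<open>hq_eq\<close> instead of an equality of functions.\<close>
      have "hq P Y (chain_add Y (q ** \<phi>) (q ** \<phi>')) (q ** (chain_add Q \<phi> \<phi>'))"
        using cm_simps[OF \<phi>(1) rr(2) qq(2)] cm_simps[OF \<phi>'(1) rr(2) qq(2)] cm_simps[OF qq(4,2,3)]
        by (intro hq_eq rr qq cm_add c cm_comp[OF c(3) qq(4)]) (simp add: chain_comp_def chain_add_def)
      then have 1: "f \<otimes>\<^bsub>dhom R X Y\<^esub> f' = cls P p X Y (q ** (chain_add Q \<phi> \<phi>'))"
        using mult_dhom[OF r qq(3) c(1,2)] \<phi>(2) \<phi>'(2) cls_eq_iff[OF r qq(3)] hqD by metis
      have "hq P Z (?\<gamma> ** (chain_add Q \<phi> \<phi>')) (chain_add Z (?\<gamma> ** \<phi>) (?\<gamma> ** \<phi>'))"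
        using cm_simps[OF \<phi>(1) rr(2) qq(2)] cm_simps[OF \<phi>'(1) rr(2) qq(2)] cm_simps[OF s\<psi> qq(2) ss(3)]
        by (intro hq_eq rr ss cm_add c cm_comp[OF c(3) s\<psi> rr(2) qq(2)]) (simp add: chain_comp_def chain_add_def)
      then have 2: "cls P p X Z (?\<gamma> ** (chain_add Q \<phi> \<phi>')) =
          cls P p X Z (?\<gamma> ** \<phi>) \<otimes>\<^bsub>dhom R X Z\<^esub> cls P p X Z (?\<gamma> ** \<phi>')"
        using mult_dhom[OF r ss(3) c(4,5)] cls_eq_iff[OF r ss(3)] hqD by metis
      show "dcomp R X Y Z g (f \<otimes>\<^bsub>dhom R X Y\<^esub> f') = dcomp R X Y Z g f \<otimes>\<^bsub>dhom R X Z\<^esub> dcomp R X Y Z g f'"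
        using 1 2 dcomp_cls[OF r q ss(3) c(3) s\<psi>] dcomp_cls[OF r q ss(3) \<phi>(1) s\<psi>]
          dcomp_cls[OF r q ss(3) \<phi>'(1) s\<psi>] \<phi>(2) \<phi>'(2) \<psi>(2) by simp } }
next
  fix X assume X: "X \<in> perfect_complexes R"
  obtain P p where r: "res P p X" using perfect_res[OF X] by blast
  show "roof_class R X X (Roof X chain_id chain_id) \<in> carrier (dhom R X X)"
    using id_dhom[OF r] carrier_dhom[OF r resD(3)[OF r]] resD(4)[OF r] by auto
qed

text \<open>Composition with the quasi-isomorphism \<open>q\<close> reflects null homotopies of maps
  out of \<open>P\<close>, by uniqueness of lifts.\<close>

lemma dcomp_one_iff:
  assumes r: "res P p X" and q: "res Q q Y" and \<phi>: "cm P Q \<phi>"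
  shows "cls P p X Y (q ** \<phi>) = \<one>\<^bsub>dhom R X Y\<^esub> \<longleftrightarrow> hq P Q \<phi> (chain_zero Q)"
proof -
  note rr = resD[OF r] and qq = resD[OF q]
  have c: "cm P Y (q ** \<phi>)" using cm_comp[OF \<phi> qq(4) rr(2) qq(2)] .
  have z: "hq P Y (q ** (chain_zero Q)) (chain_zero Y)"
    using cm_simps(3)[OF qq(4,2,3)]
    by (intro hq_eq cm_comp[OF cm_zero qq(4)] cm_zero rr qq) (simp add: chain_comp_def chain_zero_def)
  have "hq P Q \<phi> (chain_zero Q) \<longleftrightarrow> hq P Y (q ** \<phi>) (q ** (chain_zero Q))"
    using kproj_uniq[OF rr(1) qq(2,3,4,5) \<phi> cm_zero[OF rr(2) qq(2)]] hq_post[OF _ qq(4,3), of P \<phi> "chain_zero Q"]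
      rr qq \<phi> cm_zero[OF rr(2) qq(2)] by (auto simp: hq_def)
  also have "\<dots> \<longleftrightarrow> hq P Y (q ** \<phi>) (chain_zero Y)"
    using z hq_trans hq_sym by blast
  also have "\<dots> \<longleftrightarrow> cls P p X Y (q ** \<phi>) = \<one>\<^bsub>dhom R X Y\<^esub>"
    using cls_eq_iff[OF r qq(3) c cm_zero[OF rr(2) qq(3)]] one_dhom[OF r qq(3)] by simp
  finally show ?thesis by simp
qed

text \<open>A morphism killed by \<open>f\<close> is, on resolutions, a chain map together with a
  null homotopy of its composite with \<open>\<phi>\<close>, and this is the same as a chain map
  into the fibre.\<close>

lemma fibre_exact:
  assumes X: "X \<in> perfect_complexes R" and Y: "Y \<in> perfect_complexes R" and f: "f \<in> carrier (dhom R X Y)"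
  shows "\<exists>A\<in>perfect_complexes R. \<exists>g\<in>carrier (dhom R A X). preadditive.exact_at (compact_cat R) A X Y g f"
proof -
  interpret preadditive "compact_cat R" by (rule preadditive_compact)
  obtain P p where r: "res P p X" using perfect_res[OF X] by blast
  obtain Q q where q: "res Q q Y" using perfect_res[OF Y] by blast
  note rr = resD[OF r] and qq = resD[OF q]
  obtain \<phi> where \<phi>: "cm P Q \<phi>" "f = cls P p X Y (q ** \<phi>)" using cls_surj[OF r q f] .
  let ?A = "fib P Q \<phi>" and ?\<pi> = "\<lambda>n z. p1 z"
  have A: "strictly_perfect ?A" using sp_fib[OF _ _ \<phi>(1)] r q by (simp add: res_def)
  note i = res_id[OF A]
  note Ac = sp_cpx[OF A]
  have \<pi>: "cm ?A P ?\<pi>" by (rule cmI) (simp_all add: fib_sel hm_p1)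
  let ?g = "cls ?A chain_id ?A X (p ** ?\<pi>)"
  have g: "?g \<in> carrier (dhom R ?A X)" by (rule dhom_closed[OF i r \<pi>])
  note S = cm_simps[OF \<phi>(1) rr(2) qq(2)] cpx_simps[OF rr(2)] cpx_simps[OF qq(2)]
    md_all[OF cpx_md[OF rr(2)]] md_all[OF cpx_md[OF qq(2)]]
  have \<phi>\<pi>: "cm ?A Q (\<phi> ** ?\<pi>)" using cm_comp[OF \<pi> \<phi>(1) Ac rr(2)] .
  have "hot ?A Q (\<phi> ** ?\<pi>) (chain_zero Q)"
  proof (rule hotI)
    \<comment> \<open>The second projection is the tautological null homotopy on the fibre.\<close>
    show "p2 \<in> hm (cobj ?A n) (cobj Q (n - 1))" for n unfolding fib_sel by (rule hm_p2)
  qed (simp add: chain_comp_def chain_zero_def fib_sel dsum_simps S)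
  then have n: "hq ?A Q (\<phi> ** ?\<pi>) (chain_zero Q)"
    using \<phi>\<pi> Ac qq(2) cm_zero by (simp add: hq_def)
  have comp: "dcomp R Z X Y f (cls S s Z X (p ** \<beta>)) = cls S s Z Y (q ** \<phi> ** \<beta>)"
    if "res S s Z" "cm S P \<beta>" for Z S s \<beta>
    using dcomp_cls[OF that(1) r qq(3) that(2) cm_comp[OF \<phi>(1) qq(4) rr(2) qq(2)]] \<phi>(2)
    by (simp add: chain_comp_assoc)
  have "exact_at ?A X Y ?g f"
    unfolding exact_at_def compact_sel
  proof (intro conjI ballI impI)
    show "dcomp R ?A X Y f ?g = \<one>\<^bsub>dhom R ?A Y\<^esub>"
      using comp[OF i \<pi>] dcomp_one_iff[OF i q \<phi>\<pi>] n by simp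
    fix Z b assume Z: "Z \<in> perfect_complexes R" and b: "b \<in> carrier (dhom R Z X)"
      and fb: "dcomp R Z X Y f b = \<one>\<^bsub>dhom R Z Y\<^esub>"
    obtain S s where s: "res S s Z" using perfect_res[OF Z] by blast
    note ss = resD[OF s]
    obtain \<beta> where \<beta>: "cm S P \<beta>" "b = cls S s Z X (p ** \<beta>)" using cls_surj[OF s r b] .
    have "hq S Q (\<phi> ** \<beta>) (chain_zero Q)"
      using comp[OF s \<beta>(1)] fb \<beta>(2) dcomp_one_iff[OF s q cm_comp[OF \<beta>(1) \<phi>(1) ss(2) rr(2)]] by simp
    then have "hot S Q (\<phi> ** \<beta>) (chain_zero Q)" by (rule hqD)
    then obtain h where t: "htpy S Q (\<phi> ** \<beta>) (chain_zero Q) h"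
      by (rule hotE)
    note h = htpyD(1)[OF t] and e = htpyD(2)[OF t]
    note hs = deg_simps[OF h ss(2) qq(2)] and \<beta>s = cm_simps[OF \<beta>(1) ss(2) rr(2)] and Ss = cpx_simps[OF ss(2)]
    \<comment> \<open>The factorization: \<open>\<beta>\<close> paired with the null
      homotopy.\<close>
    let ?\<gamma> = "\<lambda>n x. pr (\<beta> n x) (h n x)"
    have e': "\<phi> n (\<beta> n x) = cdiff Q (n - 1) (h n x) \<oplus>\<^bsub>cobj Q n\<^esub> h (n + 1) (cdiff S n x)"
      if "x \<in> carrier (cobj S n)" for n x
      using e[OF that] that by (simp add: chain_comp_def chain_zero_def S hs \<beta>s Ss)
    have \<gamma>: "cm S ?A ?\<gamma>"
    proof (rule cmI)
      show "?\<gamma> n \<in> hm (cobj S n) (cobj ?A n)" for n unfolding fib_sel by (rule hm_pr[OF cm_hm[OF \<beta>(1)] h])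
    qed (simp add: fib_sel pr_eq \<beta>s hs Ss S e')
    have "dcomp R Z ?A X ?g (cls S s Z ?A ?\<gamma>) = b"
      using dcomp_cls[OF s i rr(3) \<gamma> cm_comp[OF \<pi> rr(4) Ac rr(2)]] \<beta>(2)
      by (simp add: chain_comp_assoc) (simp add: chain_comp_def)
    moreover have "cls S s Z ?A ?\<gamma> \<in> carrier (dhom R Z ?A)" using carrier_dhom[OF s Ac] \<gamma> by blast
    ultimately show "\<exists>c\<in>carrier (dhom R Z ?A). dcomp R Z ?A X ?g c = b" by blast
  qed
  then show ?thesis using g sp_perfect[OF A] by blast
qed

text \<open>A morphism killed by the map into the cone is null homotopic there on resolutions, and
  \<open>cone_null\<close> turns the null homotopy into a factorization through
  \<open>\<phi>\<close>.\<close>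

lemma cone_exact:
  assumes X: "X \<in> perfect_complexes R" and Y: "Y \<in> perfect_complexes R" and f: "f \<in> carrier (dhom R X Y)"
  shows "\<exists>N\<in>perfect_complexes R. \<exists>h\<in>carrier (dhom R Y N). preadditive.exact_at (compact_cat R) X Y N f h"
proof -
  interpret preadditive "compact_cat R" by (rule preadditive_compact)
  obtain P p where r: "res P p X" using perfect_res[OF X] by blast
  obtain Q q where q: "res Q q Y" using perfect_res[OF Y] by blast
  note rr = resD[OF r] and qq = resD[OF q]
  obtain \<phi> where \<phi>: "cm P Q \<phi>" "f = cls P p X Y (q ** \<phi>)" using cls_surj[OF r q f] .
  let ?N = "shift 1 (fib P Q \<phi>)" and ?i = "\<lambda>n x. pr \<zero>\<^bsub>cobj P (n + 1)\<^esub> x"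
  have N: "strictly_perfect ?N" using sp_shift[OF sp_fib[OF _ _ \<phi>(1)]] r q by (simp add: res_def)
  note j = res_id[OF N] and Nc = sp_cpx[OF N]
  have i: "cm Q ?N ?i"
    using cone_incl[OF qq(2) rr(2) qq(2) \<phi>(1) cm_id] by (simp add: chain_id_def)
  let ?h = "cls Q q Y ?N ?i"
  have h: "?h \<in> carrier (dhom R Y ?N)" using carrier_dhom[OF q Nc] i by blast
  note S = cm_simps[OF \<phi>(1) rr(2) qq(2)] cpx_simps[OF rr(2)] cpx_simps[OF qq(2)]
    md_all[OF cpx_md[OF rr(2)]] md_all[OF cpx_md[OF qq(2)]]
  have comp: "dcomp R Z Y ?N ?h (cls S s Z Y (q ** \<beta>)) = cls S s Z ?N (?i ** \<beta>)"
    if "res S s Z" "cm S Q \<beta>" for Z S s \<beta>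
    using dcomp_cls[OF that(1) q Nc that(2) i] .
  have one: "cls S s Z ?N (?i ** \<beta>) = \<one>\<^bsub>dhom R Z ?N\<^esub> \<longleftrightarrow> hq S ?N (?i ** \<beta>) (chain_zero ?N)"
    if "res S s Z" "cm S Q \<beta>" for Z S s \<beta>
    using dcomp_one_iff[OF that(1) j cm_comp[OF that(2) i resD(2)[OF that(1)] qq(2)]] by simp
  have "hot P ?N (?i ** \<phi>) (chain_zero ?N)"
  proof (rule hotI)
    \<comment> \<open>The homotopy sends \<open>x\<close> to \<open>(-x, 0)\<close>. Its
      differential in the cone is \<open>(d x, \<phi> x)\<close>, and the other term of the homotopy
      identity removes \<open>d x\<close>.\<close>
    show "(\<lambda>x. pr (\<ominus>\<^bsub>cobj P n\<^esub> x) \<zero>\<^bsub>cobj Q (n - 1)\<^esub>) \<in> hm (cobj P n) (cobj ?N (n - 1))" for n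
      using hm_pr[OF hm_neg[OF hm_id cpx_md[OF rr(2)] cpx_md[OF rr(2)]] hm_zero[OF cpx_md[OF qq(2)]]]
      by (simp add: shift_sel fib_sel)
    fix n x assume x: "x \<in> carrier (cobj P n)"
    have d: "cdiff ?N (n - 1) (pr (\<ominus>\<^bsub>cobj P n\<^esub> x) \<zero>\<^bsub>cobj Q (n - 1)\<^esub>) = pr (cdiff P n x) (\<phi> n x)"
      using x cone_diff[OF rr(2) qq(2) \<phi>(1), of "pr (\<ominus>\<^bsub>cobj P n\<^esub> x) \<zero>\<^bsub>cobj Q (n - 1)\<^esub>" "n - 1"]
      by (simp add: S index_simps)
    show "(?i ** \<phi>) n x = chain_zero ?N n x \<oplus>\<^bsub>cobj ?N n\<^esub>
      (cdiff ?N (n - 1) (pr (\<ominus>\<^bsub>cobj P n\<^esub> x) \<zero>\<^bsub>cobj Q (n - 1)\<^esub>) \<oplus>\<^bsub>cobj ?N n\<^esub>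
       pr (\<ominus>\<^bsub>cobj P (n + 1)\<^esub> cdiff P n x) \<zero>\<^bsub>cobj Q (n + 1 - 1)\<^esub>)"
      unfolding d using x by (simp add: chain_comp_def chain_zero_def shift_sel fib_sel dsum_simps pr_eq S)
  qed
  then have n: "hq P ?N (?i ** \<phi>) (chain_zero ?N)"
    using cm_comp[OF \<phi>(1) i rr(2) qq(2)] Nc rr(2) cm_zero by (simp add: hq_def)
  have "exact_at X Y ?N f ?h"
    unfolding exact_at_def compact_sel
  proof (intro conjI ballI impI)
    show "dcomp R X Y ?N ?h f = \<one>\<^bsub>dhom R X ?N\<^esub>"
      using comp[OF r \<phi>(1)] one[OF r \<phi>(1)] n \<phi>(2) by simp
    fix Z b assume Z: "Z \<in> perfect_complexes R" and b: "b \<in> carrier (dhom R Z Y)"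
      and hb: "dcomp R Z Y ?N ?h b = \<one>\<^bsub>dhom R Z ?N\<^esub>"
    obtain S s where s: "res S s Z" using perfect_res[OF Z] by blast
    note ss = resD[OF s]
    obtain \<beta> where \<beta>: "cm S Q \<beta>" "b = cls S s Z Y (q ** \<beta>)" using cls_surj[OF s q b] .
    have "hot S ?N (?i ** \<beta>) (chain_zero ?N)"
      using comp[OF s \<beta>(1)] one[OF s \<beta>(1)] hb \<beta>(2) hqD(5) by simp
    then obtain u where u: "cm S P u" "hot S Q \<beta> (\<phi> ** u)"
      using cone_null[OF ss(2) rr(2) qq(2) \<phi>(1) \<beta>(1)] by (auto simp: chain_comp_def)
    have "hq S Q \<beta> (\<phi> ** u)"
      using u \<beta>(1) ss qq cm_comp[OF u(1) \<phi>(1) ss(2) rr(2)] by (simp add: hq_def)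
    then have "hq S Y (q ** \<beta>) ((q ** \<phi>) ** u)"
      using hq_post[OF _ qq(4,3)] by (simp add: chain_comp_assoc)
    then have "b = cls S s Z Y ((q ** \<phi>) ** u)"
      using cls_eq_iff[OF s qq(3)] hqD \<beta>(2) by metis
    then have "dcomp R Z X Y f (cls S s Z X (p ** u)) = b"
      using dcomp_cls[OF s r qq(3) u(1) cm_comp[OF \<phi>(1) qq(4) rr(2) qq(2)]] \<phi>(2) by simp
    then show "\<exists>c\<in>carrier (dhom R Z X). dcomp R Z X Y f c = b" using dhom_closed[OF s r u(1)] by blast
  qed
  then show ?thesis using h sp_perfect[OF N] by blast
qed

lemma stalk_perfect: "shift i (stalk_ring R) \<in> perfect_complexes R"
  by (rule sp_perfect[OF sp_shift[OF sp_stalk]])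

text \<open>Cones give the forward direction and fibres the backward one. The injection ensures that
  \<open>'b\<close> is large enough for the image functor of a ghost.\<close>

theorem generating_hypothesis_iff_ghost_functors:
  fixes \<iota> :: "'u dmor \<Rightarrow> 'b"
  assumes \<iota>: "inj \<iota>"
  shows "generating_hypothesis R \<longleftrightarrow> ghost_functors R \<inter> mod_cat (compact_cat R) =
    (zero_functors (compact_cat R) :: ('u cpx, 'u dmor, 'b) cfun set)"
proof
  interpret preadditive "compact_cat R" by (rule preadditive_compact)
  let ?T = "\<lambda>i. shift i (stalk_ring R)"
  note T = stalk_perfect[folded compact_sel(1)]
  {
    assume gh: "generating_hypothesis R"
    have "F \<in> zero_functors (compact_cat R)" if F: "F \<in> ghost_functors R" "F \<in> mod_cat (compact_cat R)"
      for F :: "('u cpx, 'u dmor, 'b) cfun"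
    proof (rule ghost_mod_is_zero[where T = ?T, OF T _ _ F(2)])
      show "carrier (fobj F (?T i)) = {\<one>\<^bsub>fobj F (?T i)\<^esub>}" for i using F(1) by (simp add: ghost_functors_def)
    qed (use gh cone_exact in \<open>auto simp: generating_hypothesis_def compact_sel\<close>)
    moreover have "F \<in> ghost_functors R \<inter> mod_cat (compact_cat R)" if F: "F \<in> zero_functors (compact_cat R)"
      for F :: "('u cpx, 'u dmor, 'b) cfun"
      using zero_functors_mod[OF T[of 0] F] F T by (auto simp: zero_functors_def ghost_functors_def)
    ultimately show "ghost_functors R \<inter> mod_cat (compact_cat R) =
      (zero_functors (compact_cat R) :: ('u cpx, 'u dmor, 'b) cfun set)" by blast
  }
  assume z: "ghost_functors R \<inter> mod_cat (compact_cat R) =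
      (zero_functors (compact_cat R) :: ('u cpx, 'u dmor, 'b) cfun set)"
  show "generating_hypothesis R"
    unfolding generating_hypothesis_def
  proof (intro ballI impI)
    fix X Y f assume XY: "X \<in> perfect_complexes R" "Y \<in> perfect_complexes R" "f \<in> carrier (dhom R X Y)"
      and g: "\<forall>i. \<forall>x\<in>carrier (dhom R (?T i) X). dcomp R (?T i) X Y f x = \<one>\<^bsub>dhom R (?T i) Y\<^esub>"
    obtain A h where A: "A \<in> perfect_complexes R" "h \<in> carrier (dhom R A X)" "exact_at A X Y h f"
      using fibre_exact[OF XY] by blast
    show "f = \<one>\<^bsub>dhom R X Y\<^esub>"
    proof (rule ghost_is_zero[where T = ?T, OF \<iota> T, unfolded compact_sel, OF _ XY A])
      fix F :: "('u cpx, 'u dmor, 'b) cfun"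
      assume "F \<in> mod_cat (compact_cat R)" "\<And>i. carrier (fobj F (?T i)) = {\<one>\<^bsub>fobj F (?T i)\<^esub>}"
      then have "F \<in> ghost_functors R \<inter> mod_cat (compact_cat R)"
        by (simp add: ghost_functors_def mod_cat_def)
      then show "F \<in> zero_functors (compact_cat R)" using z by blast
    qed (use g in blast)
  qed
qed

section \<open>Maps out of the shifts of \<open>R\<close>\<close>

abbreviation "stalk i \<equiv> shift i (stalk_ring R)"

lemma cobj_shift_stalk:
  "cobj (stalk i) n = (if n = - i then regular_rmod R else zero_rmod R)"
  by (auto simp: shift_def stalk_ring_def)

lemma cdiff_shift_stalk: "cdiff (stalk i) n x = \<zero>"
proof -
  have "\<ominus>\<^bsub>cobj (stalk_ring R) m\<^esub> \<zero> = \<zero>" for m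
    using md_minus_zero[OF md_regular] md_minus_zero[OF md_zero] by (simp add: stalk_ring_def)
  moreover have "cdiff (stalk_ring R) m x = \<zero>" for m by (simp add: stalk_ring_def)
  ultimately show ?thesis by (simp add: shift_sel)
qed

lemmas shift_stalk_res = res_id[OF sp_shift[OF sp_stalk]]
lemmas shift_stalk_cpx = sp_cpx[OF sp_shift[OF sp_stalk]]

lemma one_cocycle: "\<one> \<in> cocycles (stalk i) (- i)"
proof -
  interpret ring R by (rule R)
  show ?thesis by (simp add: cocycles_def cobj_shift_stalk cdiff_shift_stalk)
qed

text \<open>\<open>N\<close> is an arbitrary family of modules, so that it can be the modules of a
  complex for chain maps, or the modules one degree lower for homotopies.\<close>

lemma stalk_scale_hm:
  assumes "\<And>n. md (N n)" "c \<in> carrier (N (- i))"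
  shows "(\<lambda>r. if n = - i then c \<cdot>\<^bsub>N n\<^esub> r else \<zero>\<^bsub>N n\<^esub>) \<in> hm (cobj (stalk i) n) (N n)"
  using smult_hom[OF assms] hm_zero[OF assms(1)] by (cases "n = - i") (simp_all add: cobj_shift_stalk)

text \<open>The shift by \<open>i\<close> has \<open>R\<close> in degree \<open>-i\<close>, and a
  map out of it is determined by the value at one. With the next lemma this identifies homotopy
  classes of such maps with cohomology in degree \<open>-i\<close>.\<close>

lemma stalk_map_of_cocycle:
  assumes P: "P \<in> cpx" and c: "c \<in> cocycles P (- i)"
  obtains \<xi> where "cm (stalk i) P \<xi>" "\<xi> (- i) \<one> = c"
proof
  note m = cpx_md[OF P]
  have c': "c \<in> carrier (cobj P (- i))" "cdiff P (- i) c = \<zero>\<^bsub>cobj P (- i + 1)\<^esub>"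
    using c by (auto simp: cocycles_def)
  let ?\<xi> = "\<lambda>n r. if n = - i then c \<cdot>\<^bsub>cobj P n\<^esub> r else \<zero>\<^bsub>cobj P n\<^esub>"
  note h = stalk_scale_hm[of "cobj P", OF m c'(1)]
  show "cm (stalk i) P ?\<xi>"
  proof (rule cmI[OF h])
    fix n r assume r: "r \<in> carrier (cobj (stalk i) n)"
    have "?\<xi> (n + 1) (cdiff (stalk i) n r) = \<zero>\<^bsub>cobj P (n + 1)\<^esub>"
      using hm_simps(3)[OF h cpx_md[OF shift_stalk_cpx] m, of "n + 1"]
      by (simp add: cobj_shift_stalk cdiff_shift_stalk split: if_splits)
    moreover have "cdiff P n (?\<xi> n r) = \<zero>\<^bsub>cobj P (n + 1)\<^esub>"
      using r c' cpx_simps(4)[OF P, of n] cpx_simps(6)[OF P c'(1), of r] md_zero_smult[OF m, of r "n + 1"]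
      by (auto simp: cobj_shift_stalk split: if_splits)
    ultimately show "?\<xi> (n + 1) (cdiff (stalk i) n r) = cdiff P n (?\<xi> n r)" by simp
  qed
  show "?\<xi> (- i) \<one> = c" using c'(1) by (simp add: md_simps[OF m])
qed

text \<open>A preimage \<open>y\<close> of the value at one under the differential gives the
  homotopy \<open>r \<mapsto> y r\<close>; conversely, homotopic maps agree on cocycles modulo
  coboundaries.\<close>

lemma stalk_map_null_iff:
  assumes Q: "Q \<in> cpx" and \<xi>: "cm (stalk i) Q \<xi>"
  shows "hq (stalk i) Q \<xi> (chain_zero Q) \<longleftrightarrow> \<xi> (- i) \<one> \<in> coboundaries Q (- i)"
proof
  interpret ring R by (rule R)
  note T = shift_stalk_cpx[of i]
  note Qm = md_simps[OF cpx_md[OF Q]] and \<xi>s = cm_simps[OF \<xi> T Q]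
  {
    assume h: "hq (stalk i) Q \<xi> (chain_zero Q)"
    have "coh Q (- i) (\<xi> (- i) \<one>) (\<zero>\<^bsub>cobj Q (- i)\<^esub>)"
      using hot_coh[OF hqD(5,4,1,2)[OF h] one_cocycle] by (simp add: chain_zero_def)
    then show "\<xi> (- i) \<one> \<in> coboundaries Q (- i)" using coh_boundary coboundaries_closed(3) Q by blast
  }
  assume "\<xi> (- i) \<one> \<in> coboundaries Q (- i)"
  then obtain y where y: "y \<in> carrier (cobj Q (- i - 1))" "\<xi> (- i) \<one> = cdiff Q (- i - 1) y"
    by (auto simp: coboundaries_def)
  let ?h = "\<lambda>n r. if n = - i then y \<cdot>\<^bsub>cobj Q (n - 1)\<^esub> r else \<zero>\<^bsub>cobj Q (n - 1)\<^esub>"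
  note h = stalk_scale_hm[of "\<lambda>n. cobj Q (n - 1)", OF cpx_md[OF Q] y(1)]
  have "hot (stalk i) Q \<xi> (chain_zero Q)"
  proof (rule hotI[OF h])
    fix n r assume r: "r \<in> carrier (cobj (stalk i) n)"
    have h0: "?h (n + 1) (cdiff (stalk i) n r) = \<zero>\<^bsub>cobj Q n\<^esub>"
      using hm_simps(3)[OF h cpx_md[OF T] cpx_md[OF Q], of "n + 1"]
      by (simp add: cobj_shift_stalk cdiff_shift_stalk split: if_splits)
    have "\<xi> n r = cdiff Q (n - 1) (?h n r)"
    proof (cases "n = - i")
      case True
      then have r': "r \<in> carrier R" using r by (simp add: cobj_shift_stalk)
      then have "\<xi> n r = \<xi> n \<one> \<cdot>\<^bsub>cobj Q n\<^esub> r"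
        using \<xi>s(5)[of \<one> n r] True by (simp add: cobj_shift_stalk)
      then show ?thesis using True y cpx_simps(6)[OF Q y(1) r'] by simp
    next
      case False
      then have "r = \<zero>\<^bsub>cobj (stalk i) n\<^esub>" using r by (simp add: cobj_shift_stalk)
      then show ?thesis using False \<xi>s(3)[of n] by (simp add: cpx_simps[OF Q])
    qed
    then show "\<xi> n r = chain_zero Q n r \<oplus>\<^bsub>cobj Q n\<^esub>
        (cdiff Q (n - 1) (?h n r) \<oplus>\<^bsub>cobj Q n\<^esub> ?h (n + 1) (cdiff (stalk i) n r))"
      unfolding h0 using \<xi>s(1)[OF r] by (simp add: chain_zero_def Qm)
  qed
  then show "hq (stalk i) Q \<xi> (chain_zero Q)" using \<xi> T Q cm_zero by (simp add: hq_def)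
qed

text \<open>Being a ghost is tested on maps from the shifts of \<open>R\<close>, and these are
  cocycles of the resolution up to coboundaries.\<close>

lemma generating_hypothesis_iff_chain_maps:
  "generating_hypothesis R \<longleftrightarrow> (\<forall>P Q f. strictly_perfect P \<longrightarrow> strictly_perfect Q \<longrightarrow> cm P Q f \<longrightarrow>
     (\<forall>n. \<forall>c\<in>cocycles P n. f n c \<in> coboundaries Q n) \<longrightarrow> hot P Q f (chain_zero Q))" (is "_ \<longleftrightarrow> ?G")
proof
  note Ti = shift_stalk_res and Tc = shift_stalk_cpx
  {
    assume gh: "generating_hypothesis R"
    show ?G
    proof (intro allI impI)
      fix P Q f assume P: "strictly_perfect P" and Q: "strictly_perfect Q" and f: "cm P Q f"
        and g: "\<forall>n. \<forall>c\<in>cocycles P n. f n c \<in> coboundaries Q n"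
      note Pi = res_id[OF P] and Qi = res_id[OF Q] and Pc = sp_cpx[OF P] and Qc = sp_cpx[OF Q]
      have "cls P chain_id P Q f = \<one>\<^bsub>dhom R P Q\<^esub>"
      proof (rule gh[unfolded generating_hypothesis_def, rule_format])
        show "cls P chain_id P Q f \<in> carrier (dhom R P Q)" using carrier_dhom[OF Pi Qc] f by blast
        fix i x assume "x \<in> carrier (dhom R (stalk i) P)"
        then obtain \<xi> where \<xi>: "cm (stalk i) P \<xi>" "x = cls (stalk i) chain_id (stalk i) P \<xi>"
          using carrier_dhom[OF Ti Pc] by auto
        have fx: "cm (stalk i) Q (f ** \<xi>)" using cm_comp[OF \<xi>(1) f Tc Pc] .
        have "hq (stalk i) Q (f ** \<xi>) (chain_zero Q)"
          unfolding stalk_map_null_iff[OF Qc fx]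
          using g cm_cocycles[OF \<xi>(1) Tc Pc one_cocycle] by (simp add: chain_comp_def)
        then show "dcomp R (stalk i) P Q (cls P chain_id P Q f) x = \<one>\<^bsub>dhom R (stalk i) Q\<^esub>"
          using dcomp_cls[OF Ti Pi Qc \<xi>(1) f] \<xi>(2) dcomp_one_iff[OF Ti Qi fx] by simp
      qed (use P Q sp_perfect in auto)
      then show "hot P Q f (chain_zero Q)" using dcomp_one_iff[OF Pi Qi f] hqD(5) by simp
    qed
  }
  assume gh: ?G
  show "generating_hypothesis R"
    unfolding generating_hypothesis_def
  proof (intro ballI impI)
    fix X Y \<alpha> assume XY: "X \<in> perfect_complexes R" "Y \<in> perfect_complexes R" "\<alpha> \<in> carrier (dhom R X Y)"
      and g: "\<forall>i. \<forall>x\<in>carrier (dhom R (stalk i) X). dcomp R (stalk i) X Y \<alpha> x = \<one>\<^bsub>dhom R (stalk i) Y\<^esub>"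
    obtain P p where r: "res P p X" using perfect_res[OF XY(1)] by blast
    obtain Q q where q: "res Q q Y" using perfect_res[OF XY(2)] by blast
    note rr = resD[OF r] and qq = resD[OF q]
    obtain \<phi> where \<phi>: "cm P Q \<phi>" "\<alpha> = cls P p X Y (q ** \<phi>)" using cls_surj[OF r q XY(3)] .
    have "\<phi> n c \<in> coboundaries Q n" if c: "c \<in> cocycles P n" for n c
    proof -
      \<comment> \<open>Cohomology in degree \<open>n\<close> is seen by the shift by
        \<open>-n\<close>.\<close>
      define i where "i = - n"
      have n: "n = - i" by (simp add: i_def)
      obtain \<xi> where \<xi>: "cm (stalk i) P \<xi>" "\<xi> (- i) \<one> = c"
        using stalk_map_of_cocycle[OF rr(2) c[unfolded n]] .
      have fx: "cm (stalk i) Q (\<phi> ** \<xi>)" using cm_comp[OF \<xi>(1) \<phi>(1) Tc rr(2)] .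
      have "dcomp R (stalk i) X Y \<alpha> (cls (stalk i) chain_id (stalk i) X (p ** \<xi>)) =
          cls (stalk i) chain_id (stalk i) Y (q ** \<phi> ** \<xi>)"
        using dcomp_cls[OF Ti r qq(3) \<xi>(1) cm_comp[OF \<phi>(1) qq(4) rr(2) qq(2)]] \<phi>(2)
        by (simp add: chain_comp_assoc)
      then have "hq (stalk i) Q (\<phi> ** \<xi>) (chain_zero Q)"
        using g dhom_closed[OF Ti r \<xi>(1)] dcomp_one_iff[OF Ti q fx] by simp
      then show ?thesis
        unfolding stalk_map_null_iff[OF qq(2) fx] using \<xi>(2) n by (simp add: chain_comp_def)
    qed
    then have "hot P Q \<phi> (chain_zero Q)" using gh \<phi>(1) r q by (simp add: res_def)
    then have "hq P Q \<phi> (chain_zero Q)" using \<phi>(1) rr qq cm_zero by (simp add: hq_def)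
    then show "\<alpha> = \<one>\<^bsub>dhom R X Y\<^esub>" using dcomp_one_iff[OF r q \<phi>(1)] \<phi>(2) by simp
  qed
qed

section \<open>Von Neumann regular rings\<close>

text \<open>Von Neumann regularity of \<open>Hom(M, N)\<close>. Allowing two different modules makes
  an induction over direct sums possible in each argument.\<close>

definition all_regular :: "('u, 'u) rmod \<Rightarrow> ('u, 'u) rmod \<Rightarrow> bool" where
  "all_regular M N \<longleftrightarrow> (\<forall>f\<in>hm M N. \<exists>g\<in>hm N M. \<forall>x\<in>carrier M. f (g (f x)) = f x)"

lemma all_regularD: "\<lbrakk>all_regular M N; f \<in> hm M N\<rbrakk> \<Longrightarrow> \<exists>g\<in>hm N M. \<forall>x\<in>carrier M. f (g (f x)) = f x"
  by (simp add: all_regular_def)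

text \<open>McCoy's lemma: if \<open>b = a - a y a\<close> has a quasi-inverse \<open>z\<close>,
  then \<open>a\<close> has the quasi-inverse \<open>w = y + (1 - y a) z (1 - a y)\<close>, because
  \<open>a w a = a y a + b z b\<close>.\<close>

lemma mccoy:
  assumes M: "md M" and N: "md N" and a: "a \<in> hm M N" and y: "y \<in> hm N M" and z: "z \<in> hm N M"
    and b: "\<And>x. x \<in> carrier M \<Longrightarrow> b x = a x \<ominus>\<^bsub>N\<^esub> a (y (a x))"
    and bz: "\<And>x. x \<in> carrier M \<Longrightarrow> b (z (b x)) = b x"
  shows "\<exists>w\<in>hm N M. \<forall>x\<in>carrier M. a (w (a x)) = a x"
proof (intro bexI ballI)
  note s = hm_simps[OF a M N] hm_simps[OF y N M] hm_simps[OF z N M] md_all[OF M] md_all[OF N]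
  let ?t = "\<lambda>n. z (n \<ominus>\<^bsub>N\<^esub> a (y n))"
  let ?w = "\<lambda>n. y n \<oplus>\<^bsub>M\<^esub> (?t n \<ominus>\<^bsub>M\<^esub> y (a (?t n)))"
  have t: "?t \<in> hm N M"
    by (rule hm_comp[OF hm_diff[OF hm_id hm_comp[OF y a] N N] z])
  show "?w \<in> hm N M"
    by (intro hm_add hm_neg hm_diff y t hm_comp[OF hm_comp[OF t a] y] M N)
  fix x assume x: "x \<in> carrier M"
  have tx: "?t (a x) = z (b x)" using x by (simp add: b)
  have c: "z (b x) \<in> carrier M" using x by (simp add: b s)
  have "a (?w (a x)) = a (y (a x)) \<oplus>\<^bsub>N\<^esub> b (z (b x))"
    unfolding tx using x c by (simp add: b[OF c] s)
  also have "\<dots> = a x" unfolding bz[OF x] using x by (simp add: b s)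
  finally show "a (?w (a x)) = a x" .
qed

text \<open>Take for \<open>y\<close> a quasi-inverse of the restriction of \<open>f\<close> to
  \<open>M\<close>. Then \<open>f - f y f\<close> vanishes on \<open>M\<close>, so it is the map
  \<open>?g\<close> on \<open>M'\<close>, which has a quasi-inverse, and \<open>mccoy\<close>
  applies.\<close>

lemma all_regular_dsum_left:
  assumes M: "md M" and M': "md M'" and N: "md N" and 1: "all_regular M N" and 2: "all_regular M' N"
  shows "all_regular (dsum M M') N"
  unfolding all_regular_def
proof
  fix f assume f: "f \<in> hm (dsum M M') N"
  note D = md_dsum[OF M M']
  have f1: "(\<lambda>x. f (pr x \<zero>\<^bsub>M'\<^esub>)) \<in> hm M N" and f2: "(\<lambda>x. f (pr \<zero>\<^bsub>M\<^esub> x)) \<in> hm M' N"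
    by (rule hm_comp[OF hm_in1[OF M M'] f] hm_comp[OF hm_in2[OF M M'] f])+
  obtain y where y: "y \<in> hm N M" "\<And>x. x \<in> carrier M \<Longrightarrow> f (pr (y (f (pr x \<zero>\<^bsub>M'\<^esub>))) \<zero>\<^bsub>M'\<^esub>) = f (pr x \<zero>\<^bsub>M'\<^esub>)"
    using all_regularD[OF 1 f1] by blast
  let ?g = "\<lambda>x. f (pr \<zero>\<^bsub>M\<^esub> x) \<ominus>\<^bsub>N\<^esub> f (pr (y (f (pr \<zero>\<^bsub>M\<^esub> x))) \<zero>\<^bsub>M'\<^esub>)"
  have g: "?g \<in> hm M' N"
    by (intro hm_add hm_neg hm_diff f2 hm_comp[OF hm_comp[OF f2 y(1)] f1] M' N)
  obtain z where z: "z \<in> hm N M'" "\<And>x. x \<in> carrier M' \<Longrightarrow> ?g (z (?g x)) = ?g x"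
    using all_regularD[OF 2 g] by blast
  note s = hm_simps[OF f1 M N] hm_simps[OF f2 M' N] hm_simps[OF y(1) N M] hm_simps[OF z(1) N M']
    md_all[OF M] md_all[OF M'] md_all[OF N]
  have spl: "f v = f (pr (p1 v) \<zero>\<^bsub>M'\<^esub>) \<oplus>\<^bsub>N\<^esub> f (pr \<zero>\<^bsub>M\<^esub> (p2 v))" if v: "v \<in> carrier (dsum M M')" for v
  proof -
    have "pr (p1 v) \<zero>\<^bsub>M'\<^esub> \<oplus>\<^bsub>dsum M M'\<^esub> pr \<zero>\<^bsub>M\<^esub> (p2 v) = v"
      using v by (simp add: dsum_simps s)
    then show ?thesis
      using v hm_simps(2)[OF f D N, of "pr (p1 v) \<zero>\<^bsub>M'\<^esub>" "pr \<zero>\<^bsub>M\<^esub> (p2 v)"] by (simp add: dsum_simps s)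
  qed
  have y': "(\<lambda>n. pr (y n) \<zero>\<^bsub>M'\<^esub>) \<in> hm N (dsum M M')" by (rule hm_comp[OF y(1) hm_in1[OF M M']])
  have z': "(\<lambda>n. pr \<zero>\<^bsub>M\<^esub> (z n)) \<in> hm N (dsum M M')" by (rule hm_comp[OF z(1) hm_in2[OF M M']])
  have b: "?g (p2 v) = f v \<ominus>\<^bsub>N\<^esub> f (pr (y (f v)) \<zero>\<^bsub>M'\<^esub>)" if v: "v \<in> carrier (dsum M M')" for v
    using v unfolding spl[OF v] by (simp add: dsum_simps s y(2))
  show "\<exists>g\<in>hm N (dsum M M'). \<forall>x\<in>carrier (dsum M M'). f (g (f x)) = f x"
    by (rule mccoy[OF D N f y' z', of "\<lambda>v. ?g (p2 v)", OF b]) (simp_all only: pr_simps dsum_simps z(2))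
qed

text \<open>The dual argument: correcting by a quasi-inverse of the first component leaves a map
  whose first component is zero.\<close>

lemma all_regular_dsum_right:
  assumes M: "md M" and N: "md N" and N': "md N'" and 1: "all_regular M N" and 2: "all_regular M N'"
  shows "all_regular M (dsum N N')"
  unfolding all_regular_def
proof
  fix f assume f: "f \<in> hm M (dsum N N')"
  note D = md_dsum[OF N N']
  have f1: "(\<lambda>x. p1 (f x)) \<in> hm M N" and f2: "(\<lambda>x. p2 (f x)) \<in> hm M N'"
    by (rule hm_comp[OF f hm_p1] hm_comp[OF f hm_p2])+
  obtain y where y: "y \<in> hm N M" "\<And>x. x \<in> carrier M \<Longrightarrow> p1 (f (y (p1 (f x)))) = p1 (f x)"
    using all_regularD[OF 1 f1] by blast
  let ?g = "\<lambda>x. p2 (f x) \<ominus>\<^bsub>N'\<^esub> p2 (f (y (p1 (f x))))"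
  have g: "?g \<in> hm M N'"
    by (intro hm_add hm_neg hm_diff f2 hm_comp[OF hm_comp[OF f1 y(1)] f2] M N')
  obtain z where z: "z \<in> hm N' M" "\<And>x. x \<in> carrier M \<Longrightarrow> ?g (z (?g x)) = ?g x"
    using all_regularD[OF 2 g] by blast
  note s = hm_simps[OF f1 M N] hm_simps[OF f2 M N'] hm_simps[OF y(1) N M]
    md_all[OF M] md_all[OF N] md_all[OF N']
  have b: "pr \<zero>\<^bsub>N\<^esub> (?g v) = f v \<ominus>\<^bsub>dsum N N'\<^esub> f (y (p1 (f v)))" if v: "v \<in> carrier M" for v
    using v hm_simps(1)[OF f M D] by (simp add: md_simps(16)[OF D] dsum_simps dsum_neg N N' pr_eq s y(2))
  show "\<exists>g\<in>hm (dsum N N') M. \<forall>x\<in>carrier M. f (g (f x)) = f x"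
    by (rule mccoy[OF M D f hm_comp[OF hm_p1 y(1)] hm_comp[OF hm_p2 z(1)], of "\<lambda>v. pr \<zero>\<^bsub>N\<^esub> (?g v)", OF b])
      (simp_all only: pr_simps z(2))
qed

lemma all_regular_zero_left: "md N \<Longrightarrow> all_regular (zero_rmod R) N"
  unfolding all_regular_def
proof
  fix f assume N: "md N" and f: "f \<in> hm (zero_rmod R) N"
  then show "\<exists>g\<in>hm N (zero_rmod R). \<forall>x\<in>carrier (zero_rmod R). f (g (f x)) = f x"
    by (intro bexI[OF _ hm_zero[OF md_zero]]) simp
qed

lemma all_regular_zero_right: "md M \<Longrightarrow> all_regular M (zero_rmod R)"
  unfolding all_regular_def
proof
  fix f assume M: "md M" and f: "f \<in> hm M (zero_rmod R)"
  then have "\<And>x. x \<in> carrier M \<Longrightarrow> f x = \<zero>" using hm_simps(1)[OF f M md_zero] by simp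
  then show "\<exists>g\<in>hm (zero_rmod R) M. \<forall>x\<in>carrier M. f (g (f x)) = f x"
    using md_simps(2)[OF M] by (intro bexI[OF _ hm_zero[OF M]]) simp
qed

context
  assumes vn: "von_neumann_regular R"
begin

text \<open>An endomorphism of the right module \<open>R\<close> is left multiplication by its value
  at one, so regularity of the ring is the case of rank one.\<close>

lemma all_regular_regular: "all_regular (regular_rmod R) (regular_rmod R)"
  unfolding all_regular_def
proof
  interpret ring R by (rule R)
  fix f assume f: "f \<in> hm (regular_rmod R) (regular_rmod R)"
  define x where "x = f \<one>"
  have x: "x \<in> carrier R" using hm_simps(1)[OF f md_regular md_regular] by (simp add: x_def)
  have fx: "f r = x \<otimes> r" if "r \<in> carrier R" for r
    using hm_simps(5)[OF f md_regular md_regular, of "\<one>" r] that by (simp add: x_def)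
  obtain y where y: "y \<in> carrier R" "x = x \<otimes> y \<otimes> x" using vn x by (auto simp: von_neumann_regular_def)
  show "\<exists>g\<in>hm (regular_rmod R) (regular_rmod R). \<forall>r\<in>carrier (regular_rmod R). f (g (f r)) = f r"
  proof (intro bexI ballI)
    show "(\<lambda>r. y \<otimes> r) \<in> hm (regular_rmod R) (regular_rmod R)"
      using smult_hom[OF md_regular, of y] y by simp
    fix r assume r: "r \<in> carrier (regular_rmod R)"
    have "x \<otimes> (y \<otimes> (x \<otimes> r)) = (x \<otimes> y \<otimes> x) \<otimes> r"
      using x y(1) r by (simp add: m_assoc)
    then show "f (y \<otimes> f r) = f r" using x y r by (simp add: fx)
  qed
qed

lemma all_regular_free: "all_regular (free m) (free n)"
proof -
  have "all_regular (regular_rmod R) (free n)" for n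
    by (induction n) (simp_all add: all_regular_zero_right all_regular_dsum_right all_regular_regular
        md_regular md_free)
  then show ?thesis
    by (induction m) (simp_all add: all_regular_zero_left all_regular_dsum_left md_regular md_free)
qed

lemma free_retract:
  fixes P :: "('u, 'u) rmod"
  assumes "projective_rmod R P" "fg_rmod R P"
  obtains k r i where "r \<in> hm (free k) P" "i \<in> hm P (free k)" "\<And>x. x \<in> carrier P \<Longrightarrow> r (i x) = x"
proof -
  note P = proj_md[OF assms(1)]
  obtain k r where r: "r \<in> hm (free k) P" "r ` carrier (free k) = carrier P" using fg_cover[OF P assms(2)] .
  have "\<exists>i\<in>hm P (free k). \<forall>x\<in>carrier P. r (i x) = x"
  proof (rule proj_lift[OF assms(1) md_free P r(1) hm_id])
    fix x assume "x \<in> carrier P"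
    then show "\<exists>y\<in>carrier (free k). r y = x" using r(2) by (metis imageE)
  qed
  then show thesis using that r(1) by blast
qed

text \<open>Finitely generated projectives are retracts of free modules. A quasi-inverse
  \<open>g\<close> of \<open>j f r\<close> between the free modules gives the quasi-inverse
  \<open>r g j\<close> of \<open>f\<close>.\<close>

lemma all_regular_projective:
  assumes P: "projective_rmod R P" "fg_rmod R P" and Q: "projective_rmod R Q" "fg_rmod R Q"
  shows "all_regular P Q"
  unfolding all_regular_def
proof
  fix f assume f: "f \<in> hm P Q"
  note mP = proj_md[OF P(1)] and mQ = proj_md[OF Q(1)]
  obtain k r i where r: "r \<in> hm (free k) P" "i \<in> hm P (free k)" "\<And>x. x \<in> carrier P \<Longrightarrow> r (i x) = x"
    by (rule free_retract[OF P]) (rule that)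
  obtain l s j where s: "s \<in> hm (free l) Q" "j \<in> hm Q (free l)" "\<And>x. x \<in> carrier Q \<Longrightarrow> s (j x) = x"
    by (rule free_retract[OF Q]) (rule that)
  have "(\<lambda>x. j (f (r x))) \<in> hm (free k) (free l)" by (rule hm_comp[OF hm_comp[OF r(1) f] s(2)])
  then obtain g where g: "g \<in> hm (free l) (free k)"
    "\<And>x. x \<in> carrier (free k) \<Longrightarrow> j (f (r (g (j (f (r x)))))) = j (f (r x))"
    using all_regularD[OF all_regular_free] by blast
  note cl = hm_simps(1)[OF r(1) md_free mP] hm_simps(1)[OF r(2) mP md_free] hm_simps(1)[OF s(2) mQ md_free]
    hm_simps(1)[OF f mP mQ] hm_simps(1)[OF g(1) md_free md_free]
  show "\<exists>g\<in>hm Q P. \<forall>x\<in>carrier P. f (g (f x)) = f x"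
  proof (intro bexI ballI)
    show "(\<lambda>x. r (g (j x))) \<in> hm Q P" by (rule hm_comp[OF hm_comp[OF s(2) g(1)] r(1)])
    fix x assume x: "x \<in> carrier P"
    have "s (j (f (r (g (j (f (r (i x)))))))) = s (j (f (r (i x))))" using g(2)[of "i x"] x cl by simp
    then show "f (r (g (j (f x)))) = f x" using x by (simp add: r(3) s(3) cl)
  qed
qed

text \<open>With \<open>d e d = d\<close>, the projection \<open>1 - e d\<close> onto cocycles lifts \<open>f\<close> through \<open>d\<close> to a map \<open>k\<close>;
  the factor \<open>1 - d e\<close> makes the first summand of the homotopy vanish on coboundaries.\<close>

lemma ghost_null_homotopic:
  assumes P: "strictly_perfect P" and Q: "Q \<in> cpx" and f: "cm P Q f"
    and g: "\<And>n c. c \<in> cocycles P n \<Longrightarrow> f n c \<in> coboundaries Q n"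
  shows "hot P Q f (chain_zero Q)"
proof -
  note Pc = sp_cpx[OF P]
  have Pp: "\<And>n. projective_rmod R (cobj P n)" "\<And>n. fg_rmod R (cobj P n)"
    using P by (auto simp: strictly_perfect_def)
  have "\<forall>n. \<exists>e. e \<in> hm (cobj P (n + 1)) (cobj P n) \<and>
      (\<forall>x\<in>carrier (cobj P n). cdiff P n (e (cdiff P n x)) = cdiff P n x)"
    using all_regular_projective[OF Pp Pp] cpx_d[OF Pc refl] unfolding all_regular_def by blast
  then obtain e where e: "\<And>n. e n \<in> hm (cobj P (n + 1)) (cobj P n)"
    and de: "\<And>n x. x \<in> carrier (cobj P n) \<Longrightarrow> cdiff P n (e n (cdiff P n x)) = cdiff P n x" by metis
  note es = hm_simps[OF e cpx_md[OF Pc] cpx_md[OF Pc]]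
  note S = cm_simps[OF f Pc Q] cpx_simps[OF Pc] cpx_simps[OF Q] md_all[OF cpx_md[OF Pc]] md_all[OF cpx_md[OF Q]]
  let ?c = "\<lambda>n x. x \<ominus>\<^bsub>cobj P n\<^esub> e n (cdiff P n x)"
  have c: "?c n \<in> hm (cobj P n) (cobj P n)" for n
    by (intro hm_add hm_neg hm_diff hm_id hm_comp[OF cpx_d[OF Pc refl] e] cpx_md Pc)
  have "\<exists>k\<in>hm (cobj P n) (cobj Q (n - 1)). \<forall>x\<in>carrier (cobj P n). cdiff Q (n - 1) (k x) = f n (?c n x)" for n
  proof (rule proj_lift[OF Pp(1) cpx_md[OF Q] cpx_md[OF Q] cpx_d[OF Q] hm_comp[OF c cm_hm[OF f]]])
    fix x assume x: "x \<in> carrier (cobj P n)"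
    have "?c n x \<in> cocycles P n" using x by (intro cocyclesI) (simp_all add: S es de)
    then show "\<exists>y\<in>carrier (cobj Q (n - 1)). cdiff Q (n - 1) y = f n (?c n x)"
      using g by (fastforce simp: coboundaries_def)
  qed simp
  then obtain k where k: "\<And>n. k n \<in> hm (cobj P n) (cobj Q (n - 1))"
    and dk: "\<And>n x. x \<in> carrier (cobj P n) \<Longrightarrow> cdiff Q (n - 1) (k n x) = f n (?c n x)" by metis
  note ks = deg_simps[OF k Pc Q]
  \<comment> \<open>Reindexed so that \<open>e\<close> has the shape of a map of degree
    \<open>-1\<close>.\<close>
  have e': "e (n - 1) \<in> hm (cobj P n) (cobj P (n - 1))" for n using e[of "n - 1"] by simp
  note es' = deg_simps[OF e' Pc Pc]
  let ?b = "\<lambda>n x. x \<ominus>\<^bsub>cobj P n\<^esub> cdiff P (n - 1) (e (n - 1) x)"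
  have b: "?b n \<in> hm (cobj P n) (cobj P n)" for n
    by (intro hm_add hm_neg hm_diff hm_id hm_comp[OF e' cpx_d[OF Pc]] cpx_md Pc) simp
  let ?h = "\<lambda>n x. k n (?b n x) \<oplus>\<^bsub>cobj Q (n - 1)\<^esub> f (n - 1) (e (n - 1) x)"
  show ?thesis
  proof (rule hotI)
    show "?h n \<in> hm (cobj P n) (cobj Q (n - 1))" for n
      by (intro hm_add hm_comp[OF b k] hm_comp[OF e' cm_hm[OF f]] cpx_md Pc Q)
    fix n x assume x: "x \<in> carrier (cobj P n)"
    have bx: "?b n x \<in> carrier (cobj P n)" using hm_simps(1)[OF b cpx_md[OF Pc] cpx_md[OF Pc]] x .
    have fd: "f n (cdiff P (n - 1) (e (n - 1) x)) = cdiff Q (n - 1) (f (n - 1) (e (n - 1) x))"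
      using cm_simps(6)[OF f Pc Q, of n "n - 1" "e (n - 1) x"] es'(1)[OF refl x] by simp
    \<comment> \<open>As \<open>d (1 - d e) = d\<close>, the composite of \<open>?c\<close> after
      \<open>?b\<close> is \<open>1 - d e - e d\<close>. The term \<open>f d e\<close> it produces
      is cancelled by the second summand of \<open>?h\<close>.\<close>
    have "cdiff P n (?b n x) = cdiff P n x" using x by (simp add: S es')
    then have 1: "cdiff Q (n - 1) (k n (?b n x)) = f n x \<oplus>\<^bsub>cobj Q n\<^esub>
        \<ominus>\<^bsub>cobj Q n\<^esub> cdiff Q (n - 1) (f (n - 1) (e (n - 1) x)) \<ominus>\<^bsub>cobj Q n\<^esub> f n (e n (cdiff P n x))"
      using x bx dk[OF bx] by (simp add: S es es' fd)
    have "k n (?b n x) \<in> carrier (cobj Q (n - 1))" using ks(1)[OF refl bx] .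
    then have dh: "cdiff Q (n - 1) (?h n x) = f n x \<ominus>\<^bsub>cobj Q n\<^esub> f n (e n (cdiff P n x))"
      using x 1 by (simp add: S es es')
    \<comment> \<open>Here \<open>(1 - d e) d = 0\<close>, so only \<open>f e\<close> contributes to
      \<open>?h\<close> on coboundaries.\<close>
    have "?b (n + 1) (cdiff P n x) = \<zero>\<^bsub>cobj P (n + 1)\<^esub>" using x de[OF x] by (simp add: S)
    then have hd: "?h (n + 1) (cdiff P n x) = f n (e n (cdiff P n x))"
      using ks(3)[of "n + 1"] x by (simp add: S es)
    show "f n x = chain_zero Q n x \<oplus>\<^bsub>cobj Q n\<^esub> (cdiff Q (n - 1) (?h n x) \<oplus>\<^bsub>cobj Q n\<^esub> ?h (n + 1) (cdiff P n x))"
      unfolding dh hd using x by (simp add: chain_zero_def S es)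
  qed
qed

lemma generating_hypothesis_of_regular: "generating_hypothesis R"
  unfolding generating_hypothesis_iff_chain_maps using ghost_null_homotopic sp_cpx by blast

end

section \<open>Coherent rings\<close>

lemma free_rmod_sel: "v \<in> carrier (free_rmod R n) \<longleftrightarrow>
    (\<forall>i<n. v i \<in> carrier R) \<and> (\<forall>i. \<not> i < n \<longrightarrow> v i = undefined)"
  "\<zero>\<^bsub>free_rmod R n\<^esub> = (\<lambda>i. if i < n then \<zero> else undefined)"
  "v \<oplus>\<^bsub>free_rmod R n\<^esub> w = (\<lambda>i. if i < n then v i \<oplus> w i else undefined)"
  "v \<cdot>\<^bsub>free_rmod R n\<^esub> r = (\<lambda>i. if i < n then v i \<otimes> r else undefined)"
  by (auto simp: free_rmod_def PiE_def Pi_def extensional_def restrict_def)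

lemma md_free_rmod: "md (free_rmod R n)"
proof -
  interpret ring R by (rule R)
  show ?thesis
  proof (rule mdI)
    fix x assume x: "x \<in> carrier (free_rmod R n)"
    show "\<exists>y\<in>carrier (free_rmod R n). y \<oplus>\<^bsub>free_rmod R n\<^esub> x = \<zero>\<^bsub>free_rmod R n\<^esub>"
      using x by (intro bexI[of _ "\<lambda>i. if i < n then \<ominus> x i else undefined"])
        (simp_all add: free_rmod_sel l_neg fun_eq_iff)
  qed (simp_all add: free_rmod_sel fun_eq_iff a_ac l_distr r_distr m_assoc)
qed

text \<open>Projectivity of \<open>free_rmod\<close> along \<open>R -> x R\<close>. It is proved by
  hand because \<open>projective_rmod\<close> tests modules in one fixed type, whereas
  \<open>free_rmod\<close> and \<open>R\<close> have elements of different types.\<close>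

lemma free_rmod_lift:
  assumes x: "x \<in> carrier R" and \<phi>: "\<phi> \<in> hm (free_rmod R n) (regular_rmod R)"
    and im: "\<And>v. v \<in> carrier (free_rmod R n) \<Longrightarrow> \<exists>r\<in>carrier R. \<phi> v = x \<otimes> r"
  shows "\<exists>\<alpha>\<in>hm (free_rmod R n) (regular_rmod R). \<forall>v\<in>carrier (free_rmod R n). x \<otimes> \<alpha> v = \<phi> v"
proof -
  interpret ring R by (rule R)
  note fs = hm_simps[OF \<phi> md_free_rmod md_regular]
  \<comment> \<open>Truncation to the first \<open>k\<close> coordinates; the lift is built one
    coordinate at a time.\<close>
  define t where "t k v = (\<lambda>i. if i < n then if i < k then v i else \<zero> else undefined)" for k :: nat and v :: "nat \<Rightarrow> 'u"
  have "\<exists>\<alpha>\<in>hm (free_rmod R n) (regular_rmod R). \<forall>v\<in>carrier (free_rmod R n). x \<otimes> \<alpha> v = \<phi> (t k v)"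
    if "k \<le> n" for k
    using that
  proof (induction k)
    case 0
    have "\<phi> (t 0 v) = \<zero>" for v using fs(3) by (simp add: t_def free_rmod_sel cong: if_cong)
    then show ?case using hm_zero[OF md_regular] x by (intro bexI[of _ "\<lambda>v. \<zero>"]) auto
  next
    case (Suc k)
    then obtain \<alpha> where \<alpha>: "\<alpha> \<in> hm (free_rmod R n) (regular_rmod R)"
      "\<And>v. v \<in> carrier (free_rmod R n) \<Longrightarrow> x \<otimes> \<alpha> v = \<phi> (t k v)" by auto
    have kn: "k < n" using Suc.prems by simp
    \<comment> \<open>The basis vector number \<open>k\<close>; a preimage \<open>c\<close> of its
      value under multiplication by \<open>x\<close> is the new coefficient of the lift.\<close>
    let ?u = "\<lambda>i. if i < n then if i = k then \<one> else \<zero> else undefined"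
    have u: "?u \<in> carrier (free_rmod R n)" by (simp add: free_rmod_sel)
    obtain c where c: "c \<in> carrier R" "\<phi> ?u = x \<otimes> c" using im[OF u] by blast
    have ev: "(\<lambda>v. v k) \<in> hm (free_rmod R n) (regular_rmod R)"
      using kn by (intro hmI) (simp_all add: free_rmod_sel)
    have ch: "(\<lambda>v. c \<otimes> v k) \<in> hm (free_rmod R n) (regular_rmod R)"
      using hm_comp[OF ev smult_hom[OF md_regular, of c]] c by simp
    show ?case
    proof (intro bexI ballI)
      show "(\<lambda>v. \<alpha> v \<oplus> c \<otimes> v k) \<in> hm (free_rmod R n) (regular_rmod R)"
        using hm_add[OF \<alpha>(1) ch md_free_rmod md_regular] by simp
      fix v assume v: "v \<in> carrier (free_rmod R n)"
      then have vk: "v k \<in> carrier R" using kn by (simp add: free_rmod_sel)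
      have tv: "t k v \<in> carrier (free_rmod R n)" using v by (simp add: free_rmod_sel t_def)
      have av: "\<alpha> v \<in> carrier R" using hm_simps(1)[OF \<alpha>(1) md_free_rmod md_regular v] by simp
      have uc: "?u \<cdot>\<^bsub>free_rmod R n\<^esub> v k \<in> carrier (free_rmod R n)"
        using md_simps(4)[OF md_free_rmod u vk] .
      have "t (Suc k) v = t k v \<oplus>\<^bsub>free_rmod R n\<^esub> ?u \<cdot>\<^bsub>free_rmod R n\<^esub> v k"
        using v vk by (auto simp: t_def free_rmod_sel fun_eq_iff less_Suc_eq)
      then have "\<phi> (t (Suc k) v) = \<phi> (t k v) \<oplus> \<phi> ?u \<otimes> v k"
        using fs(2)[OF tv uc] fs(5)[OF u vk] by simp
      then show "x \<otimes> (\<alpha> v \<oplus> c \<otimes> v k) = \<phi> (t (Suc k) v)"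
        using \<alpha>(2)[OF v] c x vk av by (simp add: r_distr m_assoc)
    qed
  qed
  from this[OF le_refl] show ?thesis
  proof (elim bexE, intro bexI ballI)
    fix \<alpha> v assume "\<forall>v\<in>carrier (free_rmod R n). x \<otimes> \<alpha> v = \<phi> (t n v)" and v: "v \<in> carrier (free_rmod R n)"
    moreover have "t n v = v" using v by (simp add: t_def free_rmod_sel fun_eq_iff)
    ultimately show "x \<otimes> \<alpha> v = \<phi> v" by simp
  qed
qed

text \<open>Schanuel's lemma for \<open>R \<rightarrow> x R\<close> and a presentation \<open>\<phi>\<close> of \<open>x R\<close>: with \<open>x \<alpha> = \<phi>\<close> and
  \<open>\<phi> \<beta> = x\<close>, the annihilator of \<open>x\<close> is generated by \<open>1 - \<alpha> \<beta>\<close> and \<open>\<alpha> (ker \<phi>)\<close>.\<close>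

lemma annihilator_cover:
  assumes coh: "right_coherent R" and x: "x \<in> carrier R"
  shows "\<exists>k. \<exists>a\<in>hm (free k) (regular_rmod R). a ` carrier (free k) = {r \<in> carrier R. x \<otimes> r = \<zero>}"
proof -
  interpret ring R by (rule R)
  let ?Rm = "regular_rmod R"
  have xh: "(\<lambda>r. x \<otimes> r) \<in> hm ?Rm ?Rm" using smult_hom[OF md_regular, of x] x by simp
  define I where "I = (\<lambda>r. x \<otimes> r) ` carrier R"
  have sI: "submod ?Rm I" using submod_image[OF xh md_regular md_regular] by (simp add: I_def)
  note mI = submod_md[OF md_regular sI]
  have add: "additive_subgroup I R"
  proof -
    have "\<ominus> r \<in> I" if r: "r \<in> I" for r
    proof -
      obtain s where "s \<in> carrier R" "r = x \<otimes> s" using r unfolding I_def by blast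
      then show ?thesis using x by (auto simp: I_def r_minus intro!: image_eqI[of _ _ "\<ominus> s"])
    qed
    then have "subgroup I (add_monoid R)"
      using sI by (intro add.subgroupI) (auto simp: submod_def a_inv_def)
    then show ?thesis by (rule additive_subgroupI)
  qed
  have xI: "x \<in> I" unfolding I_def using x by (intro image_eqI[of _ _ "\<one>"]) auto
  have "fg_rmod R (?Rm\<lparr>carrier := I\<rparr>)"
  proof (rule fgI[OF mI, of "{x}"])
    fix L assume "submod (?Rm\<lparr>carrier := I\<rparr>) L" "{x} \<subseteq> L"
    then show "L = carrier (?Rm\<lparr>carrier := I\<rparr>)" by (auto simp: submod_def I_def)
  qed (use xI in auto)
  then have "fp_rmod R (?Rm\<lparr>carrier := I\<rparr>)"
    using coh add sI unfolding right_coherent_def by (auto simp: submod_def)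
  then obtain n \<phi> where \<phi>: "\<phi> \<in> hm (free_rmod R n) (?Rm\<lparr>carrier := I\<rparr>)"
    and \<phi>I: "\<phi> ` carrier (free_rmod R n) = I"
    and ker: "fg_rmod R ((free_rmod R n)\<lparr>carrier := {v \<in> carrier (free_rmod R n). \<phi> v = \<zero>}\<rparr>)"
    by (auto simp: fp_rmod_def)
  let ?V = "free_rmod R n"
  let ?K = "{v \<in> carrier ?V. \<phi> v = \<zero>}"
  have \<phi>': "\<phi> \<in> hm ?V ?Rm" using \<phi> sI by (auto simp: rmod_hom_def submod_def)
  note fs = hm_simps[OF \<phi>' md_free_rmod md_regular]
  have "\<exists>r\<in>carrier R. \<phi> v = x \<otimes> r" if "v \<in> carrier ?V" for v
    using \<phi>I that by (auto simp: I_def)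
  from free_rmod_lift[OF x \<phi>' this]
  obtain \<alpha> where \<alpha>: "\<alpha> \<in> hm ?V ?Rm" "\<And>v. v \<in> carrier ?V \<Longrightarrow> x \<otimes> \<alpha> v = \<phi> v" by blast
  note as = hm_simps[OF \<alpha>(1) md_free_rmod md_regular]
  obtain \<beta> where \<beta>: "\<beta> \<in> carrier ?V" "\<phi> \<beta> = x" using xI \<phi>I by (metis imageE)
  have "submod ?V ?K"
    using submod_vimage[OF \<phi>' md_free_rmod md_regular, of "{\<zero>}"] by (simp add: submod_def)
  note mK = submod_md[OF md_free_rmod this]
  obtain S where S: "finite S" "S \<subseteq> ?K" "\<And>L. submod (?V\<lparr>carrier := ?K\<rparr>) L \<Longrightarrow> S \<subseteq> L \<Longrightarrow> L = ?K"
    using fgD[OF mK ker] by auto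
  let ?A = "{r \<in> carrier R. x \<otimes> r = \<zero>}"
  have sA: "submod ?Rm ?A"
    using submod_vimage[OF xh md_regular md_regular, of "{\<zero>}"] by (simp add: submod_def)
  \<comment> \<open>It lies in the annihilator, since \<open>x\<close> times
    \<open>\<alpha> \<beta>\<close> is \<open>\<phi> \<beta>\<close>, which is
    \<open>x\<close>.\<close>
  let ?g = "\<one> \<oplus> \<ominus> \<alpha> \<beta>"
  have \<alpha>\<beta>: "\<alpha> \<beta> \<in> carrier R" "x \<otimes> \<alpha> \<beta> = x" using as(1)[OF \<beta>(1)] \<alpha>(2)[OF \<beta>(1)] \<beta>(2) by simp_all
  have "?g \<in> ?A" using \<alpha>\<beta> x by (simp add: r_distr r_minus r_neg)
  moreover have "\<alpha> v \<in> ?A" if "v \<in> ?K" for v using that as(1)[of v] \<alpha>(2)[of v] by simp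
  ultimately have "insert ?g (\<alpha> ` S) \<subseteq> ?A" using S(2) by blast
  then obtain k a where a: "a \<in> hm (free k) ?Rm" "insert ?g (\<alpha> ` S) \<subseteq> a ` carrier (free k)"
    "a ` carrier (free k) \<subseteq> ?A"
    using free_cover[OF md_regular _ _ sA, of "insert ?g (\<alpha> ` S)"] S(1) by auto
  have sa: "submod ?Rm (a ` carrier (free k))" by (rule submod_image[OF a(1) md_free md_regular])
  \<comment> \<open>The elements of the kernel that \<open>\<alpha>\<close> sends into the image of
    \<open>a\<close> form a submodule containing the generators \<open>S\<close>, hence are all of
    the kernel.\<close>
  have "{v \<in> ?K. \<alpha> v \<in> a ` carrier (free k)} = ?K"
  proof (rule S(3))
    have "\<alpha> \<in> hm (?V\<lparr>carrier := ?K\<rparr>) ?Rm" using \<alpha>(1) by (auto simp: rmod_hom_def)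
    from submod_vimage[OF this mK md_regular sa]
    show "submod (?V\<lparr>carrier := ?K\<rparr>) {v \<in> ?K. \<alpha> v \<in> a ` carrier (free k)}" by simp
  qed (use S(2) a(2) in auto)
  then have K: "\<alpha> v \<in> a ` carrier (free k)" if "v \<in> ?K" for v using that by blast
  have "r \<in> a ` carrier (free k)" if r: "r \<in> ?A" for r
  proof -
    have \<beta>r: "\<beta> \<cdot>\<^bsub>?V\<^esub> r \<in> carrier ?V" using md_simps(4)[OF md_free_rmod \<beta>(1)] r by blast
    have "\<phi> (\<beta> \<cdot>\<^bsub>?V\<^esub> r) = \<zero>" using fs(5)[OF \<beta>(1), of r] \<beta>(2) r by simp
    then have 1: "\<alpha> (\<beta> \<cdot>\<^bsub>?V\<^esub> r) \<in> a ` carrier (free k)" using K \<beta>r by blast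
    have 2: "?g \<otimes> r \<in> a ` carrier (free k)" using sa a(2) r by (auto simp: submod_def)
    \<comment> \<open>Every \<open>r\<close> splits as
      \<open>(1 - \<alpha> \<beta>) r + \<alpha> (\<beta> r)\<close>; for \<open>r\<close> in the
      annihilator \<open>\<beta> r\<close> lies in the kernel of \<open>\<phi>\<close>.\<close>
    have "?g \<otimes> r \<oplus> \<alpha> (\<beta> \<cdot>\<^bsub>?V\<^esub> r) = r"
      using as(5)[OF \<beta>(1), of r] r \<alpha>\<beta>(1) by (simp add: l_distr l_minus a_assoc l_neg)
    then show ?thesis using sa 1 2 unfolding submod_def by (metis regular_simps(3))
  qed
  then have "a ` carrier (free k) = ?A" using a(3) by blast
  then show ?thesis using a(1) by blast
qed

section \<open>Two-term complexes and the converse for coherent rings\<close>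

definition two_term :: "int \<Rightarrow> ('u, 'u) rmod \<Rightarrow> ('u, 'u) rmod \<Rightarrow> ('u \<Rightarrow> 'u) \<Rightarrow> 'u cpx" where
  "two_term m M N f = \<lparr>cobj = (\<lambda>n. if n = m then M else if n = m + 1 then N else zero_rmod R),
     cdiff = (\<lambda>n x. if n = m then f x
       else \<zero>\<^bsub>if n + 1 = m then M else if n + 1 = m + 1 then N else zero_rmod R\<^esub>)\<rparr>"

lemma two_term_sel:
  "cobj (two_term m M N f) n = (if n = m then M else if n = m + 1 then N else zero_rmod R)"
  "cdiff (two_term m M N f) n x = (if n = m then f x else \<zero>\<^bsub>cobj (two_term m M N f) (n + 1)\<^esub>)"
  by (simp_all add: two_term_def)

lemma sp_two_term:
  assumes M: "projective_rmod R M" "fg_rmod R M" and N: "projective_rmod R N" "fg_rmod R N"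
    and f: "f \<in> hm M N"
  shows "strictly_perfect (two_term m M N f)"
proof -
  let ?X = "two_term m M N f"
  note mM = proj_md[OF M(1)] and mN = proj_md[OF N(1)]
  have md: "md (cobj ?X n)" for n using mM mN md_zero by (simp add: two_term_sel)
  have d: "cdiff ?X n \<in> hm (cobj ?X n) (cobj ?X (n + 1))" for n
  proof (cases "n = m")
    case True
    then show ?thesis using f by (simp add: two_term_def)
  next
    case False
    then have "cdiff ?X n = (\<lambda>x. \<zero>\<^bsub>cobj ?X (n + 1)\<^esub>)" by (simp add: fun_eq_iff two_term_sel(2))
    then show ?thesis using hm_zero[OF md] by simp
  qed
  have "?X \<in> cpx"
  proof (rule cpxI[OF md d])
    fix n x assume x: "x \<in> carrier (cobj ?X n)"
    show "cdiff ?X (n + 1) (cdiff ?X n x) = \<zero>\<^bsub>cobj ?X (n + 1 + 1)\<^esub>"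
    proof (cases "n + 1 = m")
      case True
      then have "cdiff ?X n x = \<zero>\<^bsub>M\<^esub>" by (simp add: two_term_sel)
      then show ?thesis using True hm_simps(3)[OF f mM mN] by (simp add: two_term_sel)
    next
      case False
      then show ?thesis by (simp add: two_term_sel(2)[of _ _ _ _ "n + 1"])
    qed
  qed
  moreover have "carrier (cobj ?X n) = {\<zero>\<^bsub>cobj ?X n\<^esub>}" if "n \<notin> {m..m + 1}" for n
  proof -
    have "n \<noteq> m" "n \<noteq> m + 1" using that by auto
    then show ?thesis by (simp add: two_term_sel)
  qed
  moreover have "projective_rmod R (cobj ?X n) \<and> fg_rmod R (cobj ?X n)" for n
    using M N proj_zero fg_zero by (simp add: two_term_sel)
  ultimately show ?thesis unfolding strictly_perfect_def by blast
qed

text \<open>For \<open>X = (R \<rightarrow> R)\<close> given by \<open>x\<close> in degrees \<open>-1, 0\<close> and \<open>C = (R^k \<rightarrow> R)\<close> in degrees \<open>-2, -1\<close>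
  with image the annihilator of \<open>x\<close>, the identity in degree \<open>-1\<close> is a ghost \<open>X \<rightarrow> C\<close>. A null homotopy
  yields \<open>1 = a h + y x\<close> with \<open>x a = 0\<close>.\<close>

lemma regular_of_generating_hypothesis:
  assumes coh: "right_coherent R" and gh: "generating_hypothesis R"
  shows "von_neumann_regular R"
  unfolding von_neumann_regular_def
proof
  interpret ring R by (rule R)
  fix x assume x: "x \<in> carrier R"
  let ?Rm = "regular_rmod R"
  obtain k a where a: "a \<in> hm (free k) ?Rm" "a ` carrier (free k) = {r \<in> carrier R. x \<otimes> r = \<zero>}"
    using annihilator_cover[OF coh x] by blast
  have xh: "(\<lambda>r. x \<otimes> r) \<in> hm ?Rm ?Rm" using smult_hom[OF md_regular, of x] x by simp
  let ?X = "two_term (-1) ?Rm ?Rm (\<lambda>r. x \<otimes> r)" and ?C = "two_term (-2) (free k) ?Rm a"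
  have X: "strictly_perfect ?X" by (rule sp_two_term[OF proj_regular fg_regular proj_regular fg_regular xh])
  have C: "strictly_perfect ?C" by (rule sp_two_term[OF free_props proj_regular fg_regular a(1)])
  note Xc = sp_cpx[OF X] and Cc = sp_cpx[OF C]
  let ?f = "\<lambda>n v. if n = -1 then v else \<zero>\<^bsub>cobj ?C n\<^esub>"
  have f: "cm ?X ?C ?f"
  proof (rule cmI)
    fix n
    show "?f n \<in> hm (cobj ?X n) (cobj ?C n)"
    proof (cases "n = -1")
      case True
      then show ?thesis by (simp add: two_term_sel hm_id)
    next
      case False
      then show ?thesis using hm_zero[OF cpx_md[OF Cc]] by simp
    qed
    fix v assume v: "v \<in> carrier (cobj ?X n)"
    consider "n = -2" | "n = -1" | "n \<noteq> -1" "n \<noteq> -2" by blast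
    then show "?f (n + 1) (cdiff ?X n v) = cdiff ?C n (?f n v)"
    proof cases
      case 1
      then show ?thesis using hm_simps(3)[OF a(1) md_free md_regular] by (simp add: two_term_sel)
    qed (simp_all add: two_term_sel)
  qed
  have "hot ?X ?C ?f (chain_zero ?C)"
  proof (rule gh[unfolded generating_hypothesis_iff_chain_maps, rule_format, OF X C f])
    fix n c assume c: "c \<in> cocycles ?X n"
    show "?f n c \<in> coboundaries ?C n"
    proof (cases "n = -1")
      case True
      \<comment> \<open>The cocycles of \<open>?X\<close> in degree \<open>-1\<close> are the
        annihilator of \<open>x\<close>, and \<open>a\<close> was chosen so that these are the
        coboundaries of \<open>?C\<close>.\<close>
      then have "c \<in> carrier R" "x \<otimes> c = \<zero>" using c by (auto simp: cocycles_def two_term_sel)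
      then have "c \<in> a ` carrier (free k)" using a(2) by simp
      then show ?thesis using True by (auto simp: coboundaries_def two_term_sel)
    next
      case False
      then show ?thesis using coboundaries_closed(3)[OF Cc] by simp
    qed
  qed
  then obtain h where t: "htpy ?X ?C ?f (chain_zero ?C) h"
    by (rule hotE)
  note h = htpyD(1)[OF t] and e = htpyD(2)[OF t]
  \<comment> \<open>The homotopy lowers degrees by one: \<open>h 0\<close> goes from the target copy
    of \<open>R\<close> in \<open>?X\<close> to the copy of \<open>R\<close> in \<open>?C\<close>,
    and \<open>h (-1)\<close> goes to the free module.\<close>
  have h0: "h 0 \<in> hm ?Rm ?Rm" and h1: "h (-1) \<in> hm ?Rm (free k)"
    using h[of 0] h[of "-1"] by (simp_all add: two_term_sel)
  define y where "y = h 0 \<one>"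
  define b where "b = a (h (-1) \<one>)"
  have y: "y \<in> carrier R" "h 0 x = y \<otimes> x"
    using hm_simps(1)[OF h0 md_regular md_regular, of "\<one>"]
      hm_simps(5)[OF h0 md_regular md_regular, of "\<one>" x] x by (simp_all add: y_def)
  have "h (-1) \<one> \<in> carrier (free k)" using hm_simps(1)[OF h1 md_regular md_free] by simp
  then have b: "b \<in> carrier R" "x \<otimes> b = \<zero>" using a(2) by (auto simp: b_def)
  \<comment> \<open>The homotopy identity at one in degree \<open>-1\<close>; multiplying it by
    \<open>x\<close> on the left kills \<open>b\<close>.\<close>
  have "\<one> = b \<oplus> y \<otimes> x"
    using e[of "\<one>" "-1"] b(1) y x by (simp add: two_term_sel chain_zero_def b_def)
  then have "x \<otimes> \<one> = x \<otimes> (b \<oplus> y \<otimes> x)" by simp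
  then have "x = x \<otimes> y \<otimes> x" using x y b by (simp add: r_distr m_assoc)
  then show "\<exists>y\<in>carrier R. x = x \<otimes> y \<otimes> x" using y(1) by blast
qed

end

theorem proposition4p9:
  fixes R :: "('u, 'm) ring_scheme"
    and \<iota> :: "'u dmor \<Rightarrow> 'b"
  assumes "ring R"
    and "infinite (UNIV :: 'u set)"
    and "inj \<iota>"
  shows "(generating_hypothesis R \<longleftrightarrow>
            ghost_functors R \<inter> mod_cat (compact_cat R) =
              (zero_functors (compact_cat R) :: ('u cpx, 'u dmor, 'b) cfun set)) \<and>
         (right_coherent R \<longrightarrow>
            (generating_hypothesis R \<longleftrightarrow> von_neumann_regular R))"
proof -
  interpret module_universe R by (rule module_universe.intro) fact+
  show ?thesis
    using generating_hypothesis_iff_ghost_functors[OF assms(3)] regular_of_generating_hypothesis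
      generating_hypothesis_of_regular by blast
qed

end
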